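(* Let $n_1,n_2$ be nonzero natural numbers and let $\omega_1,\omega_2$ be nonzero real numbers with $n_1\omega_2-n_2\omega_1=0$. Let $$L=\begin{pmatrix}0&1&&&&\\0&0&&&&\\&&0&\omega_1&&\\&&-\omega_1&0&&\\&&&&0&\omega_2\\&&&&-\omega_2&0\end{pmatrix}$$ act on $\mathbb{R}^6\cong\mathbb{R}^2\times\mathbb{C}^2$ with coordinates $(x_1,x_2,z_1,z_2)$. Let $a_0,a_1,a_2\in\{1,-1\}$ and consider the involutions $$\phi(x_1,x_2,z_1,z_2)=(x_1,-x_2,\bar z_1,\bar z_2),\qquad \psi(x_1,x_2,z_1,z_2)=(a_0x_1,-a_0x_2,a_1\bar z_1,a_2\bar z_2),$$ both regarded as reversing symmetries. Let $\dot x=F(x)$ be a smooth $\mathbf{Z}_2^\phi\times\mathbf{Z}_2^\psi$-reversible-equivariant system on $\mathbb{R}^6$ with $F(0)=0$ and $(dF)_0=L$. Write $\rho=\mathrm{Re}(z_1^{n_2}\bar z_2^{n_1})$ and $\iota=\mathrm{Im}(z_1^{n_2}\bar z_2^{n_1})$. Then this system is formally conjugate to the following system, according to its type A, B, C or D (types defined in the context in terms of $a_0,a_1,a_2,n_1,n_2$), for some function germs $f_i$ at the origin. Type A: with $f_i:(\mathbb{R}^4,0)\to\mathbb{R}$, $0\le i\le 9$, and $X=(x_1,|z_1|^2,|z_2|^2,\rho)$, \begin{align*} \dot x_1&=x_2+x_1\iota f_0(X),\\ \dot x_2&=f_1(X)+x_2\iota f_0(X),\\ \dot z_1&=-i\omega_1z_1+iz_1f_2(X)+i\bar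 z_1^{n_2-1}z_2^{n_1}f_3(X)+z_1\iota f_4(X)+\bar z_1^{n_2-1}z_2^{n_1}\iota f_5(X),\\ \dot z_2&=-i\omega_2z_2+iz_2f_6(X)+iz_1^{n_2}\bar z_2^{n_1-1}f_7(X)+z_2\iota f_8(X)+z_1^{n_2}\bar z_2^{n_1-1}\iota f_9(X). \end{align*} Type B: with $f_i:(\mathbb{R}^4,0)\to\mathbb{R}$, $0\le i\le 9$, and $X=(x_1,|z_1|^2,|z_2|^2,\rho^2)$, \begin{align*} \dot x_1&=x_2+x_1\rho\iota f_0(X),\\ \dot x_2&=f_1(X)+x_2\rho\iota f_0(X),\\ \dot z_1&=-i\omega_1z_1+iz_1f_2(X)+\bar z_1^{n_2-1}z_2^{n_1}\iota f_3(X)+i\bar z_1^{n_2-1}z_2^{n_1}\rho f_4(X)+z_1\rho\iota f_5(X),\\ \dot z_2&=-i\omega_2z_2+iz_2f_6(X)+z_1^{n_2}\bar z_2^{n_1-1}\iota f_7(X)+iz_1^{n_2}\bar z_2^{n_1-1}\rho f_8(X)+z_2\rho\iota f_9(X). \end{align*} Type C: with $f_i:(\mathbb{R}^4,0)\to\mathbb{R}$, $0\le i\le 9$, and $X=(x_1^2,|z_1|^2,|z_2|^2,\rho)$, \begin{align*} \dot x_1&=x_2+x_1\iota f_0(X),\\ \dot x_2&=x_1f_1(X)+x_2\iota f_0(X),\\ \dot z_1&=-i\omega_1z_1+iz_1f_2(X)+i\bar z_1^{n_2-1}z_2^{n_1}f_3(X)+z_1\iota f_4(X)+\bar z_1^{n_2-1}z_2^{n_1}\iota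 f_5(X),\\ \dot z_2&=-i\omega_2z_2+iz_2f_6(X)+iz_1^{n_2}\bar z_2^{n_1-1}f_7(X)+z_2\iota f_8(X)+z_1^{n_2}\bar z_2^{n_1-1}\iota f_9(X). \end{align*} Type D: with $f_i:(\mathbb{R}^5,0)\to\mathbb{R}$, $0\le i\le 15$, and $X=(x_1^2,|z_1|^2,|z_2|^2,\rho^2,x_1\rho)$, \begin{align*} \dot x_1&=x_2+x_1^2\iota f_0(X)+x_1\rho\iota f_1(X),\\ \dot x_2&=x_1f_2(X)+x_1x_2\iota f_0(X)+\rho f_3(X)+x_2\rho\iota f_1(X),\\ \dot z_1&=-i\omega_1z_1+iz_1f_4(X)+\bar z_1^{n_2-1}z_2^{n_1}\iota f_5(X)+ix_1\bar z_1^{n_2-1}z_2^{n_1}f_6(X)+x_1z_1\iota f_7(X)\\ &\quad+i\bar z_1^{n_2-1}z_2^{n_1}\rho f_8(X)+z_1\rho\iota f_9(X),\\ \dot z_2&=-i\omega_2z_2+iz_2f_{10}(X)+z_1^{n_2}\bar z_2^{n_1-1}\iota f_{11}(X)+ix_1z_1^{n_2}\bar z_2^{n_1-1}f_{12}(X)+x_1z_2\iota f_{13}(X)\\ &\quad+iz_1^{n_2}\bar z_2^{n_1-1}\rho f_{14}(X)+z_2\rho\iota f_{15}(X). \end{align*}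
   Context: The identification $\mathbb{R}^6\cong\mathbb{R}^2\times\mathbb{C}^2$ writes each of the last two pairs of real coordinates $(a,b)$ as $z=a+ib$, so that $L(x_1,x_2,z_1,z_2)=(x_2,0,-i\omega_1z_1,-i\omega_2z_2)$. The system is $\mathbf{Z}_2^\phi\times\mathbf{Z}_2^\psi$-reversible-equivariant if $F(\phi x)=-\phi F(x)$ and $F(\psi x)=-\psi F(x)$ for all $x$. Types. For $a_0=1$: - if $a_1=a_2=1$, type A; - if $a_1=a_2=-1$, type A when $n_1+n_2$ is even and type B when $n_1+n_2$ is odd; - if $a_1=1,a_2=-1$, type A when $n_1$ is even and type B when $n_1$ is odd; - if $a_1=-1,a_2=1$, type A when $n_2$ is even and type B when $n_2$ is odd. For $a_0=-1$: - if $a_1=a_2=1$, type C; - if $a_1=a_2=-1$, type C when $n_1+n_2$ is even and type D when $n_1+n_2$ is odd; - if $a_1=1,a_2=-1$, type C when $n_1$ is even and type D when $n_1$ is odd; - if $a_1=-1,a_2=1$, type C when $n_2$ is even and type D when $n_2$ is odd. Formally conjugate means that the formal Taylor series at the origin of the two systems are conjugate as formal vector fields: there is a formal change of coordinates $x=\Phi(y)$, obtained as the (formal, infinite) composition of successive changes of coordinates $I+\xi_k$, $k\ge2$, with $\xi_k$ a homogeneous polynomial mapping of degree $k$ commuting with $\phi$ and $\psi$, such that $(D\Phi)_{(y)}Y(y)=F(\Phi(y))$ as formal power series, where $Y$ is the right-hand side of the new system. Only the Taylor series of the $f_i$ at $0$ matter.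
   Formalization: The natural numbers n_1, n_2 are additionally assumed coprime (resonance in lowest terms); without this the claim fails, e.g. n_1=n_2=2, ω_1=ω_2=1, all a_i=1, with the term i z_2|z_2|^2 in the equation for z_1. *)

theory Defs
  imports "HOL-Analysis.Analysis" "HOL-Library.Function_Algebras"
begin

section \<open>Formal power series in finitely many variables\<close>

text \<open>Multi-indices are functions \<open>'n \<Rightarrow> nat\<close>, added and compared pointwise.\<close>

typedef 'n mfps = "UNIV :: (('n::finite \<Rightarrow> nat) \<Rightarrow> real) set"
  morphisms mfps_nth Abs_mfps
  by simp

setup_lifting type_definition_mfps

lemma mfps_nth_Abs [simp]: "mfps_nth (Abs_mfps f) = f"
  by (simp add: Abs_mfps_inverse)

lemma mfps_eqI: "(\<And>\<alpha>. mfps_nth f \<alpha> = mfps_nth g \<alpha>) \<Longrightarrow> f = g"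
  by (rule mfps_nth_inject [THEN iffD1], rule ext)

lemma finite_multiindex_le [simp, intro]: "finite {\<beta>. \<beta> \<le> (\<alpha> :: 'n::finite \<Rightarrow> nat)}"
proof (rule finite_subset)
  show "{\<beta>. \<beta> \<le> \<alpha>} \<subseteq> PiE UNIV (\<lambda>i. {..\<alpha> i})"
    by (auto simp: le_fun_def)
  show "finite (PiE UNIV (\<lambda>i. {..\<alpha> i}))"
    by (rule finite_PiE) auto
qed

lemma finite_multiindex_degree [simp, intro]:
  "finite {\<alpha> :: 'n::finite \<Rightarrow> nat. sum \<alpha> UNIV \<le> k}"
proof (rule finite_subset)
  show "{\<alpha> :: 'n \<Rightarrow> nat. sum \<alpha> UNIV \<le> k} \<subseteq> {\<alpha>. \<alpha> \<le> (\<lambda>_. k)}"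
  proof (clarsimp simp: le_fun_def)
    fix \<alpha> :: "'n \<Rightarrow> nat" and i
    assume "sum \<alpha> UNIV \<le> k"
    moreover have "\<alpha> i \<le> sum \<alpha> UNIV"
      by (rule member_le_sum) auto
    ultimately show "\<alpha> i \<le> k"
      by linarith
  qed
qed (rule finite_multiindex_le)

lemma finite_multiindex_degree_eq [simp, intro]:
  "finite {\<alpha> :: 'n::finite \<Rightarrow> nat. sum \<alpha> UNIV = k}"
  by (rule finite_subset[OF _ finite_multiindex_degree[of k]]) auto

lemma finite_multiindex_add:
  "finite {(\<beta>, \<gamma>). \<beta> + \<gamma> = (\<alpha> :: 'n::finite \<Rightarrow> nat)}"
proof (rule finite_subset)
  show "{(\<beta>, \<gamma>). \<beta> + \<gamma> = \<alpha>} \<subseteq> {\<beta>. \<beta> \<le> \<alpha>} \<times> {\<gamma>. \<gamma> \<le> \<alpha>}"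
    by (auto simp: le_fun_def)
  show "finite ({\<beta>. \<beta> \<le> \<alpha>} \<times> {\<gamma>. \<gamma> \<le> \<alpha>})"
    by (intro finite_cartesian_product finite_multiindex_le)
qed

instantiation mfps :: (finite) comm_ring_1
begin

lift_definition zero_mfps :: "'a mfps" is "\<lambda>_. 0" .
lift_definition one_mfps :: "'a mfps" is "\<lambda>\<alpha>. if \<alpha> = 0 then 1 else 0" .
lift_definition plus_mfps :: "'a mfps \<Rightarrow> 'a mfps \<Rightarrow> 'a mfps" is "\<lambda>f g \<alpha>. f \<alpha> + g \<alpha>" .
lift_definition minus_mfps :: "'a mfps \<Rightarrow> 'a mfps \<Rightarrow> 'a mfps" is "\<lambda>f g \<alpha>. f \<alpha> - g \<alpha>" .
lift_definition uminus_mfps :: "'a mfps \<Rightarrow> 'a mfps" is "\<lambda>f \<alpha>. - f \<alpha>" .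
lift_definition times_mfps :: "'a mfps \<Rightarrow> 'a mfps \<Rightarrow> 'a mfps"
  is "\<lambda>f g \<alpha>. \<Sum>(\<beta>, \<gamma>) \<in> {(\<beta>, \<gamma>). \<beta> + \<gamma> = \<alpha>}. f \<beta> * g \<gamma>" .

instance
proof
  fix f g h :: "'a mfps"
  show "f * g * h = f * (g * h)"
  proof (transfer, rule ext)
    fix f g h :: "('a \<Rightarrow> nat) \<Rightarrow> real" and \<alpha>
    have "(\<Sum>(\<beta>, \<gamma>) \<in> {(\<beta>, \<gamma>). \<beta> + \<gamma> = \<alpha>}.
            (\<Sum>(\<mu>, \<nu>) \<in> {(\<mu>, \<nu>). \<mu> + \<nu> = \<beta>}. f \<mu> * g \<nu>) * h \<gamma>)
        = (\<Sum>((\<beta>, \<gamma>), (\<mu>, \<nu>)) \<in> (SIGMA (\<beta>, \<gamma>) : {(\<beta>, \<gamma>). \<beta> + \<gamma> = \<alpha>}. {(\<mu>, \<nu>). \<mu> + \<nu> = \<beta>}).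
             f \<mu> * g \<nu> * h \<gamma>)"
      by (subst sum.Sigma [symmetric])
         (auto simp: finite_multiindex_add [unfolded case_prod_unfold] sum_distrib_right case_prod_unfold)
    also have "\<dots> = (\<Sum>((\<beta>, \<gamma>), (\<mu>, \<nu>)) \<in>
          (SIGMA (\<beta>, \<gamma>) : {(\<beta>, \<gamma>). \<beta> + \<gamma> = \<alpha>}. {(\<mu>, \<nu>). \<mu> + \<nu> = \<gamma>}). f \<beta> * (g \<mu> * h \<nu>))"
      by (rule sum.reindex_bij_witness
            [where i = "\<lambda>((\<beta>, \<gamma>), (\<mu>, \<nu>)). ((\<beta> + \<mu>, \<nu>), (\<beta>, \<mu>))"
               and j = "\<lambda>((\<beta>, \<gamma>), (\<mu>, \<nu>)). ((\<mu>, \<nu> + \<gamma>), (\<nu>, \<gamma>))"])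
         (auto simp: add.assoc mult.assoc)
    also have "\<dots> = (\<Sum>(\<beta>, \<gamma>) \<in> {(\<beta>, \<gamma>). \<beta> + \<gamma> = \<alpha>}.
            f \<beta> * (\<Sum>(\<mu>, \<nu>) \<in> {(\<mu>, \<nu>). \<mu> + \<nu> = \<gamma>}. g \<mu> * h \<nu>))"
      by (subst sum.Sigma [symmetric])
         (auto simp: finite_multiindex_add [unfolded case_prod_unfold] sum_distrib_left case_prod_unfold)
    finally show "(\<Sum>(\<beta>, \<gamma>) \<in> {(\<beta>, \<gamma>). \<beta> + \<gamma> = \<alpha>}.
            (\<Sum>(\<mu>, \<nu>) \<in> {(\<mu>, \<nu>). \<mu> + \<nu> = \<beta>}. f \<mu> * g \<nu>) * h \<gamma>)
        = (\<Sum>(\<beta>, \<gamma>) \<in> {(\<beta>, \<gamma>). \<beta> + \<gamma> = \<alpha>}.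
            f \<beta> * (\<Sum>(\<mu>, \<nu>) \<in> {(\<mu>, \<nu>). \<mu> + \<nu> = \<gamma>}. g \<mu> * h \<nu>))" .
  qed
  show "f * g = g * f"
  proof (transfer, rule ext)
    fix f g :: "('a \<Rightarrow> nat) \<Rightarrow> real" and \<alpha>
    show "(\<Sum>(\<beta>, \<gamma>) \<in> {(\<beta>, \<gamma>). \<beta> + \<gamma> = \<alpha>}. f \<beta> * g \<gamma>)
        = (\<Sum>(\<beta>, \<gamma>) \<in> {(\<beta>, \<gamma>). \<beta> + \<gamma> = \<alpha>}. g \<beta> * f \<gamma>)"
      by (rule sum.reindex_bij_witness[where i = prod.swap and j = prod.swap])
         (auto simp: add.commute)
  qed
  show "1 * f = f"
  proof (transfer, rule ext)
    fix f :: "('a \<Rightarrow> nat) \<Rightarrow> real" and \<alpha>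
    have "(\<Sum>(\<beta>, \<gamma>) \<in> {(\<beta>, \<gamma>). \<beta> + \<gamma> = \<alpha>}. (if \<beta> = 0 then 1 else 0) * f \<gamma>)
        = (\<Sum>(\<beta>, \<gamma>) \<in> {(0 :: 'a \<Rightarrow> nat, \<alpha>)}. (if \<beta> = 0 then 1 else 0) * f \<gamma>)"
      by (rule sum.mono_neutral_right) (auto simp: finite_multiindex_add split: if_splits)
    then show "(\<Sum>(\<beta>, \<gamma>) \<in> {(\<beta>, \<gamma>). \<beta> + \<gamma> = \<alpha>}. (if \<beta> = 0 then 1 else 0) * f \<gamma>) = f \<alpha>"
      by simp
  qed
  show "(f + g) * h = f * h + g * h"
    by transfer (simp add: fun_eq_iff distrib_right case_prod_unfold sum.distrib)
  show "(0 :: 'a mfps) \<noteq> 1"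
    by (transfer, metis zero_neq_one)
  show "f + g + h = f + (g + h)" "f + g = g + f" "0 + f = f" "- f + f = 0" "f - g = f + - g"
    by (transfer, simp add: fun_eq_iff)+
qed

end

lemma mfps_nth_times:
  "mfps_nth (f * g) \<alpha> = (\<Sum>(\<beta>, \<gamma>) \<in> {(\<beta>, \<gamma>). \<beta> + \<gamma> = \<alpha>}. mfps_nth f \<beta> * mfps_nth g \<gamma>)"
  by (simp add: times_mfps.rep_eq)

definition mfps_deriv :: "'n::finite \<Rightarrow> 'n mfps \<Rightarrow> 'n mfps" where
  "mfps_deriv j f = Abs_mfps (\<lambda>\<alpha>. real (Suc (\<alpha> j)) * mfps_nth f (\<alpha>(j := Suc (\<alpha> j))))"

text \<open>
  Substitution \<open>g(\<Phi>)\<close>.  It is only meaningful when every component of \<open>\<Phi>\<close> has zero constant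
  term: then \<open>\<Phi>\<^sup>\<beta>\<close> has no terms of degree below \<open>|\<beta>|\<close>, so the terms of \<open>\<Sum>\<^sub>\<beta> g\<^sub>\<beta> \<Phi>\<^sup>\<beta>\<close> contributing
  to the coefficient \<open>\<alpha>\<close> are among those with \<open>|\<beta>| \<le> |\<alpha>|\<close>.
\<close>
definition mfps_subst :: "'n::finite mfps \<Rightarrow> ('n \<Rightarrow> 'm::finite mfps) \<Rightarrow> 'm mfps" where
  "mfps_subst g \<Phi> = Abs_mfps (\<lambda>\<alpha>. \<Sum>\<beta> | sum \<beta> UNIV \<le> sum \<alpha> UNIV.
      mfps_nth g \<beta> * mfps_nth (\<Prod>i\<in>UNIV. \<Phi> i ^ \<beta> i) \<alpha>)"


section \<open>Smooth maps and Taylor series at the origin\<close>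

definition partial :: "'n::finite \<Rightarrow> (real^'n \<Rightarrow> 'b::real_normed_vector) \<Rightarrow> real^'n \<Rightarrow> 'b" where
  "partial i f = (\<lambda>x. frechet_derivative f (at x) (axis i 1))"

text \<open>
  \<open>C\<^sup>\<infinity>\<close> on the set \<open>S\<close> (used for open \<open>S\<close>): every iterated partial derivative exists and is
  differentiable, hence also continuous.
\<close>
definition smooth_on :: "(real^'n::finite) set \<Rightarrow> (real^'n \<Rightarrow> 'b::real_normed_vector) \<Rightarrow> bool" where
  "smooth_on S f \<longleftrightarrow> (\<forall>is. \<forall>x\<in>S. foldr partial is f differentiable (at x))"

text \<open>\<open>f\<close> represents a smooth function germ at the origin; its values away from \<open>0\<close> are irrelevant.\<close>
definition smooth_germ :: "(real^'n::finite \<Rightarrow> 'b::real_normed_vector) \<Rightarrow> bool" where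
  "smooth_germ f \<longleftrightarrow> (\<exists>U. open U \<and> 0 \<in> U \<and> smooth_on U f)"

text \<open>
  \<open>\<partial>\<^sup>\<alpha> f\<close>.  The order of differentiation is irrelevant for smooth functions, so an arbitrary
  enumeration of the coordinates is used.
\<close>
definition multi_partial ::
    "('n::finite \<Rightarrow> nat) \<Rightarrow> (real^'n \<Rightarrow> 'b::real_normed_vector) \<Rightarrow> real^'n \<Rightarrow> 'b" where
  "multi_partial \<alpha> f = foldr (\<lambda>i. partial i ^^ \<alpha> i) (SOME js. distinct js \<and> set js = UNIV) f"

definition taylor :: "(real^'n::finite \<Rightarrow> real) \<Rightarrow> 'n mfps" where
  "taylor f = Abs_mfps (\<lambda>\<alpha>. multi_partial \<alpha> f 0 / (\<Prod>i\<in>UNIV. fact (\<alpha> i)))"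

definition taylor_map ::
    "(real^'n::finite \<Rightarrow> real^'m::finite) \<Rightarrow> 'm \<Rightarrow> 'n mfps" where
  "taylor_map F i = taylor (\<lambda>x. F x $ i)"


section \<open>Formal conjugacy\<close>

definition homogeneous_poly_map :: "nat \<Rightarrow> (real^'n::finite \<Rightarrow> real^'n) \<Rightarrow> bool" where
  "homogeneous_poly_map k \<xi> \<longleftrightarrow>
     (\<exists>c. \<forall>x i. \<xi> x $ i = (\<Sum>\<alpha> | sum \<alpha> UNIV = k. c i \<alpha> * (\<Prod>j\<in>UNIV. (x $ j) ^ \<alpha> j)))"

text \<open>
  \<open>successive_changes \<xi> m\<close> is the formal composition
  \<open>(I + \<xi>\<^sub>2) \<circ> (I + \<xi>\<^sub>3) \<circ> \<dots> \<circ> (I + \<xi>\<^sub>m\<^sub>+\<^sub>1)\<close> of the first \<open>m\<close> changes of coordinates.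
\<close>
primrec successive_changes ::
    "(nat \<Rightarrow> real^'n::finite \<Rightarrow> real^'n) \<Rightarrow> nat \<Rightarrow> 'n \<Rightarrow> 'n mfps" where
  "successive_changes \<xi> 0 = taylor_map (\<lambda>x. x)"
| "successive_changes \<xi> (Suc m) =
     (\<lambda>i. mfps_subst (successive_changes \<xi> m i) (taylor_map (\<lambda>x. x + \<xi> (m + 2) x)))"

text \<open>
  \<open>\<Phi>\<close> is the infinite formal composition of the changes \<open>I + \<xi>\<^sub>k\<close>, \<open>k \<ge> 2\<close>, each \<open>\<xi>\<^sub>k\<close> commuting with
  the maps in \<open>\<Gamma>\<close>.  The composition converges coefficientwise: each coefficient is eventually constant.
\<close>
definition formal_change_of_coordinates ::
    "(real^'n::finite \<Rightarrow> real^'n) set \<Rightarrow> ('n \<Rightarrow> 'n mfps) \<Rightarrow> bool" where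
  "formal_change_of_coordinates \<Gamma> \<Phi> \<longleftrightarrow>
     (\<exists>\<xi>. (\<forall>k\<ge>2. homogeneous_poly_map k (\<xi> k) \<and> (\<forall>\<gamma>\<in>\<Gamma>. \<forall>x. \<xi> k (\<gamma> x) = \<gamma> (\<xi> k x))) \<and>
          (\<forall>i \<alpha>. \<forall>\<^sub>F m in sequentially.
             mfps_nth (successive_changes \<xi> m i) \<alpha> = mfps_nth (\<Phi> i) \<alpha>))"

text \<open>The identity below is \<open>(D\<Phi>)\<^sub>y Y(y) = F(\<Phi>(y))\<close>, componentwise.\<close>
definition formally_conjugate ::
    "(real^'n::finite \<Rightarrow> real^'n) set \<Rightarrow> (real^'n \<Rightarrow> real^'n) \<Rightarrow> (real^'n \<Rightarrow> real^'n) \<Rightarrow> bool"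
  where
  "formally_conjugate \<Gamma> F Y \<longleftrightarrow>
     (\<exists>\<Phi>. formal_change_of_coordinates \<Gamma> \<Phi> \<and>
          (\<forall>i. (\<Sum>j\<in>UNIV. mfps_deriv j (\<Phi> i) * taylor_map Y j) = mfps_subst (taylor_map F i) \<Phi>))"

definition reversing :: "(real^'n::finite \<Rightarrow> real^'n) \<Rightarrow> (real^'n \<Rightarrow> real^'n) \<Rightarrow> bool" where
  "reversing R F \<longleftrightarrow> (\<forall>x. F (R x) = - R (F x))"


section \<open>The phase space and its symmetries\<close>

text \<open>The identification of \<open>\<real>\<^sup>6\<close> with \<open>\<real>\<^sup>2 \<times> \<complex>\<^sup>2\<close>.\<close>

definition z1 :: "real^6 \<Rightarrow> complex" where "z1 x = Complex (x $ 3) (x $ 4)"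
definition z2 :: "real^6 \<Rightarrow> complex" where "z2 x = Complex (x $ 5) (x $ 6)"

definition pack :: "real \<Rightarrow> real \<Rightarrow> complex \<Rightarrow> complex \<Rightarrow> real^6" where
  "pack x1 x2 w1 w2 = vector [x1, x2, Re w1, Im w1, Re w2, Im w2]"

definition L_matrix :: "real \<Rightarrow> real \<Rightarrow> real^6^6" where
  "L_matrix \<omega>1 \<omega>2 = vector
    [vector [0, 1,   0,  0,   0,  0],
     vector [0, 0,   0,  0,   0,  0],
     vector [0, 0,   0, \<omega>1,   0,  0],
     vector [0, 0, -\<omega>1,  0,   0,  0],
     vector [0, 0,   0,  0,   0, \<omega>2],
     vector [0, 0,   0,  0, -\<omega>2,  0]]"

definition phi :: "real^6 \<Rightarrow> real^6" where
  "phi x = pack (x $ 1) (- (x $ 2)) (cnj (z1 x)) (cnj (z2 x))"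

definition psi :: "real \<Rightarrow> real \<Rightarrow> real \<Rightarrow> real^6 \<Rightarrow> real^6" where
  "psi a0 a1 a2 x = pack (a0 * x $ 1) (- a0 * x $ 2)
                      (of_real a1 * cnj (z1 x)) (of_real a2 * cnj (z2 x))"

lemma vector_6 [simp]:
  fixes a b c d e f :: "'a::zero"
  shows "(vector [a, b, c, d, e, f] :: 'a^6) $ 1 = a"
    and "(vector [a, b, c, d, e, f] :: 'a^6) $ 2 = b"
    and "(vector [a, b, c, d, e, f] :: 'a^6) $ 3 = c"
    and "(vector [a, b, c, d, e, f] :: 'a^6) $ 4 = d"
    and "(vector [a, b, c, d, e, f] :: 'a^6) $ 5 = e"
    and "(vector [a, b, c, d, e, f] :: 'a^6) $ 6 = f"
  by (simp_all add: vector_def)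

lemma exhaust_6: "(x = 1 \<or> x = 2 \<or> x = 3 \<or> x = 4 \<or> x = 5 \<or> x = 6)" for x :: 6
proof (induct x)
  case (of_int z)
  hence "z = 0 \<or> z = 1 \<or> z = 2 \<or> z = 3 \<or> z = 4 \<or> z = 5" by simp presburger
  thus ?case by auto
qed

lemma forall_6: "(\<forall>i::6. P i) \<longleftrightarrow> P 1 \<and> P 2 \<and> P 3 \<and> P 4 \<and> P 5 \<and> P 6"
  by (metis exhaust_6)

lemma UNIV_6: "(UNIV :: 6 set) = {1, 2, 3, 4, 5, 6}"
  using exhaust_6 by auto

lemma sum_6: "sum f (UNIV :: 6 set) = f 1 + f 2 + f 3 + f 4 + f 5 + f 6"
  unfolding UNIV_6 by (subst sum.insert, simp, simp)+ (simp add: ac_simps)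

lemma pack_components [simp]:
  "pack x1 x2 w1 w2 $ 1 = x1" "pack x1 x2 w1 w2 $ 2 = x2"
  "z1 (pack x1 x2 w1 w2) = w1" "z2 (pack x1 x2 w1 w2) = w2"
  by (simp_all add: pack_def z1_def z2_def)

lemma pack_eta [simp]: "pack (x $ 1) (x $ 2) (z1 x) (z2 x) = x"
  by (simp add: pack_def z1_def z2_def vec_eq_iff forall_6)

lemma L_matrix_pack:
  "L_matrix \<omega>1 \<omega>2 *v x = pack (x $ 2) 0 (- \<i> * of_real \<omega>1 * z1 x) (- \<i> * of_real \<omega>2 * z2 x)"
  by (simp add: vec_eq_iff forall_6 L_matrix_def matrix_vector_mult_def sum_6 pack_def
                z1_def z2_def)


section \<open>The four types and their normal forms\<close>

text \<open>
  The numbers \<open>n1\<close>, \<open>n2\<close> describe the resonance \<open>\<omega>1 : \<omega>2 = n1 : n2\<close> in lowest terms (\<open>coprime n1 n2\<close>).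
  This is what makes the monomials below generate all resonant terms: for \<open>n1 = n2 = 2\<close>, for
  instance, the resonant term \<open>\<i> z\<^sub>2 |z\<^sub>2|\<^sup>2\<close> in the equation for \<open>z\<^sub>1\<close> would be missing.
\<close>

datatype nf_type = TypeA | TypeB | TypeC | TypeD

definition system_type :: "real \<Rightarrow> real \<Rightarrow> real \<Rightarrow> nat \<Rightarrow> nat \<Rightarrow> nf_type" where
  "system_type a0 a1 a2 n1 n2 =
     (let plain = (a1 = 1 \<and> a2 = 1) \<or>
                  (a1 = -1 \<and> a2 = -1 \<and> even (n1 + n2)) \<or>
                  (a1 = 1 \<and> a2 = -1 \<and> even n1) \<or>
                  (a1 = -1 \<and> a2 = 1 \<and> even n2)
      in if a0 = 1 then (if plain then TypeA else TypeB)
                   else (if plain then TypeC else TypeD))"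

definition rho :: "nat \<Rightarrow> nat \<Rightarrow> real^6 \<Rightarrow> real" where
  "rho n1 n2 x = Re (z1 x ^ n2 * cnj (z2 x) ^ n1)"

definition iota :: "nat \<Rightarrow> nat \<Rightarrow> real^6 \<Rightarrow> real" where
  "iota n1 n2 x = Im (z1 x ^ n2 * cnj (z2 x) ^ n1)"

definition normal_form_A ::
    "nat \<Rightarrow> nat \<Rightarrow> real \<Rightarrow> real \<Rightarrow> (nat \<Rightarrow> real^4 \<Rightarrow> real) \<Rightarrow> real^6 \<Rightarrow> real^6" where
  "normal_form_A n1 n2 \<omega>1 \<omega>2 f x =
    (let x1 = x $ 1; x2 = x $ 2; w1 = z1 x; w2 = z2 x;
         \<rho> = rho n1 n2 x; \<iota> = iota n1 n2 x;
         X = vector [x1, (cmod w1)\<^sup>2, (cmod w2)\<^sup>2, \<rho>];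
         u1 = cnj w1 ^ (n2 - 1) * w2 ^ n1; u2 = w1 ^ n2 * cnj w2 ^ (n1 - 1)
     in pack
       (x2 + x1 * \<iota> * f 0 X)
       (f 1 X + x2 * \<iota> * f 0 X)
       (- \<i> * \<omega>1 * w1 + \<i> * w1 * f 2 X + \<i> * u1 * f 3 X + w1 * \<iota> * f 4 X + u1 * \<iota> * f 5 X)
       (- \<i> * \<omega>2 * w2 + \<i> * w2 * f 6 X + \<i> * u2 * f 7 X + w2 * \<iota> * f 8 X + u2 * \<iota> * f 9 X))"

definition normal_form_B ::
    "nat \<Rightarrow> nat \<Rightarrow> real \<Rightarrow> real \<Rightarrow> (nat \<Rightarrow> real^4 \<Rightarrow> real) \<Rightarrow> real^6 \<Rightarrow> real^6" where
  "normal_form_B n1 n2 \<omega>1 \<omega>2 f x =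
    (let x1 = x $ 1; x2 = x $ 2; w1 = z1 x; w2 = z2 x;
         \<rho> = rho n1 n2 x; \<iota> = iota n1 n2 x;
         X = vector [x1, (cmod w1)\<^sup>2, (cmod w2)\<^sup>2, \<rho>\<^sup>2];
         u1 = cnj w1 ^ (n2 - 1) * w2 ^ n1; u2 = w1 ^ n2 * cnj w2 ^ (n1 - 1)
     in pack
       (x2 + x1 * \<rho> * \<iota> * f 0 X)
       (f 1 X + x2 * \<rho> * \<iota> * f 0 X)
       (- \<i> * \<omega>1 * w1 + \<i> * w1 * f 2 X + u1 * \<iota> * f 3 X + \<i> * u1 * \<rho> * f 4 X + w1 * \<rho> * \<iota> * f 5 X)
       (- \<i> * \<omega>2 * w2 + \<i> * w2 * f 6 X + u2 * \<iota> * f 7 X + \<i> * u2 * \<rho> * f 8 X + w2 * \<rho> * \<iota> * f 9 X))"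

definition normal_form_C ::
    "nat \<Rightarrow> nat \<Rightarrow> real \<Rightarrow> real \<Rightarrow> (nat \<Rightarrow> real^4 \<Rightarrow> real) \<Rightarrow> real^6 \<Rightarrow> real^6" where
  "normal_form_C n1 n2 \<omega>1 \<omega>2 f x =
    (let x1 = x $ 1; x2 = x $ 2; w1 = z1 x; w2 = z2 x;
         \<rho> = rho n1 n2 x; \<iota> = iota n1 n2 x;
         X = vector [x1\<^sup>2, (cmod w1)\<^sup>2, (cmod w2)\<^sup>2, \<rho>];
         u1 = cnj w1 ^ (n2 - 1) * w2 ^ n1; u2 = w1 ^ n2 * cnj w2 ^ (n1 - 1)
     in pack
       (x2 + x1 * \<iota> * f 0 X)
       (x1 * f 1 X + x2 * \<iota> * f 0 X)
       (- \<i> * \<omega>1 * w1 + \<i> * w1 * f 2 X + \<i> * u1 * f 3 X + w1 * \<iota> * f 4 X + u1 * \<iota> * f 5 X)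
       (- \<i> * \<omega>2 * w2 + \<i> * w2 * f 6 X + \<i> * u2 * f 7 X + w2 * \<iota> * f 8 X + u2 * \<iota> * f 9 X))"

definition normal_form_D ::
    "nat \<Rightarrow> nat \<Rightarrow> real \<Rightarrow> real \<Rightarrow> (nat \<Rightarrow> real^5 \<Rightarrow> real) \<Rightarrow> real^6 \<Rightarrow> real^6" where
  "normal_form_D n1 n2 \<omega>1 \<omega>2 f x =
    (let x1 = x $ 1; x2 = x $ 2; w1 = z1 x; w2 = z2 x;
         \<rho> = rho n1 n2 x; \<iota> = iota n1 n2 x;
         X = vector [x1\<^sup>2, (cmod w1)\<^sup>2, (cmod w2)\<^sup>2, \<rho>\<^sup>2, x1 * \<rho>];
         u1 = cnj w1 ^ (n2 - 1) * w2 ^ n1; u2 = w1 ^ n2 * cnj w2 ^ (n1 - 1)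
     in pack
       (x2 + x1\<^sup>2 * \<iota> * f 0 X + x1 * \<rho> * \<iota> * f 1 X)
       (x1 * f 2 X + x1 * x2 * \<iota> * f 0 X + \<rho> * f 3 X + x2 * \<rho> * \<iota> * f 1 X)
       (- \<i> * \<omega>1 * w1 + \<i> * w1 * f 4 X + u1 * \<iota> * f 5 X + \<i> * x1 * u1 * f 6 X + x1 * w1 * \<iota> * f 7 X
          + \<i> * u1 * \<rho> * f 8 X + w1 * \<rho> * \<iota> * f 9 X)
       (- \<i> * \<omega>2 * w2 + \<i> * w2 * f 10 X + u2 * \<iota> * f 11 X + \<i> * x1 * u2 * f 12 X + x1 * w2 * \<iota> * f 13 X
          + \<i> * u2 * \<rho> * f 14 X + w2 * \<rho> * \<iota> * f 15 X))"

end

theory Submission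
  imports Defs
begin

text \<open>
  The coordinate change is built degree by degree. At degree \<open>k\<close> one has to solve
  \<open>h = ad\<^sub>L \<xi> + Y\<close> for a homogeneous reversing field \<open>h\<close>, with \<open>ad\<^sub>L \<xi> = D\<xi> L - L \<xi>\<close>. On complex
  monomials \<open>ad\<^sub>L\<close> is a scalar (the frequency mismatch) plus the nilpotent operator induced by
  \<open>x\<^sub>2 \<partial>/\<partial>x\<^sub>1\<close>, so an explicit \<open>\<xi>\<close> removes everything except resonant terms free of \<open>x\<^sub>2\<close> and multiples
  of \<open>(x\<^sub>1, x\<^sub>2)\<close>. Since \<open>coprime n1 n2\<close>, resonant terms are generated by \<open>|z\<^sub>1|\<^sup>2\<close>, \<open>|z\<^sub>2|\<^sup>2\<close> and
  \<open>z1 ^ n2 * cnj z2 ^ n1 = \<rho> + \<i>\<iota>\<close>, with \<open>\<iota>\<^sup>2\<close> eliminated; every generator has a definite parity under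
  \<open>\<phi>\<close> and \<open>\<psi>\<phi>\<close>, and projecting onto the correct parity leaves exactly the listed normal forms. The
  formal coefficient series are realised by smooth germs through Borel's lemma.
\<close>

section \<open>Formal power series: grading, derivations, substitution\<close>

text \<open>Several mismatches shape the proof. Solving the homological equation on monomials gives
  a solution of no particular degree or parity; both are restored afterwards by projecting the
  equation, since projections onto sets of exponents intertwine with \<open>hom_op\<close>. Likewise
  every degree of the normal form comes with its own, independently chosen coefficient series, and
  these are merged into one by the weights of the invariants. Functions and series are linked by a
  predicate that compares iterated derivatives with formal ones taken in the same order, so the
  symmetry of mixed partial derivatives never has to be established. Complex series are kept as
  pairs of real ones, because the coefficients and spans in question are real.\<close>

definition mdeg :: "('n::finite \<Rightarrow> nat) \<Rightarrow> nat" where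
  "mdeg \<alpha> = sum \<alpha> UNIV"

lemma finite_mdeg [simp, intro]: "finite {\<alpha> :: 'n::finite \<Rightarrow> nat. mdeg \<alpha> \<le> k}"
  "finite {\<alpha> :: 'n::finite \<Rightarrow> nat. mdeg \<alpha> = k}"
  unfolding mdeg_def by auto

definition unit_idx :: "'n \<Rightarrow> 'n \<Rightarrow> nat" where
  "unit_idx i = (\<lambda>j. if j = i then 1 else 0)"

lemma unit_idx_apply [simp]: "unit_idx i i = 1" "j \<noteq> i \<Longrightarrow> unit_idx i j = 0"
  by (simp_all add: unit_idx_def)

lemma unit_idx_eq_iff [simp]: "unit_idx i = unit_idx j \<longleftrightarrow> i = j"
  by (metis unit_idx_apply zero_neq_one)

lemma unit_idx_neq_0 [simp]: "unit_idx i \<noteq> 0" "0 \<noteq> unit_idx i"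
  by (metis unit_idx_apply(1) zero_fun_apply zero_neq_one)+

lemma mdeg_unit_idx [simp]: "mdeg (unit_idx i) = 1"
  by (simp add: unit_idx_def mdeg_def)

lemma mdeg_zero [simp]: "mdeg 0 = 0"
  by (simp add: mdeg_def zero_fun_def)

lemma mdeg_add [simp]: "mdeg (\<alpha> + \<beta>) = mdeg \<alpha> + mdeg \<beta>"
  by (simp add: mdeg_def sum.distrib)

lemma mdeg_eq_0 [simp]: "mdeg \<alpha> = 0 \<longleftrightarrow> \<alpha> = 0"
  by (auto simp: mdeg_def fun_eq_iff)

lemma mdeg_eq_SucE:
  assumes "mdeg \<alpha> = Suc k"
  obtains i \<beta> where "\<alpha> = unit_idx i + \<beta>" "mdeg \<beta> = k"
proof -
  obtain i where i: "\<alpha> i \<noteq> 0"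
    using assms by (metis mdeg_eq_0 Zero_neq_Suc zero_fun_apply ext)
  define \<beta> where "\<beta> = \<alpha>(i := \<alpha> i - 1)"
  have eq: "\<alpha> = unit_idx i + \<beta>"
    using i by (auto simp: fun_eq_iff \<beta>_def unit_idx_def)
  then have "mdeg \<alpha> = 1 + mdeg \<beta>"
    by (metis mdeg_add mdeg_unit_idx)
  with eq assms that show thesis
    by auto
qed

lemma mdeg_eq_1E:
  assumes "mdeg \<alpha> = 1"
  obtains i where "\<alpha> = unit_idx i"
proof -
  obtain i \<beta> where "\<alpha> = unit_idx i + \<beta>" "mdeg \<beta> = 0"
    using mdeg_eq_SucE[of \<alpha> 0] assms by auto
  then show thesis
    using that by simp
qed

text \<open>The induction scheme for power products: one factor is peeled off at a time.\<close>

lemma mdeg_Suc_induct [case_names zero add]: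
  assumes "P 0" and "\<And>i \<beta>. P \<beta> \<Longrightarrow> P (unit_idx i + \<beta>)"
  shows "P (\<alpha> :: 'n::finite \<Rightarrow> nat)"
proof (induction "mdeg \<alpha>" arbitrary: \<alpha>)
  case 0
  then have "\<alpha> = 0" by simp
  then show ?case using assms(1) by (simp only:)
next
  case (Suc k)
  obtain i \<beta> where "\<alpha> = unit_idx i + \<beta>" "mdeg \<beta> = k"
    using mdeg_eq_SucE[OF Suc.hyps(2)[symmetric]] .
  with Suc.hyps(1)[of \<beta>] assms(2) show ?case by simp
qed

lemma unit_idx_add_dec: "\<beta> j \<noteq> 0 \<Longrightarrow> unit_idx j + \<beta>(j := \<beta> j - 1) = \<beta>"
  by (auto simp: fun_eq_iff unit_idx_def)

lemma dec_unit_idx_add: "(unit_idx j + \<beta>)(j := (unit_idx j + \<beta>) j - 1) = \<beta>"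
  by (auto simp: fun_eq_iff unit_idx_def)

lemma fun_upd_Suc_eq: "\<alpha>(j := Suc (\<alpha> j)) = unit_idx j + \<alpha>"
  by (auto simp: fun_eq_iff unit_idx_def)


section \<open>Real algebra structure, coefficients and monomials\<close>

instantiation mfps :: (finite) real_algebra_1
begin

lift_definition scaleR_mfps :: "real \<Rightarrow> 'a mfps \<Rightarrow> 'a mfps" is "\<lambda>c f \<alpha>. c * f \<alpha>" .

lemma nth_scaleR_mfps: "mfps_nth (c *\<^sub>R f) \<alpha> = c * mfps_nth f \<alpha>"
  by transfer simp

instance
proof
  fix c d :: real and f g :: "'a mfps"
  show "c *\<^sub>R (f + g) = c *\<^sub>R f + c *\<^sub>R g" "(c + d) *\<^sub>R f = c *\<^sub>R f + d *\<^sub>R f"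
       "c *\<^sub>R d *\<^sub>R f = (c * d) *\<^sub>R f" "1 *\<^sub>R f = f"
    by (rule mfps_eqI; simp add: nth_scaleR_mfps plus_mfps.rep_eq algebra_simps)+
  show *: "c *\<^sub>R f * g = c *\<^sub>R (f * g)" for f g :: "'a mfps"
    by (rule mfps_eqI; simp add: nth_scaleR_mfps mfps_nth_times sum_distrib_left case_prod_unfold mult.assoc)
  show "f * c *\<^sub>R g = c *\<^sub>R (f * g)"
    using *[of g f] by (simp add: mult.commute)
qed

end

lemma nth_simps [simp]:
  "mfps_nth 0 \<alpha> = 0"
  "mfps_nth (f + g) \<alpha> = mfps_nth f \<alpha> + mfps_nth g \<alpha>"
  "mfps_nth (f - g) \<alpha> = mfps_nth f \<alpha> - mfps_nth g \<alpha>"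
  "mfps_nth (- f) \<alpha> = - mfps_nth f \<alpha>"
  "mfps_nth (c *\<^sub>R f) \<alpha> = c * mfps_nth f \<alpha>"
  by (simp_all add: zero_mfps.rep_eq plus_mfps.rep_eq minus_mfps.rep_eq uminus_mfps.rep_eq
        scaleR_mfps.rep_eq)

lemma nth_one: "mfps_nth 1 \<alpha> = (if \<alpha> = 0 then 1 else 0)"
  by (simp add: one_mfps.rep_eq)

lemma nth_sum: "mfps_nth (sum f A) \<alpha> = (\<Sum>a\<in>A. mfps_nth (f a) \<alpha>)"
  by (induction A rule: infinite_finite_induct) auto

lemma nth_times_zero [simp]: "mfps_nth (f * g) 0 = mfps_nth f 0 * mfps_nth g 0"
proof -
  have "{(\<beta>, \<gamma>). \<beta> + \<gamma> = (0 :: 'a \<Rightarrow> nat)} = {(0, 0)}"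
    by (auto simp: fun_eq_iff)
  then show ?thesis by (simp add: mfps_nth_times)
qed


definition mfps_monom :: "('n::finite \<Rightarrow> nat) \<Rightarrow> 'n mfps" where
  "mfps_monom \<alpha> = Abs_mfps (\<lambda>\<beta>. if \<beta> = \<alpha> then 1 else 0)"

lemma nth_mono [simp]: "mfps_nth (mfps_monom \<alpha>) \<beta> = (if \<beta> = \<alpha> then 1 else 0)"
  by (simp add: mfps_monom_def)

lemma mono_0 [simp]: "mfps_monom 0 = 1"
  by (rule mfps_eqI) (simp add: nth_one)

abbreviation mfps_X :: "'n::finite \<Rightarrow> 'n mfps" where
  "mfps_X i \<equiv> mfps_monom (unit_idx i)"

lemma mono_mult: "mfps_monom \<alpha> * mfps_monom \<beta> = mfps_monom (\<alpha> + \<beta>)"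
proof (rule mfps_eqI)
  fix \<gamma> :: "'a \<Rightarrow> nat"
  have "mfps_nth (mfps_monom \<alpha> * mfps_monom \<beta>) \<gamma>
      = (\<Sum>p \<in> {(\<mu>, \<nu>). \<mu> + \<nu> = \<gamma>}. if p = (\<alpha>, \<beta>) then 1 else 0)"
    unfolding mfps_nth_times by (rule sum.cong) (auto split: if_splits)
  also have "\<dots> = (if \<alpha> + \<beta> = \<gamma> then 1 else 0)"
    by (subst sum.delta) (auto simp: finite_multiindex_add)
  finally show "mfps_nth (mfps_monom \<alpha> * mfps_monom \<beta>) \<gamma> = mfps_nth (mfps_monom (\<alpha> + \<beta>)) \<gamma>"
    by auto
qed


section \<open>Supports: order, homogeneity and sign parity\<close>

definition supported :: "('n::finite \<Rightarrow> nat) set \<Rightarrow> 'n mfps \<Rightarrow> bool" where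
  "supported A s \<longleftrightarrow> (\<forall>\<alpha>. mfps_nth s \<alpha> \<noteq> 0 \<longrightarrow> \<alpha> \<in> A)"

lemma supportedD: "supported A s \<Longrightarrow> \<alpha> \<notin> A \<Longrightarrow> mfps_nth s \<alpha> = 0"
  by (auto simp: supported_def)

lemma supported_mono: "supported A s \<Longrightarrow> A \<subseteq> B \<Longrightarrow> supported B s"
  by (auto simp: supported_def)

lemma supported_0 [simp]: "supported A 0"
  by (simp add: supported_def)

lemma supported_add: "supported A s \<Longrightarrow> supported A t \<Longrightarrow> supported A (s + t)"
  by (force simp: supported_def)

lemma supported_diff: "supported A s \<Longrightarrow> supported A t \<Longrightarrow> supported A (s - t)"
  by (force simp: supported_def)

lemma supported_uminus: "supported A s \<Longrightarrow> supported A (- s)"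
  by (force simp: supported_def)

lemma supported_scaleR: "supported A s \<Longrightarrow> supported A (c *\<^sub>R s)"
  by (force simp: supported_def)

lemma supported_sum: "(\<And>i. i \<in> I \<Longrightarrow> supported A (f i)) \<Longrightarrow> supported A (sum f I)"
  by (induction I rule: infinite_finite_induct) (auto intro: supported_add)

lemma supported_mult:
  assumes "supported A s" "supported B t" "\<And>\<alpha> \<beta>. \<alpha> \<in> A \<Longrightarrow> \<beta> \<in> B \<Longrightarrow> \<alpha> + \<beta> \<in> C"
  shows "supported C (s * t)"
  unfolding supported_def
proof (intro allI impI)
  fix \<alpha>
  assume "mfps_nth (s * t) \<alpha> \<noteq> 0"
  then obtain \<beta> \<gamma> where "\<beta> + \<gamma> = \<alpha>" "mfps_nth s \<beta> \<noteq> 0" "mfps_nth t \<gamma> \<noteq> 0"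
    unfolding mfps_nth_times by (auto elim!: sum.not_neutral_contains_not_neutral)
  then show "\<alpha> \<in> C"
    using assms unfolding supported_def by blast
qed

lemma supported_monoI: "\<alpha> \<in> A \<Longrightarrow> supported A (mfps_monom \<alpha>)"
  by (simp add: supported_def)


text \<open>Order, homogeneity and, below, sign parity are all support conditions, so that closure
  under the ring operations is proved once for \<open>supported\<close> and then
  specialised.\<close>

definition ord_ge :: "nat \<Rightarrow> 'n::finite mfps \<Rightarrow> bool" where
  "ord_ge m = supported {\<alpha>. m \<le> mdeg \<alpha>}"

definition homogeneous :: "nat \<Rightarrow> 'n::finite mfps \<Rightarrow> bool" where
  "homogeneous k = supported {\<alpha>. mdeg \<alpha> = k}"

lemma ord_geD: "ord_ge m s \<Longrightarrow> mdeg \<alpha> < m \<Longrightarrow> mfps_nth s \<alpha> = 0"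
  unfolding ord_ge_def by (erule supportedD) simp

lemma homD: "homogeneous k s \<Longrightarrow> mdeg \<alpha> \<noteq> k \<Longrightarrow> mfps_nth s \<alpha> = 0"
  unfolding homogeneous_def by (erule supportedD) simp

lemma hom_imp_ord_ge: "homogeneous k s \<Longrightarrow> m \<le> k \<Longrightarrow> ord_ge m s"
  by (auto simp: homogeneous_def ord_ge_def intro: supported_mono)

lemma ord_ge_0 [simp]: "ord_ge 0 s"
  by (simp add: ord_ge_def supported_def)

lemma ord_ge_mono: "ord_ge m s \<Longrightarrow> k \<le> m \<Longrightarrow> ord_ge k s"
  by (auto simp: ord_ge_def intro: supported_mono)

lemma ord_ge_mult: "ord_ge a s \<Longrightarrow> ord_ge b t \<Longrightarrow> ord_ge (a + b) (s * t)"
  unfolding ord_ge_def by (rule supported_mult) auto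

lemma ord_ge_1_iff: "ord_ge 1 s \<longleftrightarrow> mfps_nth s 0 = 0"
  by (auto simp: ord_ge_def supported_def Suc_le_eq simp flip: neq0_conv)

lemmas ord_ge_add = supported_add[of "{\<alpha>. m \<le> mdeg \<alpha>}" for m, folded ord_ge_def]
lemmas ord_ge_diff = supported_diff[of "{\<alpha>. m \<le> mdeg \<alpha>}" for m, folded ord_ge_def]
lemmas ord_ge_sum = supported_sum[of _ "{\<alpha>. m \<le> mdeg \<alpha>}" for m, folded ord_ge_def]
lemmas ord_ge_scaleR = supported_scaleR[of "{\<alpha>. m \<le> mdeg \<alpha>}" for m, folded ord_ge_def]

lemmas hom_add = supported_add[of "{\<alpha>. mdeg \<alpha> = k}" for k, folded homogeneous_def]
lemmas hom_diff = supported_diff[of "{\<alpha>. mdeg \<alpha> = k}" for k, folded homogeneous_def]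
lemmas hom_uminus = supported_uminus[of "{\<alpha>. mdeg \<alpha> = k}" for k, folded homogeneous_def]
lemmas hom_sum = supported_sum[of _ "{\<alpha>. mdeg \<alpha> = k}" for k, folded homogeneous_def]
lemmas hom_scaleR = supported_scaleR[of "{\<alpha>. mdeg \<alpha> = k}" for k, folded homogeneous_def]

lemma hom_mult: "homogeneous a s \<Longrightarrow> homogeneous b t \<Longrightarrow> homogeneous (a + b) (s * t)"
  unfolding homogeneous_def by (rule supported_mult) auto

lemma hom_mono: "mdeg \<alpha> = k \<Longrightarrow> homogeneous k (mfps_monom \<alpha>)"
  unfolding homogeneous_def by (rule supported_monoI) simp

lemma hom_one: "homogeneous 0 1"
  by (simp add: homogeneous_def supported_def nth_one)

lemma hom_power: "homogeneous a s \<Longrightarrow> homogeneous (n * a) (s ^ n)"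
  by (induction n) (auto intro: hom_one hom_mult)

lemma hom_0 [simp]: "homogeneous k 0"
  by (simp add: homogeneous_def)


lemma hom_eq_sum_mono:
  assumes "homogeneous k p"
  shows "p = (\<Sum>\<beta> | mdeg \<beta> = k. mfps_nth p \<beta> *\<^sub>R mfps_monom \<beta>)"
proof (rule mfps_eqI)
  fix \<alpha>
  have "mfps_nth (\<Sum>\<beta> | mdeg \<beta> = k. mfps_nth p \<beta> *\<^sub>R mfps_monom \<beta>) \<alpha>
      = (\<Sum>\<beta> | mdeg \<beta> = k. if \<beta> = \<alpha> then mfps_nth p \<beta> else 0)"
    unfolding nth_sum by (rule sum.cong) auto
  then show "mfps_nth p \<alpha> = mfps_nth (\<Sum>\<beta> | mdeg \<beta> = k. mfps_nth p \<beta> *\<^sub>R mfps_monom \<beta>) \<alpha>"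
    using homD[OF assms, of \<alpha>] by (auto simp: sum.delta')
qed


definition sgn_pow :: "('n::finite \<Rightarrow> real) \<Rightarrow> ('n \<Rightarrow> nat) \<Rightarrow> real" where
  "sgn_pow \<epsilon> \<alpha> = (\<Prod>i\<in>UNIV. \<epsilon> i ^ \<alpha> i)"

lemma sgn_pow_0 [simp]: "sgn_pow \<epsilon> 0 = 1"
  by (simp add: sgn_pow_def)

lemma sgn_pow_add: "sgn_pow \<epsilon> (\<alpha> + \<beta>) = sgn_pow \<epsilon> \<alpha> * sgn_pow \<epsilon> \<beta>"
  by (simp add: sgn_pow_def power_add prod.distrib)

lemma sgn_pow_unit_idx [simp]: "sgn_pow \<epsilon> (unit_idx i) = \<epsilon> i"
proof -
  have "sgn_pow \<epsilon> (unit_idx i) = (\<Prod>j\<in>UNIV. if j = i then \<epsilon> j else 1)"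
    unfolding sgn_pow_def by (rule prod.cong) (auto simp: unit_idx_def)
  then show ?thesis by simp
qed

text \<open>As an identity of series: s(\<epsilon> x) = c s(x), where \<epsilon> x scales coordinate
  i by \<open>\<epsilon> i\<close>. The diagonal map acts on the monomial of exponent \<alpha> by
  the character \<open>sgn_pow \<epsilon> \<alpha>\<close>.\<close>

definition par :: "('n::finite \<Rightarrow> real) \<Rightarrow> real \<Rightarrow> 'n mfps \<Rightarrow> bool" where
  "par \<epsilon> c = supported {\<alpha>. sgn_pow \<epsilon> \<alpha> = c}"

lemmas par_add = supported_add[of "{\<alpha>. sgn_pow \<epsilon> \<alpha> = c}" for \<epsilon> c, folded par_def]
lemmas par_diff = supported_diff[of "{\<alpha>. sgn_pow \<epsilon> \<alpha> = c}" for \<epsilon> c, folded par_def]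
lemmas par_uminus = supported_uminus[of "{\<alpha>. sgn_pow \<epsilon> \<alpha> = c}" for \<epsilon> c, folded par_def]
lemmas par_sum = supported_sum[of _ "{\<alpha>. sgn_pow \<epsilon> \<alpha> = c}" for \<epsilon> c, folded par_def]
lemmas par_scaleR = supported_scaleR[of "{\<alpha>. sgn_pow \<epsilon> \<alpha> = c}" for \<epsilon> c, folded par_def]

lemma par_0 [simp]: "par \<epsilon> c 0"
  by (simp add: par_def)

lemma par_mult: "par \<epsilon> a s \<Longrightarrow> par \<epsilon> b t \<Longrightarrow> par \<epsilon> (a * b) (s * t)"
  unfolding par_def by (rule supported_mult) (auto simp: sgn_pow_add)

lemma par_one: "par \<epsilon> 1 1"
  by (simp add: par_def supported_def nth_one)

lemma par_power: "par \<epsilon> a s \<Longrightarrow> par \<epsilon> (a ^ n) (s ^ n)"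
  by (induction n) (auto intro: par_one par_mult)

lemma par_prod: "(\<And>i. i \<in> I \<Longrightarrow> par \<epsilon> (c i) (f i)) \<Longrightarrow> par \<epsilon> (prod c I) (prod f I)"
  by (induction I rule: infinite_finite_induct) (auto intro: par_one par_mult)

lemma par_XX: "par \<epsilon> (\<epsilon> i) (mfps_X i)"
  unfolding par_def by (rule supported_monoI) simp

lemma parD: "par \<epsilon> c s \<Longrightarrow> sgn_pow \<epsilon> \<alpha> \<noteq> c \<Longrightarrow> mfps_nth s \<alpha> = 0"
  unfolding par_def by (erule supportedD) simp


section \<open>Formal partial derivatives\<close>

lemma nth_deriv: "mfps_nth (mfps_deriv j f) \<alpha> = real (Suc (\<alpha> j)) * mfps_nth f (unit_idx j + \<alpha>)"
  by (simp add: mfps_deriv_def fun_upd_Suc_eq)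

lemma deriv_add: "mfps_deriv j (f + g) = mfps_deriv j f + mfps_deriv j g"
  by (rule mfps_eqI) (simp add: nth_deriv algebra_simps)

lemma deriv_diff: "mfps_deriv j (f - g) = mfps_deriv j f - mfps_deriv j g"
  by (rule mfps_eqI) (simp add: nth_deriv algebra_simps)

lemma deriv_scaleR: "mfps_deriv j (c *\<^sub>R f) = c *\<^sub>R mfps_deriv j f"
  by (rule mfps_eqI) (simp add: nth_deriv algebra_simps)

lemma deriv_0 [simp]: "mfps_deriv j 0 = 0"
  by (rule mfps_eqI) (simp add: nth_deriv)

lemma deriv_one [simp]: "mfps_deriv j 1 = 0"
  by (rule mfps_eqI) (auto simp: nth_deriv nth_one fun_eq_iff unit_idx_def split: if_splits)

lemma deriv_XX: "mfps_deriv j (mfps_X i) = (if i = j then 1 else 0)"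
proof (rule mfps_eqI)
  fix \<alpha> :: "'a \<Rightarrow> nat"
  have "unit_idx j + \<alpha> = unit_idx i \<longleftrightarrow> i = j \<and> \<alpha> = 0"
    by (auto simp: fun_eq_iff unit_idx_def split: if_splits)
  then show "mfps_nth (mfps_deriv j (mfps_X i)) \<alpha> = mfps_nth (if i = j then 1 else 0) \<alpha>"
    by (auto simp: nth_deriv nth_one)
qed

text \<open>The factor \<open>\<beta> j\<close> kills the terms with \<open>\<beta> j = 0\<close>;
  the remaining \<beta> are exactly the shifts by \<open>unit_idx j\<close>.\<close>

lemma shift_sum_multiindex:
  fixes h :: "('n::finite \<Rightarrow> nat) \<Rightarrow> ('n \<Rightarrow> nat) \<Rightarrow> real"
  shows "(\<Sum>(\<beta>, \<gamma>) \<in> {(\<beta>, \<gamma>). \<beta> + \<gamma> = unit_idx j + \<alpha>}. real (\<beta> j) * h \<beta> \<gamma>)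
       = (\<Sum>(\<beta>, \<gamma>) \<in> {(\<beta>, \<gamma>). \<beta> + \<gamma> = \<alpha>}. real (Suc (\<beta> j)) * h (unit_idx j + \<beta>) \<gamma>)"
proof -
  have "(\<Sum>(\<beta>, \<gamma>) \<in> {(\<beta>, \<gamma>). \<beta> + \<gamma> = unit_idx j + \<alpha>}. real (\<beta> j) * h \<beta> \<gamma>)
      = (\<Sum>(\<beta>, \<gamma>) \<in> {(\<beta>, \<gamma>). \<beta> + \<gamma> = unit_idx j + \<alpha> \<and> \<beta> j \<noteq> 0}. real (\<beta> j) * h \<beta> \<gamma>)"
    by (rule sum.mono_neutral_right) (auto simp: finite_multiindex_add)
  also have "\<dots> = (\<Sum>(\<beta>, \<gamma>) \<in> {(\<beta>, \<gamma>). \<beta> + \<gamma> = \<alpha>}. real (Suc (\<beta> j)) * h (unit_idx j + \<beta>) \<gamma>)"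
  proof (rule sum.reindex_bij_witness
      [where i = "\<lambda>(\<beta>, \<gamma>). (unit_idx j + \<beta>, \<gamma>)" and j = "\<lambda>(\<beta>, \<gamma>). (\<beta>(j := \<beta> j - 1), \<gamma>)"],
      goal_cases)
    case (1 p)
    then show ?case using unit_idx_add_dec by fastforce
  next
    case (2 p)
    then obtain \<beta> \<gamma> where p: "p = (\<beta>, \<gamma>)" "\<beta> + \<gamma> = unit_idx j + \<alpha>" "\<beta> j \<noteq> 0"
      by auto
    then have "unit_idx j + (\<beta>(j := \<beta> j - 1) + \<gamma>) = unit_idx j + \<alpha>"
      unfolding add.assoc [symmetric] by (subst unit_idx_add_dec) auto
    then have "\<beta>(j := \<beta> j - 1) + \<gamma> = \<alpha>"
      by (rule add_left_imp_eq)
    then show ?case using p by simp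
  next
    case (3 p)
    then show ?case using dec_unit_idx_add[of j "fst p"] by (auto simp: case_prod_unfold)
  next
    case (4 p)
    then show ?case by (auto simp: add.assoc)
  next
    case (5 p)
    then have "unit_idx j + (fst p)(j := fst p j - 1) = fst p"
      by (intro unit_idx_add_dec) auto
    with 5 show ?case by (auto simp: case_prod_unfold simp del: plus_fun_apply)
  qed
  finally show ?thesis .
qed

lemma deriv_mult: "mfps_deriv j (f * g) = mfps_deriv j f * g + f * mfps_deriv j g"
proof (rule mfps_eqI)
  fix \<alpha> :: "'a \<Rightarrow> nat"
  let ?S = "{(\<beta>, \<gamma>). \<beta> + \<gamma> = unit_idx j + \<alpha>}"
  have "mfps_nth (mfps_deriv j (f * g)) \<alpha>
      = (\<Sum>(\<beta>, \<gamma>) \<in> ?S. real (Suc (\<alpha> j)) * (mfps_nth f \<beta> * mfps_nth g \<gamma>))"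
    by (simp add: nth_deriv mfps_nth_times sum_distrib_left case_prod_unfold)
  \<comment> \<open>On the range of summation \<open>Suc (\<alpha> j)\<close> equals
    \<open>\<beta> j + \<gamma> j\<close>; each summand produces one of the two terms of the Leibniz
    rule.\<close>
  also have "\<dots> = (\<Sum>(\<beta>, \<gamma>) \<in> ?S. real (\<beta> j) * (mfps_nth f \<beta> * mfps_nth g \<gamma>)
                                  + real (\<gamma> j) * (mfps_nth f \<beta> * mfps_nth g \<gamma>))"
  proof (rule sum.cong [OF refl], clarsimp)
    fix \<beta> \<gamma> assume "\<beta> + \<gamma> = unit_idx j + \<alpha>"
    from fun_cong[OF this, of j] have "1 + real (\<alpha> j) = real (\<beta> j) + real (\<gamma> j)"
      by (simp flip: of_nat_add)
    then show "(1 + real (\<alpha> j)) * (mfps_nth f \<beta> * mfps_nth g \<gamma>)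
        = real (\<beta> j) * (mfps_nth f \<beta> * mfps_nth g \<gamma>) + real (\<gamma> j) * (mfps_nth f \<beta> * mfps_nth g \<gamma>)"
      by (simp add: algebra_simps)
  qed
  also have "\<dots> = (\<Sum>(\<beta>, \<gamma>) \<in> ?S. real (\<beta> j) * (mfps_nth f \<beta> * mfps_nth g \<gamma>))
               + (\<Sum>(\<beta>, \<gamma>) \<in> ?S. real (\<gamma> j) * (mfps_nth f \<beta> * mfps_nth g \<gamma>))"
    by (simp add: sum.distrib case_prod_unfold)
  also have "(\<Sum>(\<beta>, \<gamma>) \<in> ?S. real (\<gamma> j) * (mfps_nth f \<beta> * mfps_nth g \<gamma>))
       = (\<Sum>(\<beta>, \<gamma>) \<in> ?S. real (\<beta> j) * (mfps_nth f \<gamma> * mfps_nth g \<beta>))"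
    by (rule sum.reindex_bij_witness[where i = prod.swap and j = prod.swap]) (auto simp: add.commute)
  also have "\<dots> = mfps_nth (mfps_deriv j g * f) \<alpha>"
    unfolding shift_sum_multiindex mfps_nth_times by (rule sum.cong) (auto simp: nth_deriv)
  also have "(\<Sum>(\<beta>, \<gamma>) \<in> ?S. real (\<beta> j) * (mfps_nth f \<beta> * mfps_nth g \<gamma>)) = mfps_nth (mfps_deriv j f * g) \<alpha>"
    unfolding shift_sum_multiindex mfps_nth_times by (rule sum.cong) (auto simp: nth_deriv)
  finally show "mfps_nth (mfps_deriv j (f * g)) \<alpha> = mfps_nth (mfps_deriv j f * g + f * mfps_deriv j g) \<alpha>"
    by (simp add: mult.commute)
qed

lemma supported_deriv:
  assumes "supported A s" "\<And>\<alpha>. unit_idx j + \<alpha> \<in> A \<Longrightarrow> \<alpha> \<in> B"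
  shows "supported B (mfps_deriv j s)"
  using assms by (auto simp: supported_def nth_deriv)

lemma ord_ge_deriv: "ord_ge (Suc k) s \<Longrightarrow> ord_ge k (mfps_deriv j s)"
  unfolding ord_ge_def by (rule supported_deriv) auto

text \<open>Removing a factor x_j divides the sign by \<open>\<epsilon> j\<close>, which is its own
  inverse.\<close>

lemma par_deriv:
  assumes "\<epsilon> j * \<epsilon> j = 1" "par \<epsilon> c s"
  shows "par \<epsilon> (c * \<epsilon> j) (mfps_deriv j s)"
  using assms(2) unfolding par_def
proof (rule supported_deriv)
  fix \<alpha> assume "unit_idx j + \<alpha> \<in> {\<alpha>. sgn_pow \<epsilon> \<alpha> = c}"
  then have "c = \<epsilon> j * sgn_pow \<epsilon> \<alpha>"
    by (simp add: sgn_pow_add)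
  then have "c * \<epsilon> j = (\<epsilon> j * \<epsilon> j) * sgn_pow \<epsilon> \<alpha>"
    by (simp add: mult_ac)
  with assms(1) show "\<alpha> \<in> {\<alpha>. sgn_pow \<epsilon> \<alpha> = c * \<epsilon> j}" by simp
qed


section \<open>Power products and substitution\<close>

definition pw :: "('n::finite \<Rightarrow> 'm::finite mfps) \<Rightarrow> ('n \<Rightarrow> nat) \<Rightarrow> 'm mfps" where
  "pw \<Phi> \<beta> = (\<Prod>i\<in>UNIV. \<Phi> i ^ \<beta> i)"

lemma pw_0 [simp]: "pw \<Phi> 0 = 1"
  by (simp add: pw_def)

lemma pw_unit_add: "pw \<Phi> (unit_idx i + \<beta>) = \<Phi> i * pw \<Phi> \<beta>"
proof -
  have "pw \<Phi> (unit_idx i + \<beta>) = (\<Prod>j\<in>UNIV. (if j = i then \<Phi> j else 1) * \<Phi> j ^ \<beta> j)"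
    unfolding pw_def by (rule prod.cong) (auto simp: unit_idx_def)
  then show ?thesis
    by (simp add: prod.distrib pw_def)
qed

lemma pw_unit [simp]: "pw \<Phi> (unit_idx i) = \<Phi> i"
  using pw_unit_add[of \<Phi> i 0] by simp

lemma pw_XX [simp]: "pw mfps_X \<beta> = mfps_monom \<beta>"
  by (induction \<beta> rule: mdeg_Suc_induct) (simp_all add: pw_unit_add mono_mult del: plus_fun_apply zero_fun_apply)

lemma ord_ge_pw: "(\<And>i. ord_ge 1 (\<Phi> i)) \<Longrightarrow> ord_ge (mdeg \<beta>) (pw \<Phi> \<beta>)"
proof (induction \<beta> rule: mdeg_Suc_induct)
  case (add i \<beta>)
  then show ?case
    using ord_ge_mult[of 1 "\<Phi> i" "mdeg \<beta>" "pw \<Phi> \<beta>"] by (simp add: pw_unit_add del: plus_fun_apply)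
qed (simp del: zero_fun_apply)

lemma par_pw: "(\<And>i. par \<epsilon> (\<epsilon>' i) (\<Phi> i)) \<Longrightarrow> par \<epsilon> (sgn_pow \<epsilon>' \<beta>) (pw \<Phi> \<beta>)"
  unfolding pw_def sgn_pow_def by (intro par_prod par_power) auto

lemma hom_pw:
  assumes "\<And>i. homogeneous (w i) (\<Phi> i)"
  shows "homogeneous (\<Sum>i\<in>UNIV. \<beta> i * w i) (pw \<Phi> \<beta>)"
proof (induction \<beta> rule: mdeg_Suc_induct)
  case (add j \<beta>)
  have "(\<Sum>i\<in>UNIV. (unit_idx j + \<beta>) i * w i) = w j + (\<Sum>i\<in>UNIV. \<beta> i * w i)"
  proof -
    have "(\<Sum>i\<in>UNIV. unit_idx j i * w i) = (\<Sum>i\<in>UNIV. if i = j then w i else 0)"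
      by (rule sum.cong) (auto simp: unit_idx_def)
    then show ?thesis by (simp add: algebra_simps sum.distrib)
  qed
  then show ?case
    using hom_mult[OF assms add] unfolding pw_unit_add by (simp only:)
qed (simp add: hom_one pw_def)

text \<open>The power product with exponent \<beta> starts in degree \<open>mdeg \<beta>\<close>, so
  enlarging the cutoff of the defining sum adds only zeros. A common cutoff N makes coefficients of
  different degrees comparable.\<close>

lemma nth_subst:
  assumes "\<And>i. ord_ge 1 (\<Phi> i)" "mdeg \<alpha> \<le> N"
  shows "mfps_nth (mfps_subst g \<Phi>) \<alpha> = (\<Sum>\<beta> | mdeg \<beta> \<le> N. mfps_nth g \<beta> * mfps_nth (pw \<Phi> \<beta>) \<alpha>)"
proof -
  have "mfps_nth (mfps_subst g \<Phi>) \<alpha> = (\<Sum>\<beta> | mdeg \<beta> \<le> mdeg \<alpha>. mfps_nth g \<beta> * mfps_nth (pw \<Phi> \<beta>) \<alpha>)"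
    by (simp add: mfps_subst_def pw_def mdeg_def)
  also have "\<dots> = (\<Sum>\<beta> | mdeg \<beta> \<le> N. mfps_nth g \<beta> * mfps_nth (pw \<Phi> \<beta>) \<alpha>)"
  proof (rule sum.mono_neutral_left)
    show "\<forall>\<beta>\<in>{\<beta>. mdeg \<beta> \<le> N} - {\<beta>. mdeg \<beta> \<le> mdeg \<alpha>}. mfps_nth g \<beta> * mfps_nth (pw \<Phi> \<beta>) \<alpha> = 0"
      by (auto intro: ord_geD[OF ord_ge_pw] assms(1))
  qed (use assms(2) in auto)
  finally show ?thesis .
qed

lemma nth_subst_0:
  assumes "\<And>i. ord_ge 1 (\<Phi> i)"
  shows "mfps_nth (mfps_subst g \<Phi>) 0 = mfps_nth g 0"
  using nth_subst[OF assms, of 0 0 g] by (simp add: nth_one)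

lemma nth_subst_mult:
  assumes "\<And>i. ord_ge 1 (\<Phi> i)" "mdeg \<alpha> \<le> N"
  shows "mfps_nth (mfps_subst g \<Phi> * h) \<alpha>
       = (\<Sum>\<beta> | mdeg \<beta> \<le> N. mfps_nth g \<beta> * mfps_nth (pw \<Phi> \<beta> * h) \<alpha>)"
proof -
  have "mfps_nth (mfps_subst g \<Phi> * h) \<alpha> = (\<Sum>(\<mu>, \<nu>)\<in>{(\<mu>, \<nu>). \<mu> + \<nu> = \<alpha>}.
      (\<Sum>\<beta> | mdeg \<beta> \<le> N. mfps_nth g \<beta> * mfps_nth (pw \<Phi> \<beta>) \<mu>) * mfps_nth h \<nu>)"
    unfolding mfps_nth_times
    by (intro sum.cong refl, clarify, subst nth_subst[OF assms(1), of _ N]) (use assms(2) in auto)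
  also have "\<dots> = (\<Sum>\<beta> | mdeg \<beta> \<le> N. \<Sum>(\<mu>, \<nu>)\<in>{(\<mu>, \<nu>). \<mu> + \<nu> = \<alpha>}.
      mfps_nth g \<beta> * (mfps_nth (pw \<Phi> \<beta>) \<mu> * mfps_nth h \<nu>))"
    by (subst sum.swap) (simp add: sum_distrib_right case_prod_unfold mult.assoc)
  also have "\<dots> = (\<Sum>\<beta> | mdeg \<beta> \<le> N. mfps_nth g \<beta> * mfps_nth (pw \<Phi> \<beta> * h) \<alpha>)"
    by (simp add: mfps_nth_times sum_distrib_left case_prod_unfold)
  finally show ?thesis .
qed

lemma subst_add: "mfps_subst (f + g) \<Phi> = mfps_subst f \<Phi> + mfps_subst g \<Phi>"
  by (rule mfps_eqI) (simp add: mfps_subst_def sum.distrib algebra_simps)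

lemma subst_scaleR: "mfps_subst (c *\<^sub>R f) \<Phi> = c *\<^sub>R mfps_subst f \<Phi>"
  by (rule mfps_eqI) (simp add: mfps_subst_def sum_distrib_left algebra_simps)

lemma subst_zero [simp]: "mfps_subst 0 \<Phi> = 0"
  by (rule mfps_eqI) (simp add: mfps_subst_def)

lemma subst_mono:
  assumes "\<And>i. ord_ge 1 (\<Phi> i)"
  shows "mfps_subst (mfps_monom \<beta>) \<Phi> = pw \<Phi> \<beta>"
proof (rule mfps_eqI)
  fix \<alpha>
  have "mfps_nth (mfps_subst (mfps_monom \<beta>) \<Phi>) \<alpha>
      = (\<Sum>\<gamma> | mdeg \<gamma> \<le> mdeg \<alpha> + mdeg \<beta>. mfps_nth (mfps_monom \<beta>) \<gamma> * mfps_nth (pw \<Phi> \<gamma>) \<alpha>)"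
    by (rule nth_subst[OF assms]) simp
  also have "\<dots> = (\<Sum>\<gamma> | mdeg \<gamma> \<le> mdeg \<alpha> + mdeg \<beta>. if \<gamma> = \<beta> then mfps_nth (pw \<Phi> \<gamma>) \<alpha> else 0)"
    by (rule sum.cong) auto
  finally show "mfps_nth (mfps_subst (mfps_monom \<beta>) \<Phi>) \<alpha> = mfps_nth (pw \<Phi> \<beta>) \<alpha>"
    by (simp add: sum.delta')
qed

lemma ord_ge_XX: "ord_ge 1 (mfps_X i)"
  unfolding ord_ge_def by (rule supported_monoI) simp

lemma subst_XX [simp]: "mfps_subst g mfps_X = g"
proof (rule mfps_eqI)
  fix \<alpha>
  have "mfps_nth (mfps_subst g mfps_X) \<alpha> = (\<Sum>\<gamma> | mdeg \<gamma> \<le> mdeg \<alpha>. mfps_nth g \<gamma> * mfps_nth (pw mfps_X \<gamma>) \<alpha>)"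
    by (rule nth_subst[OF ord_ge_XX]) simp
  also have "\<dots> = (\<Sum>\<gamma> | mdeg \<gamma> \<le> mdeg \<alpha>. if \<gamma> = \<alpha> then mfps_nth g \<gamma> else 0)"
    by (rule sum.cong) auto
  finally show "mfps_nth (mfps_subst g mfps_X) \<alpha> = mfps_nth g \<alpha>"
    by (simp add: sum.delta')
qed

lemma par_subst:
  assumes "par \<epsilon>' c g" "\<And>i. par \<epsilon> (\<epsilon>' i) (\<Phi> i)"
  shows "par \<epsilon> c (mfps_subst g \<Phi>)"
  unfolding par_def supported_def
proof (intro allI impI)
  fix \<alpha> assume "mfps_nth (mfps_subst g \<Phi>) \<alpha> \<noteq> 0"
  then obtain \<beta> where \<beta>: "mfps_nth g \<beta> \<noteq> 0" "mfps_nth (pw \<Phi> \<beta>) \<alpha> \<noteq> 0"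
    by (auto simp: mfps_subst_def simp flip: pw_def elim!: sum.not_neutral_contains_not_neutral)
  then show "\<alpha> \<in> {\<alpha>. sgn_pow \<epsilon> \<alpha> = c}"
    using parD[OF assms(1), of \<beta>] parD[OF par_pw[where \<beta> = \<beta> and \<Phi> = \<Phi>, OF assms(2)], of \<alpha>] by auto
qed

text \<open>Truncated subtraction is harmless here: for \<open>\<beta> i = 0\<close> the scalar
  factor \<open>real (\<beta> i)\<close> removes the term.\<close>

lemma deriv_pw:
  "mfps_deriv j (pw \<Phi> \<beta>)
     = (\<Sum>i\<in>UNIV. real (\<beta> i) *\<^sub>R (pw \<Phi> (\<beta>(i := \<beta> i - 1)) * mfps_deriv j (\<Phi> i)))"
proof (induction \<beta> rule: mdeg_Suc_induct)
  case (add k \<beta>)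
  have *: "real ((unit_idx k + \<beta>) i) *\<^sub>R (pw \<Phi> ((unit_idx k + \<beta>)(i := (unit_idx k + \<beta>) i - 1)) * mfps_deriv j (\<Phi> i))
     = (if i = k then pw \<Phi> \<beta> * mfps_deriv j (\<Phi> i) else 0)
       + \<Phi> k * (real (\<beta> i) *\<^sub>R (pw \<Phi> (\<beta>(i := \<beta> i - 1)) * mfps_deriv j (\<Phi> i)))" for i
  proof (cases "i = k")
    case True
    have 1: "(unit_idx k + \<beta>)(k := (unit_idx k + \<beta>) k - 1) = \<beta>"
      by (auto simp: fun_eq_iff unit_idx_def)
    have 2: "real (\<beta> k) *\<^sub>R pw \<Phi> \<beta> = real (\<beta> k) *\<^sub>R (\<Phi> k * pw \<Phi> (\<beta>(k := \<beta> k - 1)))"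
    proof (cases "\<beta> k = 0")
      case False
      then have "\<beta> = unit_idx k + \<beta>(k := \<beta> k - 1)"
        by (auto simp: fun_eq_iff unit_idx_def)
      then show ?thesis by (metis pw_unit_add)
    qed simp
    have 3: "real ((unit_idx k + \<beta>) k) = 1 + real (\<beta> k)"
      by simp
    have "real ((unit_idx k + \<beta>) k) *\<^sub>R (pw \<Phi> \<beta> * mfps_deriv j (\<Phi> k))
        = pw \<Phi> \<beta> * mfps_deriv j (\<Phi> k) + (real (\<beta> k) *\<^sub>R pw \<Phi> \<beta>) * mfps_deriv j (\<Phi> k)"
      unfolding 3 by (simp add: scaleR_add_left)
    with True show ?thesis
      unfolding 2 True 1 by (simp add: mult.assoc)
  next
    case False
    then have 1: "(unit_idx k + \<beta>)(i := (unit_idx k + \<beta>) i - 1) = unit_idx k + \<beta>(i := \<beta> i - 1)"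
      by (auto simp: fun_eq_iff unit_idx_def)
    show ?thesis
      unfolding 1 using False by (simp add: pw_unit_add mult.assoc)
  qed
  have "mfps_deriv j (pw \<Phi> (unit_idx k + \<beta>))
      = pw \<Phi> \<beta> * mfps_deriv j (\<Phi> k) + \<Phi> k * mfps_deriv j (pw \<Phi> \<beta>)"
    unfolding pw_unit_add by (simp add: deriv_mult mult.commute)
  also have "\<dots> = (\<Sum>i\<in>UNIV. real ((unit_idx k + \<beta>) i)
      *\<^sub>R (pw \<Phi> ((unit_idx k + \<beta>)(i := (unit_idx k + \<beta>) i - 1)) * mfps_deriv j (\<Phi> i)))"
    unfolding * add by (simp add: sum.distrib sum_distrib_left)
  finally show ?case .
qed (simp add: pw_def)

lemma deriv_subst:
  fixes g :: "'n::finite mfps" and \<Phi> :: "'n \<Rightarrow> 'm::finite mfps"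
  assumes "\<And>i. ord_ge 1 (\<Phi> i)"
  shows "mfps_deriv j (mfps_subst g \<Phi>) = (\<Sum>i\<in>UNIV. mfps_subst (mfps_deriv i g) \<Phi> * mfps_deriv j (\<Phi> i))"
proof (rule mfps_eqI)
  fix \<alpha> :: "'m \<Rightarrow> nat"
  define N where "N = mdeg \<alpha>"
  \<comment> \<open>Differentiation reads a coefficient of degree N + 1, hence the cutoff
    \<open>Suc N\<close> on this side; lowering \<beta> by one unit brings it back to N.\<close>
  have "mfps_nth (mfps_deriv j (mfps_subst g \<Phi>)) \<alpha>
      = (\<Sum>\<beta> | mdeg \<beta> \<le> Suc N. mfps_nth g \<beta> * mfps_nth (mfps_deriv j (pw \<Phi> \<beta>)) \<alpha>)"
    unfolding nth_deriv
    by (subst nth_subst[OF assms, of _ "Suc N"]) (simp_all add: N_def sum_distrib_left mult_ac)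
  also have "\<dots> = (\<Sum>\<beta> | mdeg \<beta> \<le> Suc N. \<Sum>i\<in>UNIV.
      mfps_nth g \<beta> * (real (\<beta> i) * mfps_nth (pw \<Phi> (\<beta>(i := \<beta> i - 1)) * mfps_deriv j (\<Phi> i)) \<alpha>))"
    by (simp add: deriv_pw nth_sum sum_distrib_left)
  also have "\<dots> = (\<Sum>i\<in>UNIV. \<Sum>\<beta> | mdeg \<beta> \<le> Suc N.
      mfps_nth g \<beta> * (real (\<beta> i) * mfps_nth (pw \<Phi> (\<beta>(i := \<beta> i - 1)) * mfps_deriv j (\<Phi> i)) \<alpha>))"
    by (rule sum.swap)
  also have "\<dots> = (\<Sum>i\<in>UNIV. mfps_nth (mfps_subst (mfps_deriv i g) \<Phi> * mfps_deriv j (\<Phi> i)) \<alpha>)"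
  proof (rule sum.cong [OF refl])
    fix i :: 'n
    have "(\<Sum>\<beta> | mdeg \<beta> \<le> Suc N.
      mfps_nth g \<beta> * (real (\<beta> i) * mfps_nth (pw \<Phi> (\<beta>(i := \<beta> i - 1)) * mfps_deriv j (\<Phi> i)) \<alpha>))
      = (\<Sum>\<beta> | mdeg \<beta> \<le> Suc N \<and> \<beta> i \<noteq> 0.
      mfps_nth g \<beta> * (real (\<beta> i) * mfps_nth (pw \<Phi> (\<beta>(i := \<beta> i - 1)) * mfps_deriv j (\<Phi> i)) \<alpha>))"
      by (rule sum.mono_neutral_right) auto
    also have "\<dots> = (\<Sum>\<beta> | mdeg \<beta> \<le> N. mfps_nth (mfps_deriv i g) \<beta> * mfps_nth (pw \<Phi> \<beta> * mfps_deriv j (\<Phi> i)) \<alpha>)"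
    proof (rule sum.reindex_bij_witness
        [where i = "\<lambda>\<beta>. unit_idx i + \<beta>" and j = "\<lambda>\<beta>. \<beta>(i := \<beta> i - 1)"], goal_cases)
      case (1 \<beta>)
      then show ?case by (intro unit_idx_add_dec) auto
    next
      case (2 \<beta>)
      then have "mdeg (unit_idx i + \<beta>(i := \<beta> i - 1)) \<le> Suc N"
        by (subst unit_idx_add_dec) auto
      then show ?case by simp
    next
      case (3 \<beta>)
      show ?case by (rule dec_unit_idx_add)
    next
      case (4 \<beta>)
      then show ?case by simp
    next
      case (5 \<beta>)
      then have "unit_idx i + \<beta>(i := \<beta> i - 1) = \<beta>"
        by (intro unit_idx_add_dec) auto
      with 5 show ?case by (simp add: nth_deriv)
    qed
    also have "\<dots> = mfps_nth (mfps_subst (mfps_deriv i g) \<Phi> * mfps_deriv j (\<Phi> i)) \<alpha>"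
      by (rule nth_subst_mult[OF assms, symmetric]) (simp add: N_def)
    finally show "(\<Sum>\<beta> | mdeg \<beta> \<le> Suc N.
      mfps_nth g \<beta> * (real (\<beta> i) * mfps_nth (pw \<Phi> (\<beta>(i := \<beta> i - 1)) * mfps_deriv j (\<Phi> i)) \<alpha>))
      = mfps_nth (mfps_subst (mfps_deriv i g) \<Phi> * mfps_deriv j (\<Phi> i)) \<alpha>" .
  qed
  finally show "mfps_nth (mfps_deriv j (mfps_subst g \<Phi>)) \<alpha>
      = mfps_nth (\<Sum>i\<in>UNIV. mfps_subst (mfps_deriv i g) \<Phi> * mfps_deriv j (\<Phi> i)) \<alpha>"
    by (simp add: nth_sum)
qed

text \<open>Every term of the difference contains a factor \<eta> of order k besides
  \<open>mdeg \<beta> - 1\<close> further factors of order at least 1.\<close>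

lemma pw_perturb:
  assumes "\<And>i. ord_ge 1 (\<Phi> i)" "\<And>i. ord_ge k (\<eta> i)" "k \<ge> 1" "mdeg \<beta> \<ge> 1"
  shows "ord_ge (k + mdeg \<beta> - 1) (pw (\<lambda>i. \<Phi> i + \<eta> i) \<beta> - pw \<Phi> \<beta>)"
  using assms(4)
proof (induction \<beta> rule: mdeg_Suc_induct)
  case (add j \<beta>)
  let ?\<Psi> = "\<lambda>i. \<Phi> i + \<eta> i"
  have \<Psi>: "ord_ge 1 (?\<Psi> i)" for i
    using assms(1)[of i] ord_ge_mono[OF assms(2) assms(3), of i] by (rule ord_ge_add)
  have eq: "pw ?\<Psi> (unit_idx j + \<beta>) - pw \<Phi> (unit_idx j + \<beta>)
      = \<eta> j * pw ?\<Psi> \<beta> + \<Phi> j * (pw ?\<Psi> \<beta> - pw \<Phi> \<beta>)"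
    unfolding pw_unit_add by (simp add: algebra_simps)
  have "ord_ge (k + mdeg \<beta>) (\<eta> j * pw ?\<Psi> \<beta>)"
    by (rule ord_ge_mult[OF assms(2) ord_ge_pw[OF \<Psi>]])
  moreover have "ord_ge (k + mdeg \<beta>) (\<Phi> j * (pw ?\<Psi> \<beta> - pw \<Phi> \<beta>))"
  proof (cases "\<beta> = 0")
    case False
    then have "mdeg \<beta> \<ge> 1"
      by (metis mdeg_eq_0 less_one not_le)
    then have "ord_ge (1 + (k + mdeg \<beta> - 1)) (\<Phi> j * (pw ?\<Psi> \<beta> - pw \<Phi> \<beta>))"
      using ord_ge_mult[OF assms(1) add.IH] by blast
    with \<open>k \<ge> 1\<close> show ?thesis by simp
  qed (simp add: ord_ge_def)
  ultimately show ?case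
    unfolding eq by (simp add: ord_ge_add del: plus_fun_apply)
qed simp

text \<open>Up to degree k only the linear coefficients of g feel the perturbation: constants
  cancel, and by \<open>pw_perturb\<close> exponents of degree at least 2 contribute in order k + 1
  or higher. This is what makes the equation in each degree linear.\<close>

lemma subst_perturb:
  fixes g :: "'n::finite mfps" and \<Phi> \<eta> :: "'n \<Rightarrow> 'm::finite mfps"
  assumes "\<And>i. ord_ge 1 (\<Phi> i)" "\<And>i. ord_ge k (\<eta> i)" "k \<ge> 1"
  shows "ord_ge (Suc k) (mfps_subst g (\<lambda>i. \<Phi> i + \<eta> i) - mfps_subst g \<Phi>
             - (\<Sum>i\<in>UNIV. mfps_nth g (unit_idx i) *\<^sub>R \<eta> i))"
  unfolding ord_ge_def supported_def
proof (intro allI impI, rule ccontr)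
  fix \<alpha> :: "'m \<Rightarrow> nat"
  let ?\<Psi> = "\<lambda>i. \<Phi> i + \<eta> i"
  assume "\<alpha> \<notin> {\<alpha>. Suc k \<le> mdeg \<alpha>}"
  then have \<alpha>: "mdeg \<alpha> \<le> k" by simp
  have \<Psi>: "ord_ge 1 (?\<Psi> i)" for i
    using assms(1)[of i] ord_ge_mono[OF assms(2) assms(3), of i] by (rule ord_ge_add)
  have "mfps_nth (mfps_subst g ?\<Psi> - mfps_subst g \<Phi>) \<alpha>
      = (\<Sum>\<beta> | mdeg \<beta> \<le> k. mfps_nth g \<beta> * mfps_nth (pw ?\<Psi> \<beta> - pw \<Phi> \<beta>) \<alpha>)"
    using \<alpha> by (simp add: nth_subst[OF assms(1), of _ k] nth_subst[OF \<Psi>, of _ k] sum_subtractf algebra_simps)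
  also have "\<dots> = (\<Sum>\<beta>\<in>range unit_idx. mfps_nth g \<beta> * mfps_nth (pw ?\<Psi> \<beta> - pw \<Phi> \<beta>) \<alpha>)"
  proof (rule sum.mono_neutral_right)
    show "range unit_idx \<subseteq> {\<beta> :: 'n \<Rightarrow> nat. mdeg \<beta> \<le> k}"
      using assms(3) by auto
    show "\<forall>\<beta>\<in>{\<beta>. mdeg \<beta> \<le> k} - range unit_idx. mfps_nth g \<beta> * mfps_nth (pw ?\<Psi> \<beta> - pw \<Phi> \<beta>) \<alpha> = 0"
    proof
      fix \<beta> :: "'n \<Rightarrow> nat"
      assume "\<beta> \<in> {\<beta>. mdeg \<beta> \<le> k} - range unit_idx"
      then have "mdeg \<beta> \<noteq> 1"
        by (metis DiffD2 mdeg_eq_1E rangeI)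
      then consider "\<beta> = 0" | "mdeg \<beta> \<ge> 2"
        by (metis One_nat_def mdeg_eq_0 less_2_cases not_le)
      then show "mfps_nth g \<beta> * mfps_nth (pw ?\<Psi> \<beta> - pw \<Phi> \<beta>) \<alpha> = 0"
      proof cases
        case 2
        then have "ord_ge (k + mdeg \<beta> - 1) (pw ?\<Psi> \<beta> - pw \<Phi> \<beta>)"
          by (intro pw_perturb assms) auto
        with 2 \<alpha> show ?thesis
          by (auto dest!: ord_geD[of _ _ \<alpha>])
      qed simp
    qed
  qed simp
  also have "\<dots> = (\<Sum>i\<in>UNIV. mfps_nth g (unit_idx i) * mfps_nth (\<eta> i) \<alpha>)"
    by (subst sum.reindex) (auto simp: inj_def)
  finally have "mfps_nth (mfps_subst g ?\<Psi> - mfps_subst g \<Phi>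
             - (\<Sum>i\<in>UNIV. mfps_nth g (unit_idx i) *\<^sub>R \<eta> i)) \<alpha> = 0"
    by (simp add: nth_sum)
  moreover assume "mfps_nth (mfps_subst g ?\<Psi> - mfps_subst g \<Phi>
             - (\<Sum>i\<in>UNIV. mfps_nth g (unit_idx i) *\<^sub>R \<eta> i)) \<alpha> \<noteq> 0"
  ultimately show False by blast
qed

section \<open>Jets of smooth functions\<close>

lemma mfps_const_nth: "mfps_nth (of_real c) \<alpha> = (if \<alpha> = 0 then c else 0)"
  by (simp add: of_real_def nth_one)

lemma deriv_of_real [simp]: "mfps_deriv j (of_real c) = 0"
  by (simp add: of_real_def deriv_scaleR)

lemma partialI:
  assumes "\<And>x. (g has_derivative g' x) (at x)"
  shows "partial i g = (\<lambda>x. g' x (axis i 1))"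
  unfolding partial_def using frechet_derivative_at[OF assms] by simp

lemma partial_const [simp]: "partial i (\<lambda>x. c) = (\<lambda>x. 0)"
  by (rule partialI) (rule has_derivative_const)

lemma partial_coord: "partial i (\<lambda>x :: real^'n::finite. x $ j) = (\<lambda>x. if i = j then 1 else 0)"
proof -
  have "partial i (\<lambda>x :: real^'n. x $ j) = (\<lambda>x. axis i 1 $ j)"
    by (rule partialI) (rule bounded_linear_imp_has_derivative[OF bounded_linear_vec_nth])
  then show ?thesis by (auto simp: axis_def)
qed

lemma partial_add:
  assumes "\<And>x. f differentiable (at x)" "\<And>x. g differentiable (at x)"
  shows "partial i (\<lambda>x. f x + g x) = (\<lambda>x. partial i f x + partial i g x)"
  unfolding partial_def[of i f] partial_def[of i g]
  by (rule partialI) (intro has_derivative_add assms[unfolded frechet_derivative_works])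

lemma partial_scaleR:
  assumes "\<And>x. f differentiable (at x)"
  shows "partial i (\<lambda>x. c *\<^sub>R f x) = (\<lambda>x. c *\<^sub>R partial i f x)"
  unfolding partial_def[of i f]
  by (rule partialI) (intro has_derivative_scaleR_right assms[unfolded frechet_derivative_works])

lemma partial_mult:
  fixes f g :: "real^'n::finite \<Rightarrow> real"
  assumes "\<And>x. f differentiable (at x)" "\<And>x. g differentiable (at x)"
  shows "partial i (\<lambda>x. f x * g x) = (\<lambda>x. partial i f x * g x + f x * partial i g x)"
proof -
  have "partial i (\<lambda>x. f x * g x) = (\<lambda>x. f x * partial i g x + partial i f x * g x)"
    unfolding partial_def[of i f] partial_def[of i g]
    by (rule partialI) (intro has_derivative_mult assms[unfolded frechet_derivative_works])
  then show ?thesis by (simp add: add.commute)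
qed

lemma partial_vec_nth:
  assumes "\<And>x. f differentiable (at x)"
  shows "partial i (\<lambda>x. f x $ k) = (\<lambda>x. partial i f x $ k)"
  unfolding partial_def[of i f]
  by (rule partialI)
     (intro bounded_linear.has_derivative[OF bounded_linear_vec_nth] assms[unfolded frechet_derivative_works])

lemma linear_sum_axis:
  assumes "linear (D :: real^'n::finite \<Rightarrow> real)"
  shows "D v = (\<Sum>j\<in>UNIV. v $ j * D (axis j 1))"
proof -
  have "D v = D (\<Sum>j\<in>UNIV. v $ j *\<^sub>R axis j 1)"
    using basis_expansion[of v] by (simp add: scalar_mult_eq_scaleR)
  also have "\<dots> = (\<Sum>j\<in>UNIV. v $ j * D (axis j 1))"
    using assms by (simp add: linear_sum linear_scale)
  finally show ?thesis .
qed

lemma has_derivative_comp_vec: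
  fixes g :: "real^'m::finite \<Rightarrow> real" and p :: "'m \<Rightarrow> real^'n::finite \<Rightarrow> real"
  assumes g: "\<And>y. g differentiable (at y)" and p: "\<And>j x. p j differentiable (at x)"
  shows "((\<lambda>x. g (\<chi> j. p j x)) has_derivative
          (\<lambda>h. \<Sum>j\<in>UNIV. partial j g (\<chi> j. p j x) * frechet_derivative (p j) (at x) h)) (at x)"
proof -
  let ?P = "\<lambda>x. \<chi> j. p j x"
  have "(?P has_derivative (\<lambda>h. \<chi> j. frechet_derivative (p j) (at x) h)) (at x)"
    unfolding has_derivative_componentwise_within[of ?P]
    using p[unfolded frechet_derivative_works] by (auto simp: Basis_vec_def inner_axis)
  then have "((\<lambda>x. g (?P x)) has_derivative
      (\<lambda>h. frechet_derivative g (at (?P x)) (\<chi> j. frechet_derivative (p j) (at x) h))) (at x)"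
    using has_derivative_compose g[unfolded frechet_derivative_works] by blast
  moreover have "frechet_derivative g (at y) v = (\<Sum>j\<in>UNIV. partial j g y * v $ j)" for y v
    unfolding partial_def
    using linear_sum_axis[OF linear_frechet_derivative[OF g[of y]], of v] by (simp add: mult.commute)
  ultimately show ?thesis by simp
qed

text \<open>Derivatives of the function and of the series are matched along every sequence of
  coordinates, which lets smoothness and Taylor coefficients pass through sums, products and
  compositions in one induction, without interchanging partial derivatives.\<close>

primrec jet :: "nat \<Rightarrow> (real^'n::finite \<Rightarrow> real) \<Rightarrow> 'n mfps \<Rightarrow> bool" where
  "jet 0 g s \<longleftrightarrow> (\<forall>x. g differentiable (at x)) \<and> g 0 = mfps_nth s 0"
| "jet (Suc n) g s \<longleftrightarrow> (\<forall>x. g differentiable (at x)) \<and> g 0 = mfps_nth s 0 \<and>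
     (\<forall>i. jet n (partial i g) (mfps_deriv i s))"

lemma jet_differentiable: "jet n g s \<Longrightarrow> g differentiable (at x)"
  by (cases n) auto

lemma jet_imp_jet_0: "jet n g s \<Longrightarrow> jet 0 g s"
  by (cases n) auto

lemma jet_at_0: "jet n g s \<Longrightarrow> g 0 = mfps_nth s 0"
  by (cases n) auto

lemma jet_Suc_imp: "jet (Suc n) g s \<Longrightarrow> jet n g s"
  by (induction n arbitrary: g s) auto

lemma jet_SucI:
  assumes "jet 0 g s" "\<And>i. jet n (partial i g) (mfps_deriv i s)"
  shows "jet (Suc n) g s"
  using assms by simp

lemma jet_const_0 [simp]: "jet n (\<lambda>x. 0) 0"
  by (induction n) auto

lemma jet_const: "jet n (\<lambda>x. c) (of_real c)"
  by (cases n) (auto simp: mfps_const_nth)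

lemma jet_one: "jet n (\<lambda>x. 1) 1"
  using jet_const[of n 1] by simp

lemma jet_coord: "jet n (\<lambda>x. x $ i) (mfps_X i)"
proof (cases n)
  case (Suc m)
  have "jet m (partial j (\<lambda>x. x $ i)) (mfps_deriv j (mfps_X i))" for j
    by (simp add: partial_coord deriv_XX jet_one)
  with Suc show ?thesis
    by (auto intro!: bounded_linear_imp_differentiable bounded_linear_vec_nth)
qed (auto intro!: bounded_linear_imp_differentiable bounded_linear_vec_nth)

lemma jet_add: "jet n f s \<Longrightarrow> jet n g t \<Longrightarrow> jet n (\<lambda>x. f x + g x) (s + t)"
proof (induction n arbitrary: f g s t)
  case (Suc n)
  then show ?case
    by (auto simp: partial_add deriv_add)
qed auto

lemma jet_scale: "jet n f s \<Longrightarrow> jet n (\<lambda>x. c * f x) (c *\<^sub>R s)"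
proof (induction n arbitrary: f s)
  case (Suc n)
  have "partial i (\<lambda>x. c * f x) = (\<lambda>x. c * partial i f x)" for i
    using partial_scaleR[of f i c] Suc.prems by simp
  then show ?case
    using Suc by (auto simp: deriv_scaleR)
qed auto

lemma jet_mult: "jet n f s \<Longrightarrow> jet n g t \<Longrightarrow> jet n (\<lambda>x. f x * g x) (s * t)"
proof (induction n arbitrary: f g s t)
  case (Suc n)
  have "jet n (partial i (\<lambda>x. f x * g x)) (mfps_deriv i (s * t))" for i
    using Suc.prems jet_Suc_imp[OF Suc.prems(1)] jet_Suc_imp[OF Suc.prems(2)]
    by (auto simp: partial_mult deriv_mult intro!: jet_add Suc.IH)
  then show ?case
    using Suc.prems by (auto intro: differentiable_mult)
qed auto

lemma jet_uminus: "jet n f s \<Longrightarrow> jet n (\<lambda>x. - f x) (- s)"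
  using jet_scale[of n f s "-1"] by simp

lemma jet_diff: "jet n f s \<Longrightarrow> jet n g t \<Longrightarrow> jet n (\<lambda>x. f x - g x) (s - t)"
  using jet_add[OF _ jet_uminus] by fastforce

lemma jet_power: "jet n f s \<Longrightarrow> jet n (\<lambda>x. f x ^ k) (s ^ k)"
  by (induction k) (auto intro: jet_mult jet_one)

lemma jet_sum: "(\<And>a. a \<in> A \<Longrightarrow> jet n (f a) (s a)) \<Longrightarrow> jet n (\<lambda>x. \<Sum>a\<in>A. f a x) (sum s A)"
  by (induction A rule: infinite_finite_induct) (auto intro: jet_add)

lemma jet_prod: "(\<And>a. a \<in> A \<Longrightarrow> jet n (f a) (s a)) \<Longrightarrow> jet n (\<lambda>x. \<Prod>a\<in>A. f a x) (prod s A)"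
  by (induction A rule: infinite_finite_induct) (auto intro: jet_mult jet_one)

text \<open>The chain rule holds on both sides in the same form. A derivative of the composite
  involves composites of the partial derivatives of g, so the induction varies g and s while p and
  \<Phi> stay fixed.\<close>

lemma jet_compose:
  fixes g :: "real^'m::finite \<Rightarrow> real" and p :: "'m \<Rightarrow> real^'n::finite \<Rightarrow> real"
  assumes "jet n g s" "\<And>j. jet n (p j) (\<Phi> j)" "\<And>j. ord_ge 1 (\<Phi> j)"
  shows "jet n (\<lambda>x. g (\<chi> j. p j x)) (mfps_subst s \<Phi>)"
  using assms(1,2)
proof (induction n arbitrary: g s)
  case 0
  have "p j 0 = 0" for j
    using jet_at_0[OF 0(2)] assms(3)[unfolded ord_ge_1_iff] by simp
  then have "(\<chi> j. p j 0) = 0"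
    by (simp add: vec_eq_iff)
  then have "g (\<chi> j. p j 0) = mfps_nth (mfps_subst s \<Phi>) 0"
    using jet_at_0[OF 0(1)] by (simp add: nth_subst_0[OF assms(3)])
  moreover have "(\<lambda>x. g (\<chi> j. p j x)) differentiable (at x)" for x
    using has_derivative_comp_vec[of g p, OF jet_differentiable[OF 0(1)] jet_differentiable[OF 0(2)]]
    unfolding differentiable_def by blast
  ultimately show ?case by simp
next
  case (Suc n)
  let ?h = "\<lambda>x. g (\<chi> j. p j x)"
  have D: "(?h has_derivative
          (\<lambda>h. \<Sum>j\<in>UNIV. partial j g (\<chi> j. p j x) * frechet_derivative (p j) (at x) h)) (at x)" for x
    using has_derivative_comp_vec[of g p] jet_differentiable[OF Suc.prems(1)]
      jet_differentiable[OF Suc.prems(2)] by blast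
  have "jet n (\<lambda>x. \<Sum>j\<in>UNIV. partial j g (\<chi> j. p j x) * partial i (p j) x)
      (\<Sum>j\<in>UNIV. mfps_subst (mfps_deriv j s) \<Phi> * mfps_deriv i (\<Phi> j))" for i
    using Suc.prems jet_Suc_imp[OF Suc.prems(2)]
    by (intro jet_sum jet_mult Suc.IH) auto
  moreover have "partial i ?h = (\<lambda>x. \<Sum>j\<in>UNIV. partial j g (\<chi> j. p j x) * partial i (p j) x)" for i
    unfolding partial_def[of i "p _"] by (rule partialI[OF D])
  ultimately have "jet n (partial i ?h) (mfps_deriv i (mfps_subst s \<Phi>))" for i
    by (simp add: deriv_subst[OF assms(3)])
  moreover have "jet 0 ?h (mfps_subst s \<Phi>)"
    by (rule jet_imp_jet_0[OF Suc.IH[OF jet_Suc_imp[OF Suc.prems(1)] jet_Suc_imp[OF Suc.prems(2)]]])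
  ultimately show ?case by (rule jet_SucI[rotated])
qed

definition has_jet :: "(real^'n::finite \<Rightarrow> real) \<Rightarrow> 'n mfps \<Rightarrow> bool" where
  "has_jet g s \<longleftrightarrow> (\<forall>n. jet n g s)"

lemma has_jet_partial: "has_jet g s \<Longrightarrow> has_jet (partial i g) (mfps_deriv i s)"
  unfolding has_jet_def by (metis jet.simps(2))

lemma has_jet_smooth_on: "has_jet g s \<Longrightarrow> smooth_on UNIV g"
proof -
  assume s: "has_jet g s"
  have "\<exists>t. has_jet (foldr partial is g) t" for "is"
    by (induction "is") (use s has_jet_partial in auto)
  then show ?thesis
    unfolding smooth_on_def has_jet_def using jet_differentiable by blast
qed

lemma has_jet_smooth_germ: "has_jet g s \<Longrightarrow> smooth_germ g"
  unfolding smooth_germ_def using has_jet_smooth_on by blast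

section \<open>Reading off Taylor coefficients from a jet\<close>

lemma nth_deriv_funpow:
  "mfps_nth ((mfps_deriv i ^^ k) s) \<gamma> * fact (\<gamma> i) = fact (\<gamma> i + k) * mfps_nth s (\<gamma>(i := \<gamma> i + k))"
proof (induction k arbitrary: \<gamma>)
  case (Suc k)
  have 1: "(unit_idx i + \<gamma>)(i := (unit_idx i + \<gamma>) i + k) = \<gamma>(i := \<gamma> i + Suc k)"
    by (auto simp: fun_eq_iff unit_idx_def)
  have "mfps_nth ((mfps_deriv i ^^ Suc k) s) \<gamma> * fact (\<gamma> i)
      = mfps_nth ((mfps_deriv i ^^ k) s) (unit_idx i + \<gamma>) * fact ((unit_idx i + \<gamma>) i)"
    by (simp add: nth_deriv)
  also have "\<dots> = fact (\<gamma> i + Suc k) * mfps_nth s (\<gamma>(i := \<gamma> i + Suc k))"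
    unfolding Suc 1 by simp
  finally show ?case .
qed simp

text \<open>The induction needs coefficients away from 0: removing the outermost derivative moves
  the exponent \<open>\<alpha> i\<close> into coordinate i, which the rest of the list, being
  distinct from i, leaves alone.\<close>

lemma nth_foldr_deriv:
  assumes "distinct js" "\<And>i. i \<in> set js \<Longrightarrow> \<gamma> i = 0"
  shows "mfps_nth (foldr (\<lambda>i. mfps_deriv i ^^ \<alpha> i) js s) \<gamma>
       = (\<Prod>i\<in>set js. fact (\<alpha> i)) * mfps_nth s (\<lambda>i. if i \<in> set js then \<alpha> i else \<gamma> i)"
  using assms
proof (induction js arbitrary: \<gamma>)
  case (Cons i js)
  have "mfps_nth (foldr (\<lambda>i. mfps_deriv i ^^ \<alpha> i) (i # js) s) \<gamma>
      = fact (\<alpha> i) * mfps_nth (foldr (\<lambda>i. mfps_deriv i ^^ \<alpha> i) js s) (\<gamma>(i := \<alpha> i))"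
    using nth_deriv_funpow[where i = i and k = "\<alpha> i" and \<gamma> = \<gamma> and s = "foldr (\<lambda>i. mfps_deriv i ^^ \<alpha> i) js s"]
      Cons.prems(2)[of i] by simp
  also have "\<dots> = fact (\<alpha> i) * ((\<Prod>i\<in>set js. fact (\<alpha> i)) *
      mfps_nth s (\<lambda>k. if k \<in> set js then \<alpha> k else (\<gamma>(i := \<alpha> i)) k))"
    using Cons.prems by (subst Cons.IH) auto
  also have "(\<lambda>k. if k \<in> set js then \<alpha> k else (\<gamma>(i := \<alpha> i)) k)
      = (\<lambda>k. if k \<in> set (i # js) then \<alpha> k else \<gamma> k)"
    by auto
  finally show ?case
    using Cons.prems(1) by (simp add: mult.assoc)
qed simp

lemma has_jet_funpow: "has_jet g s \<Longrightarrow> has_jet ((partial i ^^ k) g) ((mfps_deriv i ^^ k) s)"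
  by (induction k) (auto intro: has_jet_partial)

lemma has_jet_at_0: "has_jet g s \<Longrightarrow> g 0 = mfps_nth s 0"
  unfolding has_jet_def using jet_at_0 by blast

lemma enum_coords: "distinct (SOME js. distinct js \<and> set js = (UNIV :: 'n::finite set))"
  "set (SOME js. distinct js \<and> set js = (UNIV :: 'n::finite set)) = UNIV"
proof -
  have "\<exists>js. distinct js \<and> set js = (UNIV :: 'n set)"
    using finite_distinct_list[of "UNIV :: 'n set"] by auto
  from someI_ex[OF this]
  show "distinct (SOME js. distinct js \<and> set js = (UNIV :: 'n::finite set))"
    "set (SOME js. distinct js \<and> set js = (UNIV :: 'n::finite set)) = UNIV"
    by auto
qed

lemma taylor_has_jet:
  assumes "has_jet g s"
  shows "taylor g = s"
proof (rule mfps_eqI)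
  fix \<alpha> :: "'a \<Rightarrow> nat"
  define js where "js = (SOME js. distinct js \<and> set js = (UNIV :: 'a set))"
  have "has_jet (foldr (\<lambda>i. partial i ^^ \<alpha> i) js g) (foldr (\<lambda>i. mfps_deriv i ^^ \<alpha> i) js s)" for js
    by (induction js) (use assms has_jet_funpow in auto)
  then have "multi_partial \<alpha> g 0 = mfps_nth (foldr (\<lambda>i. mfps_deriv i ^^ \<alpha> i) js s) 0"
    unfolding multi_partial_def js_def using has_jet_at_0 by blast
  also have "\<dots> = (\<Prod>i\<in>UNIV. fact (\<alpha> i)) * mfps_nth s \<alpha>"
    using enum_coords[where 'n = 'a] by (subst nth_foldr_deriv) (auto simp: js_def)
  finally show "mfps_nth (taylor g) \<alpha> = mfps_nth s \<alpha>"
    by (simp add: taylor_def)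
qed

section \<open>Components and parity of Taylor series of smooth maps\<close>

lemma foldr_partial_vec_nth:
  assumes "smooth_on UNIV F"
  shows "foldr partial is (\<lambda>x. F x $ k) = (\<lambda>x. foldr partial is F x $ k)"
proof (induction "is")
  case (Cons i "is")
  have "foldr partial (i # is) (\<lambda>x. F x $ k) = partial i (\<lambda>x. foldr partial is F x $ k)"
    by (simp add: Cons)
  also have "\<dots> = (\<lambda>x. foldr partial (i # is) F x $ k)"
    using assms by (subst partial_vec_nth) (auto simp: smooth_on_def)
  finally show ?case .
qed simp

lemma smooth_on_vec_nth: "smooth_on UNIV F \<Longrightarrow> smooth_on UNIV (\<lambda>x. F x $ k)"
  unfolding smooth_on_def foldr_partial_vec_nth[unfolded smooth_on_def]
  using bounded_linear.has_derivative[OF bounded_linear_vec_nth] unfolding differentiable_def by blast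

lemma foldr_funpow_partial:
  "foldr (\<lambda>i. partial i ^^ \<alpha> i) js g = foldr partial (concat (map (\<lambda>i. replicate (\<alpha> i) i) js)) g"
  by (induction js) auto

text \<open>The chain rule produces the factor \<open>\<epsilon> i\<close> on the left; it moves to
  the right because it is its own inverse.\<close>

lemma partial_diag:
  fixes g :: "real^'n::finite \<Rightarrow> real"
  assumes d: "\<And>x. g differentiable (at x)" and \<epsilon>: "\<epsilon> i * \<epsilon> i = 1"
    and g: "\<And>x. g (\<chi> j. \<epsilon> j * x $ j) = c * g x"
  shows "partial i g (\<chi> j. \<epsilon> j * x $ j) = c * \<epsilon> i * partial i g x"
proof -
  let ?R = "\<lambda>x. \<chi> j. \<epsilon> j * x $ j"
  have R: "(?R has_derivative ?R) (at x)" for x :: "real^'n"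
    by (intro linear_imp_has_derivative linearI) (auto simp: vec_eq_iff algebra_simps)
  have "(g has_derivative frechet_derivative g (at (?R x))) (at (?R x))"
    using d frechet_derivative_works by blast
  from has_derivative_compose[OF R this]
  have "((\<lambda>x. g (?R x)) has_derivative (\<lambda>h. frechet_derivative g (at (?R x)) (?R h))) (at x)" .
  moreover have "((\<lambda>x. g (?R x)) has_derivative (\<lambda>h. c * frechet_derivative g (at x) h)) (at x)"
    unfolding g using d[of x] unfolding frechet_derivative_works
    by (rule has_derivative_mult_right)
  ultimately have "(\<lambda>h. frechet_derivative g (at (?R x)) (?R h)) = (\<lambda>h. c * frechet_derivative g (at x) h)"
    by (rule has_derivative_unique)
  then have "frechet_derivative g (at (?R x)) (?R (axis i 1)) = c * frechet_derivative g (at x) (axis i 1)"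
    by (rule fun_cong)
  moreover have "?R (axis i 1) = \<epsilon> i *\<^sub>R axis i 1"
    by (auto simp: vec_eq_iff axis_def)
  ultimately have "\<epsilon> i * partial i g (?R x) = c * partial i g x"
    using linear_frechet_derivative[OF d[of "?R x"]] by (simp add: partial_def linear_scale)
  then have "\<epsilon> i * \<epsilon> i * partial i g (?R x) = c * \<epsilon> i * partial i g x"
    by (simp add: mult_ac)
  then show ?thesis using \<epsilon> by simp
qed

text \<open>Iterated at the fixed point 0, \<open>partial_diag\<close> multiplies the derivative of
  multi-index \<alpha> by \<open>c * sgn_pow \<epsilon> \<alpha>\<close>. A nonzero coefficient
  forces this factor to be 1, and c is its own inverse.\<close>

lemma par_taylor:
  fixes g :: "real^'n::finite \<Rightarrow> real"
  assumes s: "smooth_on UNIV g" and \<epsilon>: "\<And>i. \<epsilon> i * \<epsilon> i = 1" and c: "c * c = 1"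
    and g: "\<And>x. g (\<chi> j. \<epsilon> j * x $ j) = c * g x"
  shows "par \<epsilon> c (taylor g)"
  unfolding par_def supported_def
proof (intro allI impI)
  fix \<alpha> :: "'n \<Rightarrow> nat"
  assume nz: "mfps_nth (taylor g) \<alpha> \<noteq> 0"
  define js where "js = (SOME js. distinct js \<and> set js = (UNIV :: 'n set))"
  define ks where "ks = concat (map (\<lambda>i. replicate (\<alpha> i) i) js)"
  have iter: "foldr partial is g (\<chi> j. \<epsilon> j * x $ j) = c * prod_list (map \<epsilon> is) * foldr partial is g x" for "is" x
  proof (induction "is" arbitrary: x)
    case (Cons i "is")
    have "foldr partial (i # is) g (\<chi> j. \<epsilon> j * x $ j)
        = c * prod_list (map \<epsilon> is) * \<epsilon> i * partial i (foldr partial is g) x"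
      using s unfolding foldr.simps comp_apply
      by (intro partial_diag[where \<epsilon> = \<epsilon> and g = "foldr partial is g", OF _ \<epsilon> Cons.IH])
         (auto simp: smooth_on_def)
    then show ?case by (simp add: mult_ac)
  qed (simp add: g)
  have mp: "multi_partial \<alpha> g = foldr partial ks g"
    unfolding multi_partial_def foldr_funpow_partial ks_def js_def ..
  have 0: "(\<chi> j. \<epsilon> j * (0 :: real^'n) $ j) = 0"
    by (simp add: vec_eq_iff)
  have "multi_partial \<alpha> g 0 = c * prod_list (map \<epsilon> ks) * multi_partial \<alpha> g 0"
    unfolding mp using iter[of ks 0] unfolding 0 .
  moreover have "multi_partial \<alpha> g 0 \<noteq> 0"
    using nz by (auto simp: taylor_def)
  ultimately have "c * prod_list (map \<epsilon> ks) = 1" by simp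
  moreover have "prod_list (map \<epsilon> ks) = (\<Prod>i\<leftarrow>js. \<epsilon> i ^ \<alpha> i)"
    unfolding ks_def by (induction js) (auto simp: prod_list_replicate)
  moreover have "(\<Prod>i\<leftarrow>js. \<epsilon> i ^ \<alpha> i) = sgn_pow \<epsilon> \<alpha>"
    using enum_coords[where 'n = 'n] prod.distinct_set_conv_list[of js "\<lambda>i. \<epsilon> i ^ \<alpha> i"]
    by (simp add: sgn_pow_def js_def)
  ultimately have "c * sgn_pow \<epsilon> \<alpha> = 1" by simp
  then have "c * c * sgn_pow \<epsilon> \<alpha> = c" by (simp add: mult.assoc)
  then show "\<alpha> \<in> {\<alpha>. sgn_pow \<epsilon> \<alpha> = c}" using c by simp
qed

lemma nth_taylor_0: "mfps_nth (taylor g) 0 = g 0"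
proof -
  have "foldr (\<lambda>i. partial i ^^ (0 :: 'a \<Rightarrow> nat) i) js g = g" for js
    by (induction js) auto
  then show ?thesis by (simp add: taylor_def multi_partial_def)
qed

lemma nth_taylor_unit: "mfps_nth (taylor g) (unit_idx i) = partial i g 0"
proof -
  have 1: "foldr (\<lambda>k. partial k ^^ unit_idx i k) js g = (if i \<in> set js then partial i g else g)"
    if "distinct js" for js
    using that by (induction js) (auto simp: unit_idx_def)
  have "fact (unit_idx i k) = (1 :: real)" for k
    by (simp add: unit_idx_def)
  then show ?thesis
    using 1[of "SOME js. distinct js \<and> set js = (UNIV :: 'a set)"] enum_coords[where 'n = 'a]
    unfolding taylor_def multi_partial_def by simp
qed

section \<open>Borel's lemma\<close>

definition uni_series :: "(nat \<Rightarrow> real) \<Rightarrow> 'n::finite \<Rightarrow> 'n mfps" where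
  "uni_series c i = Abs_mfps (\<lambda>\<alpha>. if \<forall>j. j \<noteq> i \<longrightarrow> \<alpha> j = 0 then c (\<alpha> i) else 0)"

lemma nth_uni_series: "mfps_nth (uni_series c i) \<alpha> = (if \<forall>j. j \<noteq> i \<longrightarrow> \<alpha> j = 0 then c (\<alpha> i) else 0)"
  by (simp add: uni_series_def)

lemma deriv_uni_series:
  "mfps_deriv j (uni_series c i) = (if j = i then uni_series (\<lambda>k. real (Suc k) * c (Suc k)) i else 0)"
proof (rule mfps_eqI)
  fix \<alpha> :: "'a \<Rightarrow> nat"
  show "mfps_nth (mfps_deriv j (uni_series c i)) \<alpha> =
      mfps_nth (if j = i then uni_series (\<lambda>k. real (Suc k) * c (Suc k)) i else 0) \<alpha>"
  proof (cases "j = i")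
    case True
    then show ?thesis
      by (auto simp: nth_deriv nth_uni_series unit_idx_def)
  next
    case False
    then have "\<not> (\<forall>k. k \<noteq> i \<longrightarrow> (unit_idx j + \<alpha>) k = 0)"
      by (auto intro!: exI[of _ j])
    with False show ?thesis
      by (simp only: nth_deriv nth_uni_series if_False nth_simps mult_zero_right)
  qed
qed

lemma partial_fun_coord:
  assumes "\<And>t. (h has_real_derivative h' t) (at t)"
  shows "(\<lambda>x :: real^'n::finite. h (x $ i)) differentiable (at x)"
    and "partial j (\<lambda>x :: real^'n. h (x $ i)) = (\<lambda>x. if j = i then h' (x $ i) else 0)"
proof -
  have D: "((\<lambda>x :: real^'n. h (x $ i)) has_derivative (\<lambda>v. h' (x $ i) * v $ i)) (at x)" for x
    using has_derivative_compose[OF bounded_linear_imp_has_derivative[OF bounded_linear_vec_nth]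
        assms[unfolded has_field_derivative_def], of i x UNIV] .
  then show "(\<lambda>x :: real^'n. h (x $ i)) differentiable (at x)"
    unfolding differentiable_def by blast
  show "partial j (\<lambda>x :: real^'n. h (x $ i)) = (\<lambda>x. if j = i then h' (x $ i) else 0)"
    unfolding partialI[OF D] by (auto simp: axis_def)
qed

text \<open>Sine is bounded together with all its derivatives and has leading term x, so products of
  its powers can replace the cut-off monomials of the usual proof of Borel's lemma. Sine and cosine
  go together because each is the derivative of the other up to sign.\<close>

lemma jet_sin_cos:
  "jet n (\<lambda>x. sin (x $ i)) (uni_series sin_coeff i) \<and> jet n (\<lambda>x. cos (x $ i)) (uni_series cos_coeff i)"
proof (induction n)
  case 0
  show ?case
    by (auto simp: nth_uni_series intro!: partial_fun_coord(1) DERIV_sin DERIV_cos)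
next
  case (Suc n)
  have 1: "partial j (\<lambda>x :: real^'a. sin (x $ i)) = (\<lambda>x. if j = i then cos (x $ i) else 0)"
       "partial j (\<lambda>x :: real^'a. cos (x $ i)) = (\<lambda>x. if j = i then - sin (x $ i) else 0)" for j
    by (rule partial_fun_coord(2) DERIV_sin DERIV_cos)+
  have 2: "(\<lambda>k. real (Suc k) * sin_coeff (Suc k)) = cos_coeff"
    by (simp add: sin_coeff_Suc fun_eq_iff)
  have 3: "uni_series (\<lambda>k. real (Suc k) * cos_coeff (Suc k)) i = - uni_series sin_coeff i"
    by (rule mfps_eqI) (auto simp: nth_uni_series cos_coeff_Suc)
  have "jet 0 (\<lambda>x. sin (x $ i)) (uni_series sin_coeff i)" "jet 0 (\<lambda>x. cos (x $ i)) (uni_series cos_coeff i)"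
    using Suc jet_imp_jet_0 by blast+
  moreover have "jet n (partial j (\<lambda>x. sin (x $ i))) (mfps_deriv j (uni_series sin_coeff i))"
    "jet n (partial j (\<lambda>x. cos (x $ i))) (mfps_deriv j (uni_series cos_coeff i))" for j
    unfolding 1 deriv_uni_series 2 3 using Suc by (auto intro: jet_uminus)
  ultimately show ?case
    by (intro conjI jet_SucI)
qed

section \<open>Functions with bounded partial derivatives\<close>

primrec bdd_partials :: "nat \<Rightarrow> (real^'n::finite \<Rightarrow> real) \<Rightarrow> bool" where
  "bdd_partials 0 g \<longleftrightarrow> (\<forall>x. g differentiable (at x)) \<and> (\<exists>B. \<forall>x. \<bar>g x\<bar> \<le> B)"
| "bdd_partials (Suc n) g \<longleftrightarrow> (\<forall>x. g differentiable (at x)) \<and> (\<exists>B. \<forall>x. \<bar>g x\<bar> \<le> B) \<and>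
     (\<forall>i. bdd_partials n (partial i g))"

lemma bdd_partials_imp_0: "bdd_partials n g \<Longrightarrow> bdd_partials 0 g"
  by (cases n) auto

lemma bdd_partials_Suc_imp: "bdd_partials (Suc n) g \<Longrightarrow> bdd_partials n g"
  by (induction n arbitrary: g) auto

lemma bdd_partials_const: "bdd_partials n (\<lambda>x. c)"
  by (induction n arbitrary: c) auto

lemma bdd_partials_add:
  "bdd_partials n f \<Longrightarrow> bdd_partials n g \<Longrightarrow> bdd_partials n (\<lambda>x. f x + g x)"
proof (induction n arbitrary: f g)
  case 0
  then obtain A B where "\<And>x. \<bar>f x\<bar> \<le> A" "\<And>x. \<bar>g x\<bar> \<le> B" by auto
  then have "\<bar>f x + g x\<bar> \<le> A + B" for x
    by (meson abs_triangle_ineq add_mono order_trans)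
  with 0 show ?case by auto
next
  case (Suc n)
  then obtain A B where "\<And>x. \<bar>f x\<bar> \<le> A" "\<And>x. \<bar>g x\<bar> \<le> B" by auto
  then have "\<bar>f x + g x\<bar> \<le> A + B" for x
    by (meson abs_triangle_ineq add_mono order_trans)
  with Suc show ?case by (auto simp: partial_add)
qed

lemma bdd_partials_mult:
  "bdd_partials n f \<Longrightarrow> bdd_partials n g \<Longrightarrow> bdd_partials n (\<lambda>x. f x * g x)"
proof (induction n arbitrary: f g)
  case 0
  then obtain A B where "\<And>x. \<bar>f x\<bar> \<le> A" "\<And>x. \<bar>g x\<bar> \<le> B" by auto
  then have "\<bar>f x * g x\<bar> \<le> A * B" for x
    unfolding abs_mult by (intro mult_mono) (auto intro: order_trans[OF abs_ge_zero])
  with 0 show ?case by auto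
next
  case (Suc n)
  then obtain A B where "\<And>x. \<bar>f x\<bar> \<le> A" "\<And>x. \<bar>g x\<bar> \<le> B" by auto
  then have "\<bar>f x * g x\<bar> \<le> A * B" for x
    unfolding abs_mult by (intro mult_mono) (auto intro: order_trans[OF abs_ge_zero])
  moreover have "bdd_partials n f" "bdd_partials n g"
    using Suc.prems bdd_partials_Suc_imp by blast+
  ultimately show ?case
    using Suc by (auto simp: partial_mult intro!: bdd_partials_add)
qed

lemma bdd_partials_power: "bdd_partials n f \<Longrightarrow> bdd_partials n (\<lambda>x. f x ^ k)"
  by (induction k) (auto intro: bdd_partials_mult bdd_partials_const)

lemma bdd_partials_prod:
  "(\<And>a. a \<in> A \<Longrightarrow> bdd_partials n (f a)) \<Longrightarrow> bdd_partials n (\<lambda>x. \<Prod>a\<in>A. f a x)"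
  by (induction A rule: infinite_finite_induct) (auto intro: bdd_partials_mult bdd_partials_const)

lemma bdd_partials_sin_cos:
  "bdd_partials n (\<lambda>x. sin (x $ i)) \<and> bdd_partials n (\<lambda>x. cos (x $ i))"
proof (induction n)
  case 0
  show ?case
    by (auto intro!: partial_fun_coord(1) DERIV_sin DERIV_cos exI[of _ 1])
next
  case (Suc n)
  have 1: "partial j (\<lambda>x :: real^'a. sin (x $ i)) = (\<lambda>x. if j = i then cos (x $ i) else 0)"
       "partial j (\<lambda>x :: real^'a. cos (x $ i)) = (\<lambda>x. if j = i then - 1 * sin (x $ i) else 0)" for j
    by (auto simp: partial_fun_coord(2)[OF DERIV_sin] partial_fun_coord(2)[OF DERIV_cos])
  have "bdd_partials n (\<lambda>x. - 1 * sin (x $ i))"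
    using Suc by (intro bdd_partials_mult bdd_partials_const) auto
  then have "bdd_partials n (partial j (\<lambda>x. sin (x $ i)))" "bdd_partials n (partial j (\<lambda>x. cos (x $ i)))" for j
    unfolding 1 using Suc by (cases "j = i"; simp add: bdd_partials_const)+
  then show ?case
    using bdd_partials_imp_0[OF conjunct1[OF Suc]] bdd_partials_imp_0[OF conjunct2[OF Suc]] by simp
qed

lemma bdd_partials_foldr:
  "bdd_partials n g \<Longrightarrow> \<exists>M. \<forall>is x. length is \<le> n \<longrightarrow> \<bar>foldr partial is g x\<bar> \<le> M"
proof (induction n arbitrary: g)
  case 0
  then show ?case by auto
next
  case (Suc n)
  then obtain B where B: "\<And>x. \<bar>g x\<bar> \<le> B" by auto
  have "\<forall>i. \<exists>M. \<forall>is x. length is \<le> n \<longrightarrow> \<bar>foldr partial is (partial i g) x\<bar> \<le> M"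
    using Suc by auto
  then obtain M where M: "\<And>i is x. length is \<le> n \<Longrightarrow> \<bar>foldr partial is (partial i g) x\<bar> \<le> M i"
    by metis
  \<comment> \<open>\<open>foldr\<close> applies the last entry of the list first, hence the case
    distinction from the right end.\<close>
  have "\<bar>foldr partial is g x\<bar> \<le> \<bar>B\<bar> + (\<Sum>i\<in>UNIV. \<bar>M i\<bar>)" if "length is \<le> Suc n" for "is" x
  proof (cases "is" rule: rev_cases)
    case Nil
    have "\<bar>g x\<bar> \<le> \<bar>B\<bar>"
      using B[of x] by simp
    moreover have "0 \<le> (\<Sum>i\<in>UNIV. \<bar>M i\<bar>)"
      by (simp add: sum_nonneg)
    ultimately have "\<bar>g x\<bar> \<le> \<bar>B\<bar> + (\<Sum>i\<in>UNIV. \<bar>M i\<bar>)"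
      by linarith
    then show ?thesis unfolding Nil by simp
  next
    case (snoc js i)
    have "M i \<le> \<bar>M i\<bar>" by simp
    also have "\<dots> \<le> (\<Sum>i\<in>UNIV. \<bar>M i\<bar>)"
      by (rule member_le_sum) auto
    finally have "M i \<le> \<bar>B\<bar> + (\<Sum>i\<in>UNIV. \<bar>M i\<bar>)"
      by simp
    with M[of js i x] snoc that show ?thesis by simp
  qed
  then show ?case by blast
qed

section \<open>Rescaling the argument\<close>

lemma foldr_partial_scale:
  assumes "\<And>is x. foldr partial is h differentiable (at x)"
  shows "foldr partial is (\<lambda>x :: real^'n::finite. h (c *\<^sub>R x)) = (\<lambda>x. c ^ length is *\<^sub>R foldr partial is h (c *\<^sub>R x))"
proof (induction "is")
  case (Cons i "is")
  have D: "((\<lambda>x. foldr partial is h (c *\<^sub>R x)) has_derivative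
      (\<lambda>v. frechet_derivative (foldr partial is h) (at (c *\<^sub>R x)) (c *\<^sub>R v))) (at x)" for x
    by (rule has_derivative_compose[of "\<lambda>x. c *\<^sub>R x" "\<lambda>x. c *\<^sub>R x"])
       (auto intro!: derivative_eq_intros assms simp flip: frechet_derivative_works)
  have "partial i (\<lambda>x. foldr partial is h (c *\<^sub>R x)) = (\<lambda>x. c *\<^sub>R partial i (foldr partial is h) (c *\<^sub>R x))"
    unfolding partialI[OF D] partial_def[of i "foldr partial is h"]
    using linear_frechet_derivative[OF assms] by (simp add: linear_scale)
  moreover have "(\<lambda>x. foldr partial is h (c *\<^sub>R x)) differentiable (at x)" for x
    using D unfolding differentiable_def by blast
  ultimately show ?case
    by (simp add: Cons partial_scaleR mult.commute)
qed simp

lemma has_jet_scale: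
  assumes "has_jet h s"
  obtains t where "has_jet (\<lambda>x. h (c *\<^sub>R x)) t" "\<And>\<alpha>. mfps_nth t \<alpha> = c ^ mdeg \<alpha> * mfps_nth s \<alpha>"
proof
  let ?\<Phi> = "\<lambda>j. c *\<^sub>R mfps_X j"
  have ord: "ord_ge 1 (?\<Phi> j)" for j
    by (intro ord_ge_scaleR ord_ge_XX)
  have "jet n (\<lambda>x. h (\<chi> j. c * x $ j)) (mfps_subst s ?\<Phi>)" for n
    using assms unfolding has_jet_def by (intro jet_compose ord jet_scale jet_coord) auto
  moreover have "(\<chi> j. c * x $ j) = c *\<^sub>R x" for x :: "real^'a"
    by (simp add: vec_eq_iff)
  ultimately show "has_jet (\<lambda>x. h (c *\<^sub>R x)) (mfps_subst s ?\<Phi>)"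
    by (simp add: has_jet_def)
  fix \<alpha> :: "'a \<Rightarrow> nat"
  have pw: "pw ?\<Phi> \<beta> = c ^ mdeg \<beta> *\<^sub>R mfps_monom \<beta>" for \<beta> :: "'a \<Rightarrow> nat"
  proof (induction \<beta> rule: mdeg_Suc_induct)
    case (add i \<beta>)
    then show ?case
      by (simp add: pw_unit_add mono_mult mult.commute[of "mfps_monom \<beta>"] add.commute[of \<beta>] del: plus_fun_apply)
  qed (simp del: zero_fun_apply)
  have "mfps_nth (mfps_subst s ?\<Phi>) \<alpha> = (\<Sum>\<beta> | mdeg \<beta> \<le> mdeg \<alpha>. mfps_nth s \<beta> * mfps_nth (pw ?\<Phi> \<beta>) \<alpha>)"
    by (rule nth_subst[OF ord]) simp
  also have "\<dots> = (\<Sum>\<beta> | mdeg \<beta> \<le> mdeg \<alpha>. if \<beta> = \<alpha> then c ^ mdeg \<beta> * mfps_nth s \<beta> else 0)"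
    unfolding pw by (rule sum.cong) auto
  finally show "mfps_nth (mfps_subst s ?\<Phi>) \<alpha> = c ^ mdeg \<alpha> * mfps_nth s \<alpha>"
    by (simp add: sum.delta')
qed

lemma smooth_on_foldr_differentiable: "smooth_on UNIV g \<Longrightarrow> foldr partial is g differentiable (at x)"
  by (auto simp: smooth_on_def)

lemma foldr_partial_add:
  assumes "smooth_on UNIV f" "smooth_on UNIV g"
  shows "foldr partial is (\<lambda>x. f x + g x) = (\<lambda>x. foldr partial is f x + foldr partial is g x)"
  by (induction "is") (auto simp: partial_add smooth_on_foldr_differentiable assms)

lemma foldr_partial_scaleR:
  assumes "smooth_on UNIV f"
  shows "foldr partial is (\<lambda>x. c *\<^sub>R f x) = (\<lambda>x. c *\<^sub>R foldr partial is f x)"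
  by (induction "is") (auto simp: partial_scaleR smooth_on_foldr_differentiable assms)

text \<open>
  \<open>\<lambda>\<^sup>-\<^sup>k h(\<lambda>x)\<close> has the same homogeneous part of degree \<open>k\<close> as \<open>h\<close>, but its partial
  derivatives of order \<open>< k\<close> are \<open>O(1/\<lambda>)\<close>.
\<close>

lemma small_function_with_leading_monomial:
  fixes \<beta> :: "'n::finite \<Rightarrow> nat"
  assumes "\<epsilon> > 0"
  shows "\<exists>g s. has_jet g s \<and> ord_ge (Suc (mdeg \<beta>)) (s - mfps_monom \<beta>) \<and>
    (\<forall>is. \<exists>B. \<forall>x. \<bar>foldr partial is g x\<bar> \<le> B) \<and>
    (\<forall>is x. length is < mdeg \<beta> \<longrightarrow> \<bar>foldr partial is g x\<bar> \<le> \<epsilon>)"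
proof -
  define h where "h = (\<lambda>x :: real^'n. \<Prod>i\<in>UNIV. sin (x $ i) ^ \<beta> i)"
  define S where "S = (\<lambda>i :: 'n. uni_series sin_coeff i)"
  define k where "k = mdeg \<beta>"
  have h: "has_jet h (pw S \<beta>)"
    unfolding has_jet_def h_def pw_def S_def
    using jet_sin_cos by (intro allI jet_prod jet_power) blast
  have hs: "smooth_on UNIV h"
    using h by (rule has_jet_smooth_on)
  have bdd: "bdd_partials n h" for n
    unfolding h_def using bdd_partials_sin_cos by (intro bdd_partials_prod bdd_partials_power) blast
  \<comment> \<open>Each sine differs from its coordinate by a series of order 2, so the products
    differ beyond the degree of \<beta>.\<close>
  have ord: "ord_ge (Suc k) (pw S \<beta> - mfps_monom \<beta>)"
  proof (cases "\<beta> = 0")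
    case False
    then have 1: "1 \<le> mdeg \<beta>"
      by (metis mdeg_eq_0 less_one not_le)
    have "ord_ge 2 (S i - mfps_X i)" for i
      unfolding ord_ge_def supported_def
    proof (intro allI impI)
      fix \<alpha> :: "'n \<Rightarrow> nat"
      assume nz: "mfps_nth (S i - mfps_X i) \<alpha> \<noteq> 0"
      show "\<alpha> \<in> {\<alpha>. 2 \<le> mdeg \<alpha>}"
      proof (rule ccontr)
        assume "\<alpha> \<notin> {\<alpha>. 2 \<le> mdeg \<alpha>}"
        then consider "mdeg \<alpha> = 0" | "mdeg \<alpha> = 1" by fastforce
        then show False
        proof cases
          case 1
          then show False using nz by (simp add: S_def nth_uni_series)
        next
          case 2
          then obtain j where "\<alpha> = unit_idx j" by (rule mdeg_eq_1E)
          moreover have "unit_idx j i = 0" if "i \<noteq> j"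
            using that by simp
          ultimately show False
            using nz by (cases "i = j") (auto simp: S_def nth_uni_series sin_coeff_def split: if_splits)
        qed
      qed
    qed
    from pw_perturb[of mfps_X 2 "\<lambda>i. S i - mfps_X i", OF ord_ge_XX this _ 1] show ?thesis
      by (simp add: k_def)
  qed (simp add: pw_def ord_ge_def)
  obtain M where M: "\<And>is x. length is \<le> k \<Longrightarrow> \<bar>foldr partial is h x\<bar> \<le> M"
    using bdd_partials_foldr[OF bdd[of k]] by blast
  \<comment> \<open>A derivative of order l < k of the rescaled function is bounded by c^(l - k) *
    M, hence by M / c; the second entry of the maximum brings this below \<epsilon>, the first makes
    powers of c increasing.\<close>
  define c where "c = max 1 (M / \<epsilon>)"
  have c: "c \<ge> 1" "M / \<epsilon> \<le> c"
    by (auto simp: c_def)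
  obtain t where t: "has_jet (\<lambda>x. h (c *\<^sub>R x)) t" "\<And>\<alpha>. mfps_nth t \<alpha> = c ^ mdeg \<alpha> * mfps_nth (pw S \<beta>) \<alpha>"
    using has_jet_scale[OF h] by blast
  define g where "g = (\<lambda>x. inverse (c ^ k) * h (c *\<^sub>R x))"
  define s where "s = inverse (c ^ k) *\<^sub>R t"
  have gs: "has_jet g s"
    using t(1) unfolding has_jet_def g_def s_def by (auto intro: jet_scale)
  have "mfps_nth (s - mfps_monom \<beta>) \<alpha> = 0" if "mdeg \<alpha> \<le> k" for \<alpha>
  proof -
    have eq: "mfps_nth (pw S \<beta>) \<alpha> = (if \<alpha> = \<beta> then 1 else 0)"
      using ord_geD[OF ord, of \<alpha>] that by (simp split: if_splits)
    have "mfps_nth s \<alpha> = (if \<alpha> = \<beta> then 1 else 0)"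
      unfolding s_def nth_simps t(2) eq using c(1) by (auto simp: k_def)
    then show ?thesis by simp
  qed
  then have "ord_ge (Suc k) (s - mfps_monom \<beta>)"
    unfolding ord_ge_def supported_def by (auto simp: Suc_le_eq simp flip: not_le)
  moreover have D: "foldr partial is g x = inverse (c ^ k) * (c ^ length is * foldr partial is h (c *\<^sub>R x))" for "is" x
  proof -
    have "foldr partial is g = (\<lambda>x. inverse (c ^ k) *\<^sub>R foldr partial is (\<lambda>x. h (c *\<^sub>R x)) x)"
      unfolding g_def using foldr_partial_scaleR[OF has_jet_smooth_on[OF t(1)], of "is" "inverse (c ^ k)"] by simp
    then show ?thesis
      using foldr_partial_scale[OF smooth_on_foldr_differentiable[OF hs]] by simp
  qed
  moreover have "\<exists>B. \<forall>x. \<bar>foldr partial is g x\<bar> \<le> B" for "is"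
  proof -
    obtain B where B: "\<And>x. \<bar>foldr partial is h x\<bar> \<le> B"
      using bdd_partials_foldr[OF bdd[of "length is"]] by blast
    have "\<bar>foldr partial is g x\<bar> \<le> inverse (c ^ k) * (c ^ length is * B)" for x
      unfolding D using c(1) B[of "c *\<^sub>R x"] by (simp add: abs_mult mult_left_mono)
    then show ?thesis by blast
  qed
  moreover have "\<bar>foldr partial is g x\<bar> \<le> \<epsilon>" if "length is < k" for "is" x
  proof -
    have "c ^ length is * c \<le> c ^ k"
      using that c(1) power_increasing[of "Suc (length is)" k c] by (simp add: mult.commute)
    then have "inverse (c ^ k) * c ^ length is \<le> inverse c"
      using c(1) by (simp add: field_simps)
    then have "inverse (c ^ k) * c ^ length is * \<bar>foldr partial is h (c *\<^sub>R x)\<bar> \<le> inverse c * M"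
      using M[of "is" "c *\<^sub>R x"] that c(1) by (intro mult_mono) auto
    also have "\<dots> \<le> \<epsilon>"
      using c \<open>\<epsilon> > 0\<close> by (simp add: field_simps)
    finally show ?thesis
      unfolding D using c(1) by (simp add: abs_mult mult.assoc)
  qed
  ultimately show ?thesis
    using gs unfolding k_def by blast
qed

text \<open>A homogeneous p is a finite combination of monomials, for which the functions are
  already available; \<epsilon> is halved at each summand added.\<close>

lemma small_function_with_leading_part:
  fixes p :: "'n::finite mfps"
  assumes "homogeneous k p" "\<epsilon> > 0"
  shows "\<exists>g s. has_jet g s \<and> ord_ge (Suc k) (s - p) \<and>
    (\<forall>is. \<exists>B. \<forall>x. \<bar>foldr partial is g x\<bar> \<le> B) \<and>
    (\<forall>is x. length is < k \<longrightarrow> \<bar>foldr partial is g x\<bar> \<le> \<epsilon>)"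
proof -
  let ?P = "\<lambda>p \<epsilon>. \<exists>g s. has_jet g s \<and> ord_ge (Suc k) (s - p) \<and>
    (\<forall>is. \<exists>B. \<forall>x. \<bar>foldr partial is g x\<bar> \<le> B) \<and>
    (\<forall>is x. length is < k \<longrightarrow> \<bar>foldr partial is g x\<bar> \<le> \<epsilon>)"
  have scale: "?P (c *\<^sub>R mfps_monom \<beta>) \<epsilon>" if \<epsilon>: "\<epsilon> > 0" and deg: "mdeg \<beta> = k" for c \<epsilon> and \<beta> :: "'n \<Rightarrow> nat"
  proof -
    \<comment> \<open>Adding 1 keeps the divisor positive when c = 0.\<close>
    have "\<epsilon> / (1 + \<bar>c\<bar>) > 0" using \<epsilon> by simp
    from small_function_with_leading_monomial[OF this, of \<beta>] obtain g s where gs: "has_jet g s"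
      "ord_ge (Suc k) (s - mfps_monom \<beta>)" "\<And>is. \<exists>B. \<forall>x. \<bar>foldr partial is g x\<bar> \<le> B"
      "\<And>is x. length is < k \<Longrightarrow> \<bar>foldr partial is g x\<bar> \<le> \<epsilon> / (1 + \<bar>c\<bar>)"
      unfolding deg by blast
    have D: "foldr partial is (\<lambda>x. c * g x) x = c * foldr partial is g x" for "is" x
      using foldr_partial_scaleR[OF has_jet_smooth_on[OF gs(1)], of "is" c] by simp
    have "has_jet (\<lambda>x. c * g x) (c *\<^sub>R s)"
      using gs(1) by (auto simp: has_jet_def intro: jet_scale)
    moreover have "ord_ge (Suc k) (c *\<^sub>R s - c *\<^sub>R mfps_monom \<beta>)"
      using ord_ge_scaleR[OF gs(2), of c] by (simp add: scaleR_diff_right)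
    moreover have "\<exists>B. \<forall>x. \<bar>foldr partial is (\<lambda>x. c * g x) x\<bar> \<le> B" for "is"
      using gs(3)[of "is"] unfolding D abs_mult by (meson abs_ge_zero mult_left_mono)
    moreover have "\<bar>foldr partial is (\<lambda>x. c * g x) x\<bar> \<le> \<epsilon>" if "length is < k" for "is" x
    proof -
      have "\<bar>c\<bar> * \<bar>foldr partial is g x\<bar> \<le> (1 + \<bar>c\<bar>) * (\<epsilon> / (1 + \<bar>c\<bar>))"
        using gs(4)[OF that, of x] by (intro mult_mono) auto
      then show ?thesis unfolding D abs_mult by simp
    qed
    ultimately show ?thesis by blast
  qed
  have sum: "?P (\<Sum>\<beta>\<in>A. c \<beta> *\<^sub>R mfps_monom \<beta>) \<epsilon>" if "finite A" "\<epsilon> > 0" "\<And>\<beta>. \<beta> \<in> A \<Longrightarrow> mdeg \<beta> = k"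
    for c \<epsilon> and A :: "('n \<Rightarrow> nat) set"
    using that
  proof (induction A arbitrary: \<epsilon> rule: finite_induct)
    case empty
    have "has_jet (\<lambda>x :: real^'n. 0) 0"
      by (simp add: has_jet_def)
    moreover have "foldr partial is (\<lambda>x :: real^'n. 0 :: real) = (\<lambda>x. 0)" for "is"
      by (induction "is") auto
    ultimately show ?case
      using empty by (intro exI[of _ "\<lambda>x. 0"] exI[of _ 0]) (auto simp: ord_ge_def)
  next
    case (insert \<beta> A)
    have \<epsilon>2: "\<epsilon> / 2 > 0" using insert.prems by simp
    obtain g s where gs: "has_jet g s" "ord_ge (Suc k) (s - c \<beta> *\<^sub>R mfps_monom \<beta>)"
      "\<And>is. \<exists>B. \<forall>x. \<bar>foldr partial is g x\<bar> \<le> B" "\<And>is x. length is < k \<Longrightarrow> \<bar>foldr partial is g x\<bar> \<le> \<epsilon> / 2"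
      using scale[OF \<epsilon>2, of \<beta> "c \<beta>"] insert.prems by blast
    obtain g' s' where gs': "has_jet g' s'" "ord_ge (Suc k) (s' - (\<Sum>\<beta>\<in>A. c \<beta> *\<^sub>R mfps_monom \<beta>))"
      "\<And>is. \<exists>B. \<forall>x. \<bar>foldr partial is g' x\<bar> \<le> B" "\<And>is x. length is < k \<Longrightarrow> \<bar>foldr partial is g' x\<bar> \<le> \<epsilon> / 2"
      using insert.IH[OF \<epsilon>2] insert.prems by blast
    have D: "foldr partial is (\<lambda>x. g x + g' x) x = foldr partial is g x + foldr partial is g' x" for "is" x
      using foldr_partial_add[OF has_jet_smooth_on[OF gs(1)] has_jet_smooth_on[OF gs'(1)]] by simp
    show ?case
    proof (rule exI, rule exI, intro conjI allI impI)
      show "has_jet (\<lambda>x. g x + g' x) (s + s')"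
        using gs(1) gs'(1) by (auto simp: has_jet_def intro: jet_add)
      show "ord_ge (Suc k) (s + s' - (\<Sum>\<beta>\<in>insert \<beta> A. c \<beta> *\<^sub>R mfps_monom \<beta>))"
        using ord_ge_add[OF gs(2) gs'(2)] insert.hyps by (simp add: algebra_simps)
      fix "is" :: "'n list"
      obtain B B' where "\<And>x. \<bar>foldr partial is g x\<bar> \<le> B" "\<And>x. \<bar>foldr partial is g' x\<bar> \<le> B'"
        using gs(3)[of "is"] gs'(3)[of "is"] by blast
      then have "\<bar>foldr partial is g x + foldr partial is g' x\<bar> \<le> B + B'" for x
        by (meson abs_triangle_ineq add_mono order_trans)
      then show "\<exists>B. \<forall>x. \<bar>foldr partial is (\<lambda>x. g x + g' x) x\<bar> \<le> B"
        unfolding D by blast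
      fix x
      assume "length is < k"
      then show "\<bar>foldr partial is (\<lambda>x. g x + g' x) x\<bar> \<le> \<epsilon>"
        using gs(4)[of "is" x] gs'(4)[of "is" x] unfolding D by linarith
    qed
  qed
  show ?thesis
    by (subst hom_eq_sum_mono[OF assms(1)], rule sum) (use assms(2) in auto)
qed

section \<open>Termwise differentiation of series\<close>

lemma summable_of_bounded_partials:
  fixes g :: "nat \<Rightarrow> real^'n::finite \<Rightarrow> real"
  assumes "\<And>is. \<exists>B. summable B \<and> (\<forall>k x. \<bar>foldr partial is (g k) x\<bar> \<le> B k)"
  shows "summable (\<lambda>k. g k x)"
  using assms[of "[]"] by (auto intro: summable_comparison_test')

text \<open>A differential is a combination of finitely many partial derivatives, so uniform
  convergence of the series of each partial derivative gives the uniform convergence of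
  differentials that termwise differentiation needs.\<close>

lemma has_derivative_suminf_partials:
  fixes g :: "nat \<Rightarrow> real^'n::finite \<Rightarrow> real"
  assumes diff: "\<And>k x. g k differentiable (at x)" and summ: "\<And>x. summable (\<lambda>k. g k x)"
    and bound: "\<And>j. \<exists>B. summable B \<and> (\<forall>k x. \<bar>partial j (g k) x\<bar> \<le> B k)"
  shows "((\<lambda>x. \<Sum>k. g k x) has_derivative (\<lambda>h. \<Sum>j\<in>UNIV. h $ j * (\<Sum>k. partial j (g k) x))) (at x)"
proof -
  let ?D = "\<lambda>x h. \<Sum>j\<in>UNIV. h $ j * (\<Sum>k. partial j (g k) x)"
  have fd: "frechet_derivative (g k) (at x) h = (\<Sum>j\<in>UNIV. h $ j * partial j (g k) x)" for k x h
    unfolding partial_def by (rule linear_sum_axis[OF linear_frechet_derivative[OF diff]])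
  have lim: "uniform_limit UNIV (\<lambda>n x. \<Sum>k<n. partial j (g k) x) (\<lambda>x. \<Sum>k. partial j (g k) x) sequentially" for j
    using bound[of j] by (auto intro!: Weierstrass_m_test)
  have "\<exists>f. \<forall>x\<in>UNIV. (\<lambda>k. g k x) sums f x \<and> (f has_derivative ?D x) (at x within UNIV)"
  proof (rule has_derivative_series[where x = 0 and f' = "\<lambda>k x. frechet_derivative (g k) (at x)"])
    show "\<And>n x. (g n has_derivative frechet_derivative (g n) (at x)) (at x)"
      using diff frechet_derivative_works by blast
    show "(\<lambda>n. g n 0) sums (\<Sum>n. g n 0)"
      using summ by (rule summable_sums)
    fix e :: real
    assume "e > 0"
    \<comment> \<open>Each of the \<open>CARD('n)\<close> coordinates contributes at most
      \<open>norm h * d\<close> to the error.\<close>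
    define d where "d = e / real CARD('n)"
    have "d > 0" using \<open>e > 0\<close> by (simp add: d_def)
    then have "\<forall>\<^sub>F n in sequentially. \<forall>j. \<forall>x\<in>UNIV. dist (\<Sum>k<n. partial j (g k) x) (\<Sum>k. partial j (g k) x) < d"
      using lim unfolding uniform_limit_iff by (intro eventually_all_finite) auto
    then show "\<forall>\<^sub>F n in sequentially. \<forall>x\<in>UNIV. \<forall>h. norm ((\<Sum>k<n. frechet_derivative (g k) (at x) h) - ?D x h) \<le> e * norm h"
    proof eventually_elim
      case (elim n)
      show ?case
      proof (intro ballI allI)
        fix x h :: "real^'n"
        have "(\<Sum>k<n. frechet_derivative (g k) (at x) h) = (\<Sum>j\<in>UNIV. h $ j * (\<Sum>k<n. partial j (g k) x))"
          unfolding fd by (subst sum.swap) (simp add: sum_distrib_left)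
        then have "norm ((\<Sum>k<n. frechet_derivative (g k) (at x) h) - ?D x h)
            = \<bar>\<Sum>j\<in>UNIV. h $ j * ((\<Sum>k<n. partial j (g k) x) - (\<Sum>k. partial j (g k) x))\<bar>"
          by (simp add: sum_subtractf algebra_simps)
        also have "\<dots> \<le> (\<Sum>j\<in>UNIV. \<bar>h $ j * ((\<Sum>k<n. partial j (g k) x) - (\<Sum>k. partial j (g k) x))\<bar>)"
          by (rule sum_abs)
        also have "\<dots> \<le> (\<Sum>j\<in>(UNIV :: 'n set). norm h * d)"
        proof (rule sum_mono)
          fix j :: 'n
          have "\<bar>(\<Sum>k<n. partial j (g k) x) - (\<Sum>k. partial j (g k) x)\<bar> \<le> d"
            using elim by (simp add: dist_real_def less_imp_le)
          then show "\<bar>h $ j * ((\<Sum>k<n. partial j (g k) x) - (\<Sum>k. partial j (g k) x))\<bar> \<le> norm h * d"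
            unfolding abs_mult by (intro mult_mono component_le_norm_cart) auto
        qed
        also have "\<dots> = e * norm h"
          by (simp add: d_def)
        finally show "norm ((\<Sum>k<n. frechet_derivative (g k) (at x) h) - ?D x h) \<le> e * norm h" .
      qed
    qed
  qed auto
  then obtain f where f: "\<And>x. (\<lambda>k. g k x) sums f x" "\<And>x. (f has_derivative ?D x) (at x)"
    by auto
  have "f = (\<lambda>x. \<Sum>k. g k x)"
    using sums_unique[OF f(1)] by auto
  with f(2) show ?thesis by simp
qed

lemma has_jet_differentiable: "has_jet g s \<Longrightarrow> g differentiable (at x)"
  unfolding has_jet_def using jet_differentiable by blast

text \<open>The bound is assumed for all lists of coordinates, so that the series of partial
  derivatives inherits the hypothesis.\<close>

lemma jet_suminf:
  fixes g :: "nat \<Rightarrow> real^'n::finite \<Rightarrow> real"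
  assumes "\<And>k. has_jet (g k) (s k)"
    and "\<And>is. \<exists>B. summable B \<and> (\<forall>k x. \<bar>foldr partial is (g k) x\<bar> \<le> B k)"
    and "\<And>\<alpha>. (\<lambda>k. mfps_nth (s k) \<alpha>) sums mfps_nth c \<alpha>"
  shows "jet n (\<lambda>x. \<Sum>k. g k x) c"
  using assms
proof (induction n arbitrary: g s c)
  case base: 0
  have D: "((\<lambda>x. \<Sum>k. g k x) has_derivative (\<lambda>h. \<Sum>j\<in>UNIV. h $ j * (\<Sum>k. partial j (g k) x))) (at x)" for x
    using has_jet_differentiable[OF base(1)] summable_of_bounded_partials[OF base(2)] base(2)[of "[_]"]
    by (intro has_derivative_suminf_partials) auto
  have "(\<lambda>k. g k 0) sums mfps_nth c 0"
    unfolding has_jet_at_0[OF base(1)] by (rule base(3))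
  then have zero: "(\<Sum>k. g k 0) = mfps_nth c 0"
    by (rule sums_unique[symmetric])
  show ?case
    using D zero by (auto simp: differentiable_def)
next
  case (Suc n)
  have D: "((\<lambda>x. \<Sum>k. g k x) has_derivative (\<lambda>h. \<Sum>j\<in>UNIV. h $ j * (\<Sum>k. partial j (g k) x))) (at x)" for x
    using has_jet_differentiable[OF Suc.prems(1)] summable_of_bounded_partials[OF Suc.prems(2)] Suc.prems(2)[of "[_]"]
    by (intro has_derivative_suminf_partials) auto
  have partial_eq: "partial i (\<lambda>x. \<Sum>k. g k x) = (\<lambda>x. \<Sum>k. partial i (g k) x)" for i
    unfolding partialI[OF D] by (simp add: axis_def if_distrib[of "\<lambda>c. c * _"] cong: if_cong)
  have "jet n (\<lambda>x. \<Sum>k. partial i (g k) x) (mfps_deriv i c)" for i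
  proof (rule Suc.IH)
    show "has_jet (partial i (g k)) (mfps_deriv i (s k))" for k
      using Suc.prems(1) by (rule has_jet_partial)
    \<comment> \<open>The new derivative acts first and therefore stands at the end of the
      list.\<close>
    show "\<exists>B. summable B \<and> (\<forall>k x. \<bar>foldr partial is (partial i (g k)) x\<bar> \<le> B k)" for "is"
      using Suc.prems(2)[of "is @ [i]"] by simp
    show "(\<lambda>k. mfps_nth (mfps_deriv i (s k)) \<alpha>) sums mfps_nth (mfps_deriv i c) \<alpha>" for \<alpha>
      unfolding nth_deriv by (rule sums_mult) (rule Suc.prems(3))
  qed
  moreover have "(\<lambda>k. g k 0) sums mfps_nth c 0"
    unfolding has_jet_at_0[OF Suc.prems(1)] by (rule Suc.prems(3))
  then have zero: "(\<Sum>k. g k 0) = mfps_nth c 0"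
    by (rule sums_unique[symmetric])
  ultimately show ?case
    using D zero
    by (auto simp: differentiable_def partial_eq)
qed

text \<open>A function with prescribed leading part drags along terms of higher degree, so the
  homogeneous parts of \<open>c\<close> cannot be treated independently. Stage k instead realises
  the degree k part of what \<open>c\<close> still lacks after the earlier stages.\<close>

theorem borel_formal:
  fixes c :: "'n::finite mfps"
  shows "\<exists>f. has_jet f c"
proof -
  let ?P = "\<lambda>k p g s. has_jet g s \<and> ord_ge (Suc k) (s - p) \<and>
    (\<forall>is. \<exists>B. \<forall>x. \<bar>foldr partial is g x\<bar> \<le> B) \<and>
    (\<forall>is x. length is < k \<longrightarrow> \<bar>foldr partial is g x\<bar> \<le> (1/2) ^ k)"
  have "\<forall>k p. \<exists>g s. homogeneous k p \<longrightarrow> ?P k p g (s :: 'n mfps)"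
    using small_function_with_leading_part zero_less_power[of "1/2 :: real"] by (metis half_gt_zero zero_less_one)
  then obtain G S where GS: "\<And>k p. homogeneous k p \<Longrightarrow> ?P k p (G k p) (S k p :: 'n mfps)"
    by metis
  define part where "part = (\<lambda>k s :: 'n mfps. Abs_mfps (\<lambda>\<alpha>. if mdeg \<alpha> = k then mfps_nth s \<alpha> else 0))"
  have part_nth: "mfps_nth (part k s) \<alpha> = (if mdeg \<alpha> = k then mfps_nth s \<alpha> else 0)" for k s \<alpha>
    by (simp add: part_def)
  have part_hom: "homogeneous k (part k s)" for k s
    by (simp add: homogeneous_def supported_def part_nth)
  define A where "A = rec_nat (0 :: 'n mfps) (\<lambda>k A. A + S k (part k (c - A)))"
  have A_0: "A 0 = 0" and A_Suc: "A (Suc k) = A k + S k (part k (c - A k))" for k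
    by (simp_all add: A_def)
  define p where "p = (\<lambda>k. part k (c - A k))"
  have GSp: "?P k (p k) (G k (p k)) (S k (p k))" for k
    unfolding p_def by (rule GS) (rule part_hom)
  have S_nth: "mfps_nth (S k (p k)) \<alpha> = mfps_nth (p k) \<alpha>" if "mdeg \<alpha> \<le> k" for k \<alpha>
    using ord_geD[of "Suc k" "S k (p k) - p k" \<alpha>] GSp[of k] that by simp
  have A_eq: "A k = (\<Sum>j<k. S j (p j))" for k
    by (induction k) (simp_all add: A_0 A_Suc p_def)
  have sums: "(\<lambda>k. mfps_nth (S k (p k)) \<alpha>) sums mfps_nth c \<alpha>" for \<alpha>
  proof -
    have "mfps_nth (S k (p k)) \<alpha> = 0" if "k > mdeg \<alpha>" for k
      using S_nth[of \<alpha> k] that by (simp add: p_def part_nth)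
    then have "(\<lambda>k. mfps_nth (S k (p k)) \<alpha>) sums (\<Sum>k<Suc (mdeg \<alpha>). mfps_nth (S k (p k)) \<alpha>)"
      by (intro sums_finite) auto
    also have "(\<Sum>k<Suc (mdeg \<alpha>). mfps_nth (S k (p k)) \<alpha>) = mfps_nth (A (Suc (mdeg \<alpha>))) \<alpha>"
      by (simp only: A_eq nth_sum)
    also have "\<dots> = mfps_nth c \<alpha>"
      using S_nth[of \<alpha> "mdeg \<alpha>"] by (simp add: A_Suc p_def part_nth)
    finally show ?thesis .
  qed
  have bound: "\<exists>B. summable B \<and> (\<forall>k x. \<bar>foldr partial is (G k (p k)) x\<bar> \<le> B k)" for "is" :: "'n list"
  proof -
    have "\<forall>k. \<exists>C. \<forall>x. \<bar>foldr partial is (G k (p k)) x\<bar> \<le> C"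
      using GSp by blast
    then obtain C where C: "\<And>k x. \<bar>foldr partial is (G k (p k)) x\<bar> \<le> C k"
      by metis
    \<comment> \<open>Only the finitely many stages with \<open>k \<le> length is\<close> escape the
      geometric bound; there any bound will do.\<close>
    define B where "B = (\<lambda>k. if length is < k then (1/2) ^ k else C k)"
    have "summable B"
      by (rule summable_comparison_test_ev[of _ "\<lambda>k. (1/2) ^ k"])
         (auto simp: B_def eventually_sequentially intro!: exI[of _ "Suc (length is)"])
    moreover have "\<bar>foldr partial is (G k (p k)) x\<bar> \<le> B k" for k x
      using C GSp[of k] by (simp add: B_def)
    ultimately show ?thesis by blast
  qed
  have "has_jet (\<lambda>x. \<Sum>k. G k (p k) x) c"
    unfolding has_jet_def using GSp bound sums by (intro allI jet_suminf) blast+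
  then show ?thesis by blast
qed

section \<open>The homological operator\<close>

text \<open>Adjoins a square root of -1 to the coefficient ring. Real and imaginary parts are stored
  separately because vector fields, and the spans they are taken in, stay real.\<close>

datatype 'a cx = Cx (cre: 'a) (cim: 'a)

instantiation cx :: (comm_ring_1) comm_ring_1
begin

definition "0 = Cx 0 0"
definition "1 = Cx 1 0"
definition "u + v = Cx (cre u + cre v) (cim u + cim v)"
definition "u - v = Cx (cre u - cre v) (cim u - cim v)"
definition "- u = Cx (- cre u) (- cim u)"
definition "u * v = Cx (cre u * cre v - cim u * cim v) (cre u * cim v + cim u * cre v)"

instance
  by standard (simp_all add: zero_cx_def one_cx_def plus_cx_def minus_cx_def uminus_cx_def
      times_cx_def algebra_simps)

end

lemma cx_sel [simp]:
  "cre 0 = 0" "cim 0 = 0" "cre 1 = 1" "cim 1 = 0"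
  "cre (u + v) = cre u + cre v" "cim (u + v) = cim u + cim v"
  "cre (u - v) = cre u - cre v" "cim (u - v) = cim u - cim v"
  "cre (- u) = - cre u" "cim (- u) = - cim u"
  "cre (u * v) = cre u * cre v - cim u * cim v"
  "cim (u * v) = cre u * cim v + cim u * cre v"
  by (simp_all add: zero_cx_def one_cx_def plus_cx_def minus_cx_def uminus_cx_def times_cx_def)

lemma cx_eqI: "cre u = cre v \<Longrightarrow> cim u = cim v \<Longrightarrow> u = v"
  by (rule cx.expand) simp

abbreviation creal :: "'a::comm_ring_1 \<Rightarrow> 'a cx" where "creal a \<equiv> Cx a 0"

definition cconst :: "complex \<Rightarrow> 'n::finite mfps cx" where
  "cconst c = Cx (of_real (Re c)) (of_real (Im c))"

lemma kx_simps [simp]: "cre (cconst c) = of_real (Re c)" "cim (cconst c) = of_real (Im c)"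
  by (simp_all add: cconst_def)

lemma kx_0 [simp]: "cconst 0 = 0" and kx_1 [simp]: "cconst 1 = 1"
  by (rule cx_eqI; simp)+

lemma kx_add: "cconst (c + d) = cconst c + cconst d" and kx_mult: "cconst (c * d) = cconst c * cconst d"
  and kx_uminus: "cconst (- c) = - cconst c" and kx_diff: "cconst (c - d) = cconst c - cconst d"
  by (rule cx_eqI; simp)+

definition cx_cnj :: "'a::comm_ring_1 cx \<Rightarrow> 'a cx" where
  "cx_cnj u = Cx (cre u) (- cim u)"

lemma cx_cnj_sel [simp]: "cre (cx_cnj u) = cre u" "cim (cx_cnj u) = - cim u"
  by (simp_all add: cx_cnj_def)

lemma cx_cnj_mult: "cx_cnj (u * v) = cx_cnj u * cx_cnj v"
  by (rule cx_eqI) (simp_all add: algebra_simps)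

lemma cx_cnj_one [simp]: "cx_cnj 1 = 1"
  by (rule cx_eqI) simp_all

lemma cx_cnj_power: "cx_cnj (u ^ n) = cx_cnj u ^ n"
  by (induction n) (simp_all add: cx_cnj_mult)

lemma cx_cnj_cnj [simp]: "cx_cnj (cx_cnj u) = u"
  by (rule cx_eqI) simp_all


section \<open>The homological operator of a linear field\<close>

definition lin_part :: "real^'n::finite^'n \<Rightarrow> 'n mfps^'n" where
  "lin_part A = (\<chi> i. \<Sum>j\<in>UNIV. A $ i $ j *\<^sub>R mfps_X j)"

definition lie_deriv :: "real^'n::finite^'n \<Rightarrow> 'n mfps \<Rightarrow> 'n mfps" where
  "lie_deriv A s = (\<Sum>j\<in>UNIV. mfps_deriv j s * lin_part A $ j)"

definition hom_op :: "real^'n::finite^'n \<Rightarrow> 'n mfps^'n \<Rightarrow> 'n mfps^'n" where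
  "hom_op A \<xi> = (\<chi> i. lie_deriv A (\<xi> $ i) - (\<Sum>j\<in>UNIV. A $ i $ j *\<^sub>R \<xi> $ j))"

lemma lie_deriv_add: "lie_deriv A (s + t) = lie_deriv A s + lie_deriv A t"
  by (simp add: lie_deriv_def deriv_add algebra_simps sum.distrib)

lemma lie_deriv_diff: "lie_deriv A (s - t) = lie_deriv A s - lie_deriv A t"
  by (simp add: lie_deriv_def deriv_diff algebra_simps sum_subtractf)

lemma lie_deriv_scaleR: "lie_deriv A (c *\<^sub>R s) = c *\<^sub>R lie_deriv A s"
  by (simp add: lie_deriv_def deriv_scaleR scaleR_sum_right)

lemma lie_deriv_mult: "lie_deriv A (s * t) = lie_deriv A s * t + s * lie_deriv A t"
  by (simp add: lie_deriv_def deriv_mult algebra_simps sum.distrib sum_distrib_left sum_distrib_right)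

lemma lie_deriv_XX: "lie_deriv A (mfps_X i) = lin_part A $ i"
proof -
  have "lie_deriv A (mfps_X i) = (\<Sum>j\<in>UNIV. if i = j then lin_part A $ j else 0)"
    unfolding lie_deriv_def by (rule sum.cong) (auto simp: deriv_XX)
  then show ?thesis by simp
qed

lemma lie_deriv_0 [simp]: "lie_deriv A 0 = 0" and lie_deriv_one [simp]: "lie_deriv A 1 = 0"
  by (simp_all add: lie_deriv_def)

lemma lie_deriv_of_real [simp]: "lie_deriv A (of_real c) = 0"
  by (simp add: of_real_def lie_deriv_scaleR)

lemma hom_op_add: "hom_op A (\<xi> + \<eta>) = hom_op A \<xi> + hom_op A \<eta>"
  by (simp add: hom_op_def vec_eq_iff lie_deriv_add scaleR_add_right sum.distrib)

lemma hom_op_scaleR: "hom_op A (c *\<^sub>R \<xi>) = c *\<^sub>R hom_op A \<xi>"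
  by (simp add: hom_op_def vec_eq_iff lie_deriv_scaleR scaleR_sum_right scaleR_diff_right mult.commute)

lemma linear_hom_op: "linear (hom_op A)"
  by (rule linearI) (simp_all add: hom_op_add hom_op_scaleR)

section \<open>Projections onto sets of exponents\<close>

definition vfilter :: "('n::finite \<Rightarrow> ('n \<Rightarrow> nat) set) \<Rightarrow> 'n mfps^'n \<Rightarrow> 'n mfps^'n" where
  "vfilter Q v = (\<chi> i. Abs_mfps (\<lambda>\<alpha>. if \<alpha> \<in> Q i then mfps_nth (v $ i) \<alpha> else 0))"

lemma nth_vfilter: "mfps_nth (vfilter Q v $ i) \<alpha> = (if \<alpha> \<in> Q i then mfps_nth (v $ i) \<alpha> else 0)"
  by (simp add: vfilter_def)

lemma supported_vfilter: "supported (Q i) (vfilter Q v $ i)"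
  by (auto simp: supported_def nth_vfilter)

lemma supported_vfilter_diff: "supported (- Q i) ((v - vfilter Q v) $ i)"
  by (auto simp: supported_def nth_vfilter)

lemma vfilter_add: "vfilter Q (u + v) = vfilter Q u + vfilter Q v"
  by (simp add: vec_eq_iff, intro allI mfps_eqI) (simp add: nth_vfilter)

lemma vfilter_id: "(\<And>i. supported (Q i) (v $ i)) \<Longrightarrow> vfilter Q v = v"
  by (simp add: vec_eq_iff, intro allI mfps_eqI) (auto simp: nth_vfilter supported_def)

lemma vfilter_eq_0: "(\<And>i. supported (- Q i) (v $ i)) \<Longrightarrow> vfilter Q v = 0"
  by (simp add: vec_eq_iff, intro allI mfps_eqI) (auto simp: nth_vfilter supported_def)

lemma vfilter_scaleR: "vfilter Q (c *\<^sub>R v) = c *\<^sub>R vfilter Q v"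
  by (simp add: vec_eq_iff, intro allI mfps_eqI) (simp add: nth_vfilter)

lemma vfilter_zero: "vfilter Q 0 = 0"
  by (rule vfilter_id) simp

lemma supported_hom_op:
  assumes 1: "\<And>i j l \<beta>. A $ j $ l \<noteq> 0 \<Longrightarrow> unit_idx j + \<beta> \<in> Q' i \<longleftrightarrow> unit_idx l + \<beta> \<in> Q i"
    and 2: "\<And>i j. A $ i $ j \<noteq> 0 \<Longrightarrow> Q' j = Q i"
    and \<xi>: "\<And>i. supported (Q' i) (\<xi> $ i)"
  shows "supported (Q i) (hom_op A \<xi> $ i)"
proof -
  have "supported (Q i) (mfps_deriv j (\<xi> $ i) * (A $ j $ l *\<^sub>R mfps_X l))" for j l
  proof (cases "A $ j $ l = 0")
    case False
    show ?thesis
    proof (rule supported_mult)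
      show "supported {\<beta>. unit_idx j + \<beta> \<in> Q' i} (mfps_deriv j (\<xi> $ i))"
        using \<xi> by (rule supported_deriv) simp
      show "supported {unit_idx l} (A $ j $ l *\<^sub>R mfps_X l)"
        by (intro supported_scaleR supported_monoI) simp
      show "\<And>\<alpha> \<beta>. \<alpha> \<in> {\<beta>. unit_idx j + \<beta> \<in> Q' i} \<Longrightarrow> \<beta> \<in> {unit_idx l} \<Longrightarrow> \<alpha> + \<beta> \<in> Q i"
        using 1[OF False] by (auto simp: add.commute)
    qed
  qed simp
  moreover have "supported (Q i) (A $ i $ j *\<^sub>R \<xi> $ j)" for j
    using 2[of i j] \<xi>[of j] by (cases "A $ i $ j = 0") (auto intro: supported_scaleR)
  ultimately show ?thesis
    unfolding hom_op_def lie_deriv_def lin_part_def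
    by (simp add: sum_distrib_left del: mult_scaleR_right) (intro supported_diff supported_sum)
qed

text \<open>Each term of \<open>lie_deriv\<close> trades a factor x_j for x_l, which is what the
  first hypothesis speaks of; the second covers the subtracted term A \<xi>. Since the conditions
  are equivalences, the operator maps fields supported in \<open>Q'\<close> into \<open>Q\<close>
  and fields supported off \<open>Q'\<close> off \<open>Q\<close>. Two families are required because
  L is reversed by phi.\<close>

lemma vfilter_hom_op:
  assumes 1: "\<And>i j l \<beta>. A $ j $ l \<noteq> 0 \<Longrightarrow> unit_idx j + \<beta> \<in> Q' i \<longleftrightarrow> unit_idx l + \<beta> \<in> Q i"
    and 2: "\<And>i j. A $ i $ j \<noteq> 0 \<Longrightarrow> Q' j = Q i"
  shows "vfilter Q (hom_op A \<xi>) = hom_op A (vfilter Q' \<xi>)"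
proof -
  let ?p = "vfilter Q' \<xi>"
  have "hom_op A \<xi> = hom_op A ?p + hom_op A (\<xi> - ?p)"
    by (simp flip: hom_op_add)
  moreover have "vfilter Q (hom_op A ?p) = hom_op A ?p"
    by (intro vfilter_id supported_hom_op[of A Q' Q] 1 2 supported_vfilter) auto
  moreover have "vfilter Q (hom_op A (\<xi> - ?p)) = 0"
  proof (rule vfilter_eq_0)
    show "supported (- Q i) (hom_op A (\<xi> - ?p) $ i)" for i
      by (rule supported_hom_op[of A "\<lambda>i. - Q' i" "\<lambda>i. - Q i"])
         (use 1 2 supported_vfilter_diff in \<open>auto simp del: plus_fun_apply\<close>)
  qed
  ultimately show ?thesis
    by (simp add: vfilter_add)
qed


section \<open>Complex monomials as eigenvectors\<close>

definition LX :: "real \<Rightarrow> real \<Rightarrow> 6 mfps cx \<Rightarrow> 6 mfps cx" where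
  "LX \<omega>1 \<omega>2 g = Cx (lie_deriv (L_matrix \<omega>1 \<omega>2) (cre g)) (lie_deriv (L_matrix \<omega>1 \<omega>2) (cim g))"

lemma LX_add: "LX w1 w2 (g + h) = LX w1 w2 g + LX w1 w2 h"
  by (rule cx_eqI) (simp_all add: LX_def lie_deriv_add)

lemma LX_mult: "LX w1 w2 (g * h) = LX w1 w2 g * h + g * LX w1 w2 h"
  by (rule cx_eqI) (simp_all add: LX_def lie_deriv_add lie_deriv_diff lie_deriv_mult algebra_simps)

lemma LX_kx [simp]: "LX w1 w2 (cconst c) = 0"
  by (rule cx_eqI) (simp_all add: LX_def)

lemma LX_one [simp]: "LX w1 w2 1 = 0"
  by (rule cx_eqI) (simp_all add: LX_def)

lemma LX_0: "LX w1 w2 0 = 0"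
  by (rule cx_eqI) (simp_all add: LX_def)

lemma LX_uminus: "LX w1 w2 (- g) = - LX w1 w2 g"
  using LX_add[of w1 w2 g "- g"] by (simp add: LX_0 eq_neg_iff_add_eq_0 add.commute)

lemma LX_kx_mult: "LX w1 w2 (cconst c * h) = cconst c * LX w1 w2 h"
  by (simp add: LX_mult)

definition "X1 = creal (mfps_X 1 :: 6 mfps)"
definition "X2 = creal (mfps_X 2 :: 6 mfps)"
definition "Z1 = Cx (mfps_X 3) (mfps_X 4 :: 6 mfps)"
definition "Z2 = Cx (mfps_X 5) (mfps_X 6 :: 6 mfps)"

lemma lin_part_L:
  "lin_part (L_matrix w1 w2) $ 1 = mfps_X 2"
  "lin_part (L_matrix w1 w2) $ 2 = 0"
  "lin_part (L_matrix w1 w2) $ 3 = w1 *\<^sub>R mfps_X 4"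
  "lin_part (L_matrix w1 w2) $ 4 = - (w1 *\<^sub>R mfps_X 3)"
  "lin_part (L_matrix w1 w2) $ 5 = w2 *\<^sub>R mfps_X 6"
  "lin_part (L_matrix w1 w2) $ 6 = - (w2 *\<^sub>R mfps_X 5)"
  by (simp_all add: lin_part_def L_matrix_def sum_6)

lemma LX_gens:
  "LX w1 w2 X1 = X2" "LX w1 w2 X2 = 0"
  "LX w1 w2 Z1 = cconst (- \<i> * w1) * Z1" "LX w1 w2 (cx_cnj Z1) = cconst (\<i> * w1) * cx_cnj Z1"
  "LX w1 w2 Z2 = cconst (- \<i> * w2) * Z2" "LX w1 w2 (cx_cnj Z2) = cconst (\<i> * w2) * cx_cnj Z2"
proof -
  have neg: "lie_deriv A (- s) = - lie_deriv A s" for A and s :: "6 mfps"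
    using lie_deriv_scaleR[of A "-1" s] by simp
  show "LX w1 w2 X1 = X2" "LX w1 w2 X2 = 0"
    "LX w1 w2 Z1 = cconst (- \<i> * w1) * Z1" "LX w1 w2 (cx_cnj Z1) = cconst (\<i> * w1) * cx_cnj Z1"
    "LX w1 w2 Z2 = cconst (- \<i> * w2) * Z2" "LX w1 w2 (cx_cnj Z2) = cconst (\<i> * w2) * cx_cnj Z2"
    by (rule cx_eqI; simp add: LX_def X1_def X2_def Z1_def Z2_def lie_deriv_XX lin_part_L neg scaleR_conv_of_real)+
qed

lemma LX_eigen_power: "LX w1 w2 u = cconst c * u \<Longrightarrow> LX w1 w2 (u ^ n) = cconst (of_nat n * c) * u ^ n"
  by (induction n) (simp_all add: LX_mult kx_add kx_mult algebra_simps)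

lemma LX_eigen_mult:
  "LX w1 w2 u = cconst c * u \<Longrightarrow> LX w1 w2 v = cconst d * v \<Longrightarrow> LX w1 w2 (u * v) = cconst (c + d) * (u * v)"
  by (simp add: LX_mult kx_add algebra_simps)

definition zmon :: "nat \<Rightarrow> nat \<Rightarrow> nat \<Rightarrow> nat \<Rightarrow> 6 mfps cx" where
  "zmon p q r s = (Z1 ^ p * cx_cnj Z1 ^ q) * (Z2 ^ r * cx_cnj Z2 ^ s)"

definition freq :: "real \<Rightarrow> real \<Rightarrow> nat \<Rightarrow> nat \<Rightarrow> nat \<Rightarrow> nat \<Rightarrow> real" where
  "freq w1 w2 p q r s = w1 * (real p - real q) + w2 * (real r - real s)"

lemma LX_zmon: "LX w1 w2 (zmon p q r s) = cconst (- \<i> * freq w1 w2 p q r s) * zmon p q r s"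
proof -
  have "LX w1 w2 (zmon p q r s) = cconst ((of_nat p * (- \<i> * w1) + of_nat q * (\<i> * w1))
      + (of_nat r * (- \<i> * w2) + of_nat s * (\<i> * w2))) * zmon p q r s"
    unfolding zmon_def by (intro LX_eigen_mult LX_eigen_power LX_gens)
  also have "(of_nat p * (- \<i> * w1) + of_nat q * (\<i> * w1))
      + (of_nat r * (- \<i> * w2) + of_nat s * (\<i> * w2)) = - \<i> * complex_of_real (freq w1 w2 p q r s)"
    by (simp add: freq_def algebra_simps)
  finally show ?thesis .
qed

lemma LX_X1_power: "LX w1 w2 (X1 ^ Suc a) = cconst (of_nat (Suc a)) * (X1 ^ a * X2)"
proof (induction a)
  case 0
  show ?case by (simp add: LX_gens LX_mult)
next
  case (Suc a)
  have "cconst (of_nat (Suc (Suc a))) = (1 :: 6 mfps cx) + cconst (of_nat (Suc a))"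
    unfolding of_nat_Suc[of "Suc a"] kx_add by simp
  then show ?case
    unfolding power_Suc[of X1 "Suc a"] LX_mult LX_gens Suc by (simp add: algebra_simps)
qed

lemma LX_X2_power: "LX w1 w2 (X2 ^ b) = 0"
  by (induction b) (simp_all add: LX_mult LX_gens)

definition cmon :: "nat \<Rightarrow> nat \<Rightarrow> 6 mfps cx \<Rightarrow> 6 mfps cx" where
  "cmon a b w = X1 ^ a * X2 ^ b * w"

lemma LX_cmon_0:
  assumes "LX w1 w2 w = cconst m * w"
  shows "LX w1 w2 (cmon 0 b w) = cconst m * cmon 0 b w"
  by (simp add: cmon_def LX_mult LX_X2_power assms algebra_simps)

lemma LX_cmon_Suc:
  assumes "LX w1 w2 w = cconst m * w"
  shows "LX w1 w2 (cmon (Suc a) b w) = cconst m * cmon (Suc a) b w + cconst (of_nat (Suc a)) * cmon a (Suc b) w"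
  unfolding cmon_def LX_mult LX_X2_power LX_X1_power assms by (simp add: algebra_simps)

text \<open>
  Real parts are taken in \<open>emb0\<close>, so that complex monomials span the first two components as well.
\<close>
definition emb0 :: "6 mfps cx \<Rightarrow> 6 mfps cx \<Rightarrow> 6 mfps^6" where
  "emb0 g h = vector [cre g, cre h, 0, 0, 0, 0]"
definition emb1 :: "6 mfps cx \<Rightarrow> 6 mfps^6" where
  "emb1 g = vector [0, 0, cre g, cim g, 0, 0]"
definition emb2 :: "6 mfps cx \<Rightarrow> 6 mfps^6" where
  "emb2 g = vector [0, 0, 0, 0, cre g, cim g]"

lemma hom_op_emb:
  "hom_op (L_matrix w1 w2) (emb0 g h) = emb0 (LX w1 w2 g - h) (LX w1 w2 h)"
  "hom_op (L_matrix w1 w2) (emb1 g) = emb1 (LX w1 w2 g + cconst (\<i> * w1) * g)"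
  "hom_op (L_matrix w1 w2) (emb2 g) = emb2 (LX w1 w2 g + cconst (\<i> * w2) * g)"
  by (simp_all add: vec_eq_iff forall_6 hom_op_def sum_6 emb0_def emb1_def emb2_def LX_def L_matrix_def
       scaleR_conv_of_real)

lemma emb_add:
  "emb0 (g + g') (h + h') = emb0 g h + emb0 g' h'"
  "emb1 (g + g') = emb1 g + emb1 g'"
  "emb2 (g + g') = emb2 g + emb2 g'"
  by (simp_all add: emb0_def emb1_def emb2_def vec_eq_iff forall_6)

section \<open>Solvability modulo the kept fields\<close>

definition solvable :: "real \<Rightarrow> real \<Rightarrow> (6 mfps^6) set \<Rightarrow> (6 mfps^6) set" where
  "solvable w1 w2 N = {hom_op (L_matrix w1 w2) \<xi> + Y | \<xi> Y. Y \<in> N}"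

text \<open>The set is the range of a linear operator plus N. Being a subspace, it has to be checked
  only on a spanning family of fields.\<close>

lemma subspace_solvable:
  assumes "subspace N"
  shows "subspace (solvable w1 w2 N)"
proof -
  have "solvable w1 w2 N = {x + y | x y. x \<in> range (hom_op (L_matrix w1 w2)) \<and> y \<in> N}"
    unfolding solvable_def by blast
  then show ?thesis
    using subspace_sums[OF linear_subspace_image[OF linear_hom_op subspace_UNIV] assms] by simp
qed

lemma hom_op_solvable: "subspace N \<Longrightarrow> hom_op (L_matrix w1 w2) \<xi> \<in> solvable w1 w2 N"
  unfolding solvable_def using subspace_0 by (metis (mono_tags, lifting) add.right_neutral mem_Collect_eq)

lemma normal_solvable: "Y \<in> N \<Longrightarrow> Y \<in> solvable w1 w2 N"
proof -
  have "hom_op (L_matrix w1 w2) 0 = 0"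
    using linear_0[OF linear_hom_op] .
  then show "Y \<in> N \<Longrightarrow> Y \<in> solvable w1 w2 N"
    unfolding solvable_def by (metis (mono_tags, lifting) add.left_neutral mem_Collect_eq)
qed

text \<open>
  The two complex components: \<open>L + \<i>l\<close> acts on \<open>x\<^sub>1\<^sup>a x\<^sub>2\<^sup>b w\<close> as the scalar \<open>m + \<i>l\<close> plus the nilpotent
  operator \<open>x\<^sub>2 \<partial>/\<partial>x\<^sub>1\<close>.
\<close>
lemma emb_cmon_solvable:
  assumes N: "subspace N" and w: "LX w1 w2 w = cconst m * w"
    and e_add: "\<And>g h. e (g + h) = e g + e h"
    and e_op: "\<And>g. hom_op (L_matrix w1 w2) (e g) = e (LX w1 w2 g + cconst (\<i> * l) * g)"
    and res: "\<And>a c. m + \<i> * l = 0 \<Longrightarrow> e (cconst c * cmon a 0 w) \<in> N"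
  shows "e (cconst c * cmon a b w) \<in> solvable w1 w2 N"
proof -
  note S = subspace_solvable[OF N, of w1 w2]
  have e_in: "e (LX w1 w2 g + cconst (\<i> * l) * g) \<in> solvable w1 w2 N" for g
    using hom_op_solvable[OF N, of w1 w2 "e g"] by (simp add: e_op)
  have e_minus: "e (- g) = - e g" and e_diff: "e (g - h) = e g - e h" for g h
  proof -
    have e0: "e 0 = 0" using e_add[of 0 0] by simp
    show "e (- g) = - e g" for g
      using e_add[of g "- g"] e0 by (simp add: eq_neg_iff_add_eq_0 add.commute)
    then show "e (g - h) = e g - e h"
      using e_add[of g "- h"] by simp
  qed
  define \<mu> where "\<mu> = m + \<i> * l"
  show ?thesis
  proof (cases "\<mu> = 0")
    case False
    \<comment> \<open>Dividing by \<mu> leaves an error in which one factor x1 has become x2;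
      induction on the exponent of x1 absorbs it.\<close>
    show ?thesis
    proof (induction a arbitrary: b c)
      case 0
      let ?g = "cconst (c / \<mu>) * cmon 0 b w"
      have "LX w1 w2 ?g + cconst (\<i> * l) * ?g = cconst (c / \<mu> * \<mu>) * cmon 0 b w"
        unfolding \<mu>_def LX_kx_mult LX_cmon_0[OF w] kx_mult kx_add by (simp add: algebra_simps)
      then show ?case
        using e_in[of ?g] False by simp
    next
      case (Suc a)
      let ?g = "cconst (c / \<mu>) * cmon (Suc a) b w"
      have "LX w1 w2 ?g + cconst (\<i> * l) * ?g
          = cconst (c / \<mu> * \<mu>) * cmon (Suc a) b w + cconst (c / \<mu> * of_nat (Suc a)) * cmon a (Suc b) w"
        unfolding \<mu>_def LX_kx_mult LX_cmon_Suc[OF w] kx_mult kx_add by (simp add: algebra_simps)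
      then have "cconst c * cmon (Suc a) b w
          = (LX w1 w2 ?g + cconst (\<i> * l) * ?g) - cconst (c / \<mu> * of_nat (Suc a)) * cmon a (Suc b) w"
        using False by simp
      then show ?case
        unfolding e_diff using e_in[of ?g] Suc by (metis e_diff subspace_diff[OF S])
    qed
  next
    case True
    show ?thesis
    proof (cases b)
      case 0
      then show ?thesis
        using res True normal_solvable unfolding \<mu>_def by simp
    next
      case (Suc b')
      \<comment> \<open>At resonance only \<open>x2 d/dx1\<close> remains, and integration in x1
        gives a preimage of every term that contains x2.\<close>
      let ?g = "cconst (c / of_nat (Suc a)) * cmon (Suc a) b' w"
      have "LX w1 w2 ?g + cconst (\<i> * l) * ?g
          = cconst (c / of_nat (Suc a) * \<mu>) * cmon (Suc a) b' w + cconst (c / of_nat (Suc a) * of_nat (Suc a)) * cmon a b w"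
        unfolding \<mu>_def LX_kx_mult LX_cmon_Suc[OF w] kx_mult kx_add Suc by (simp add: algebra_simps)
      also have "\<dots> = cconst c * cmon a b w"
        unfolding True by (simp del: of_nat_Suc)
      finally show ?thesis
        using e_in[of ?g] by simp
    qed
  qed
qed

text \<open>With D = \<open>LX w1 w2\<close>, the operator sends (g, h) to (D g - h, D h). A first
  entry can be shifted into the second, so the second decides. At resonance D is
  \<open>x2 d/dx1\<close>: terms with x2 squared are reached by integrating twice, terms free of x2
  are kept, and terms linear in x2 are reached with the help of a kept multiple of (x1, x2).\<close>

lemma emb0_cmon_solvable:
  assumes N: "subspace N" and w: "LX w1 w2 w = cconst m * w"
    and res: "\<And>a c. m = 0 \<Longrightarrow> emb0 0 (cconst c * cmon a 0 w) \<in> N"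
    and res': "\<And>a c. m = 0 \<Longrightarrow> emb0 (cconst c * cmon (Suc a) 0 w) (cconst c * cmon a 1 w) \<in> N"
  shows "emb0 (cconst c * cmon a b w) 0 \<in> solvable w1 w2 N \<and> emb0 0 (cconst c * cmon a b w) \<in> solvable w1 w2 N"
proof -
  let ?S = "solvable w1 w2 N"
  note S = subspace_solvable[OF N, of w1 w2]
  have e_in: "emb0 (LX w1 w2 g - h) (LX w1 w2 h) \<in> ?S" for g h
    using hom_op_solvable[OF N, of w1 w2 "emb0 g h"] by (simp add: hom_op_emb)
  have add: "emb0 (g + g') (h + h') \<in> ?S" if "emb0 g h \<in> ?S" "emb0 g' h' \<in> ?S" for g g' h h'
    unfolding emb_add using S that by (rule subspace_add)
  have diff: "emb0 (g - g') (h - h') \<in> ?S" if "emb0 g h \<in> ?S" "emb0 g' h' \<in> ?S" for g g' h h'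
  proof -
    have "emb0 (g - g') (h - h') = emb0 g h - emb0 g' h'"
      by (simp add: emb0_def vec_eq_iff forall_6)
    then show ?thesis using subspace_diff[OF S that] by simp
  qed
  have first: "emb0 g 0 \<in> ?S" if "emb0 0 (LX w1 w2 g) \<in> ?S" for g
    using add[OF e_in[of 0 "- g"] that] by (simp add: LX_uminus LX_0)
  show ?thesis
  proof (cases "m = 0")
    case False
    show ?thesis
    proof (induction a arbitrary: b c)
      case 0
      \<comment> \<open>The pair solves D g = h together with the equation for h; each application
        of the inverse of D divides by m.\<close>
      have 2: "emb0 0 (cconst c * cmon 0 b w) \<in> ?S" for c
        using e_in[of "cconst (c / m^2) * cmon 0 b w" "cconst (c / m) * cmon 0 b w"] False
        unfolding LX_kx_mult LX_cmon_0[OF w]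
        by (simp add: power2_eq_square flip: mult.assoc kx_mult)
      have "LX w1 w2 (cconst c * cmon 0 b w) = cconst (c * m) * cmon 0 b w"
        unfolding LX_kx_mult LX_cmon_0[OF w] kx_mult by (simp add: mult.assoc)
      with first[of "cconst c * cmon 0 b w"] 2 show ?case by simp
    next
      case (Suc a)
      let ?m' = "cmon a (Suc b) w"
      have 2: "emb0 0 (cconst c * cmon (Suc a) b w) \<in> ?S" for c
      proof -
        let ?g = "cconst (c / m^2) * cmon (Suc a) b w" and ?h = "cconst (c / m) * cmon (Suc a) b w"
        have g: "LX w1 w2 ?g - ?h = cconst (c / m^2 * of_nat (Suc a)) * ?m'"
          using False unfolding LX_kx_mult LX_cmon_Suc[OF w] distrib_left
          by (simp add: power2_eq_square del: of_nat_Suc flip: mult.assoc kx_mult)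
        have h: "LX w1 w2 ?h = cconst c * cmon (Suc a) b w + cconst (c / m * of_nat (Suc a)) * ?m'"
          using False unfolding LX_kx_mult LX_cmon_Suc[OF w] distrib_left
          by (simp add: del: of_nat_Suc flip: mult.assoc kx_mult)
        from diff[OF diff[OF e_in[of ?g ?h, unfolded g h] conjunct1[OF Suc, of "c / m^2 * of_nat (Suc a)" "Suc b"]]
            conjunct2[OF Suc, of "c / m * of_nat (Suc a)" "Suc b"]]
        show ?thesis by (simp del: of_nat_Suc)
      qed
      have "LX w1 w2 (cconst c * cmon (Suc a) b w) = cconst (c * m) * cmon (Suc a) b w + cconst (c * of_nat (Suc a)) * ?m'"
        unfolding LX_kx_mult LX_cmon_Suc[OF w] kx_mult by (simp add: algebra_simps del: of_nat_Suc)
      with first[of "cconst c * cmon (Suc a) b w"] add[OF 2 conjunct2[OF Suc]] 2 show ?case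
        by simp
    qed
  next
    case True
    have second: "emb0 0 (cconst c * cmon a b w) \<in> ?S" for a b c
    proof -
      consider "b = 0" | "b = 1" | b' where "b = Suc (Suc b')"
        by (metis One_nat_def not0_implies_Suc)
      then show ?thesis
      proof cases
        case 1
        then show ?thesis using res True normal_solvable by blast
      next
        case 2
        \<comment> \<open>Chosen so that (a + 1) d + d = c: the first summand comes from
          differentiating x1^(a+1), the second from the kept field, whose first entry
          cancels.\<close>
        define d where "d = c / of_nat (a + 2)"
        have "LX w1 w2 (cconst d * cmon (Suc a) 0 w) = cconst (d * of_nat (Suc a)) * cmon a 1 w"
          unfolding LX_kx_mult LX_cmon_Suc[OF w] True kx_mult by (simp add: mult.assoc del: of_nat_Suc)
        then have "emb0 (- (cconst d * cmon (Suc a) 0 w)) (cconst (d * of_nat (Suc a)) * cmon a 1 w) \<in> ?S"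
          using e_in[of 0 "cconst d * cmon (Suc a) 0 w"] by (simp add: LX_0)
        from add[OF this normal_solvable[OF res'[OF True, of d a]]]
        have "emb0 0 (cconst (d * of_nat (Suc a) + d) * cmon a 1 w) \<in> ?S"
          by (simp add: kx_add distrib_right del: of_nat_Suc)
        moreover have "d * of_nat (Suc a) + d = d * of_nat (a + 2)"
          by (simp add: algebra_simps)
        ultimately show ?thesis
          using 2 by (simp add: d_def del: of_nat_add of_nat_Suc)
      next
        case 3
        \<comment> \<open>One integration in x1 gives h, a second one gives g with D g = h, so the
          first entry vanishes.\<close>
        define d where "d = c / of_nat (Suc a)"
        have h: "LX w1 w2 (cconst d * cmon (Suc a) (Suc b') w) = cconst c * cmon a b w"
          unfolding LX_kx_mult LX_cmon_Suc[OF w] True 3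
          by (simp add: d_def del: of_nat_Suc flip: mult.assoc kx_mult)
        have g: "LX w1 w2 (cconst (d / of_nat (Suc (Suc a))) * cmon (Suc (Suc a)) b' w) = cconst d * cmon (Suc a) (Suc b') w"
          unfolding LX_kx_mult LX_cmon_Suc[OF w] True 3
          by (simp del: of_nat_Suc flip: mult.assoc kx_mult)
        show ?thesis
          using e_in[of "cconst (d / of_nat (Suc (Suc a))) * cmon (Suc (Suc a)) b' w" "cconst d * cmon (Suc a) (Suc b') w"]
          unfolding g h by simp
      qed
    qed
    have "emb0 0 (LX w1 w2 (cconst c * cmon a b w)) \<in> ?S"
    proof (cases a)
      case 0
      have "LX w1 w2 (cconst c * cmon a b w) = cconst 0 * cmon a b w"
        unfolding LX_kx_mult 0 LX_cmon_0[OF w] True by simp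
      then show ?thesis using second by metis
    next
      case (Suc a')
      have "LX w1 w2 (cconst c * cmon a b w) = cconst (c * of_nat a) * cmon a' (Suc b) w"
        unfolding LX_kx_mult Suc LX_cmon_Suc[OF w] True kx_mult by (simp add: mult.assoc del: of_nat_Suc)
      then show ?thesis using second by metis
    qed
    with first second show ?thesis by blast
  qed
qed

section \<open>Resonant monomials\<close>

definition "N1 = (mfps_X 3 * mfps_X 3 + mfps_X 4 * mfps_X 4 :: 6 mfps)"
definition "N2 = (mfps_X 5 * mfps_X 5 + mfps_X 6 * mfps_X 6 :: 6 mfps)"
definition WW :: "nat \<Rightarrow> nat \<Rightarrow> 6 mfps cx" where "WW n1 n2 = Z1 ^ n2 * cx_cnj Z2 ^ n1"
definition rho_s :: "nat \<Rightarrow> nat \<Rightarrow> 6 mfps" where "rho_s n1 n2 = cre (WW n1 n2)"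
definition iota_s :: "nat \<Rightarrow> nat \<Rightarrow> 6 mfps" where "iota_s n1 n2 = cim (WW n1 n2)"

lemma rx_mult: "creal (a * b) = creal a * creal b"
  by (rule cx_eqI) simp_all

lemma rx_power: "creal (a ^ n) = creal a ^ n"
  by (induction n) (simp_all add: rx_mult one_cx_def)

lemma Z_cnj_Z: "Z1 * cx_cnj Z1 = creal N1" "Z2 * cx_cnj Z2 = creal N2"
  by (rule cx_eqI; simp add: Z1_def Z2_def N1_def N2_def)+

text \<open>The squared modulus of \<open>WW\<close>, computed from its factors and from its real
  and imaginary parts.\<close>

lemma rho_iota_squares: "iota_s n1 n2 * iota_s n1 n2 = N1 ^ n2 * N2 ^ n1 - rho_s n1 n2 * rho_s n1 n2"
proof -
  have "WW n1 n2 * cx_cnj (WW n1 n2) = (Z1 * cx_cnj Z1) ^ n2 * (Z2 * cx_cnj Z2) ^ n1"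
    by (simp add: WW_def cx_cnj_mult cx_cnj_power power_mult_distrib mult_ac)
  also have "\<dots> = creal (N1 ^ n2 * N2 ^ n1)"
    by (simp add: Z_cnj_Z rx_mult rx_power)
  finally have "cre (WW n1 n2 * cx_cnj (WW n1 n2)) = N1 ^ n2 * N2 ^ n1"
    by simp
  then show ?thesis
    by (simp add: rho_s_def iota_s_def algebra_simps)
qed

definition inv_monom :: "nat \<Rightarrow> nat \<Rightarrow> nat \<Rightarrow> nat \<Rightarrow> nat \<Rightarrow> nat \<Rightarrow> nat \<Rightarrow> 6 mfps" where
  "inv_monom n1 n2 a b c d e = mfps_X 1 ^ a * N1 ^ b * N2 ^ c * rho_s n1 n2 ^ d * iota_s n1 n2 ^ e"

definition Rspan :: "nat \<Rightarrow> nat \<Rightarrow> 6 mfps set" where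
  "Rspan n1 n2 = span {inv_monom n1 n2 a b c d e | a b c d e. e \<le> 1}"

lemma subspace_Rspan: "subspace (Rspan n1 n2)"
  by (simp add: Rspan_def)

text \<open>Replacing the square of \<open>iota_s\<close> lowers e by two at the price of higher
  powers of the other invariants, so exponents e \<le> 1 already span a ring.\<close>

lemma Pm_Rspan: "inv_monom n1 n2 a b c d e \<in> Rspan n1 n2"
proof (induction e arbitrary: a b c d rule: less_induct)
  case (less e)
  show ?case
  proof (cases "e \<le> 1")
    case True
    then show ?thesis unfolding Rspan_def by (intro span_base) blast
  next
    case False
    then obtain e' where e: "e = e' + 2"
      by (metis add.commute le_add_diff_inverse not_less_eq_eq one_add_one plus_1_eq_Suc)
    have "inv_monom n1 n2 a b c d e = inv_monom n1 n2 a b c d e' * (iota_s n1 n2 * iota_s n1 n2)"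
      by (simp add: inv_monom_def e power2_eq_square power_add algebra_simps)
    also have "\<dots> = inv_monom n1 n2 a (b + n2) (c + n1) d e' - inv_monom n1 n2 a b c (d + 2) e'"
      unfolding rho_iota_squares by (simp add: inv_monom_def power2_eq_square power_add algebra_simps)
    finally show ?thesis
      using less[of e'] e by (simp add: subspace_diff[OF subspace_Rspan])
  qed
qed

lemma Pm_mult: "inv_monom n1 n2 a b c d e * inv_monom n1 n2 a' b' c' d' e' = inv_monom n1 n2 (a + a') (b + b') (c + c') (d + d') (e + e')"
  by (simp add: inv_monom_def power_add algebra_simps)

lemma Rspan_mult:
  assumes "s \<in> Rspan n1 n2" "t \<in> Rspan n1 n2"
  shows "s * t \<in> Rspan n1 n2"
  using assms(1) unfolding Rspan_def[of n1 n2]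
proof (induction rule: span_induct)
  case base
  show ?case
    by (rule subspaceI) (use subspace_Rspan[unfolded Rspan_def] in
        \<open>auto simp: distrib_right intro: subspace_add subspace_scale subspace_0\<close>)
next
  case (step s)
  then obtain a b c d e where s: "s = inv_monom n1 n2 a b c d e" by blast
  show ?case
    using assms(2) unfolding Rspan_def[of n1 n2]
  proof (induction rule: span_induct)
    case base
    show ?case
      by (rule subspaceI) (use subspace_Rspan[unfolded Rspan_def] in
          \<open>auto simp: distrib_left intro: subspace_add subspace_scale subspace_0\<close>)
  next
    case (step t)
    then obtain a' b' c' d' e' where "t = inv_monom n1 n2 a' b' c' d' e'" by blast
    then show ?case
      unfolding s using Pm_Rspan[unfolded Rspan_def] by (simp add: Pm_mult del: One_nat_def)
  qed
qed

definition Rcx :: "nat \<Rightarrow> nat \<Rightarrow> 6 mfps cx set" where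
  "Rcx n1 n2 = {g. cre g \<in> Rspan n1 n2 \<and> cim g \<in> Rspan n1 n2}"

lemma Rcx_mult: "g \<in> Rcx n1 n2 \<Longrightarrow> h \<in> Rcx n1 n2 \<Longrightarrow> g * h \<in> Rcx n1 n2"
  unfolding Rcx_def using subspace_Rspan
  by (auto intro!: subspace_add subspace_diff Rspan_mult)

lemma Rspan_of_real: "of_real c \<in> Rspan n1 n2"
  using subspace_scale[OF subspace_Rspan Pm_Rspan[of n1 n2 0 0 0 0 0], of c]
  by (simp add: inv_monom_def of_real_def)

lemma Rcx_kx: "cconst c \<in> Rcx n1 n2"
  by (simp add: Rcx_def Rspan_of_real)

lemma Rcx_power: "g \<in> Rcx n1 n2 \<Longrightarrow> g ^ n \<in> Rcx n1 n2"
  using Rcx_kx[of 1] by (induction n) (auto intro: Rcx_mult)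

lemma Rcx_cnj: "g \<in> Rcx n1 n2 \<Longrightarrow> cx_cnj g \<in> Rcx n1 n2"
  using subspace_neg[OF subspace_Rspan] by (auto simp: Rcx_def)

lemma Rcx_gens: "X1 \<in> Rcx n1 n2" "creal N1 \<in> Rcx n1 n2" "creal N2 \<in> Rcx n1 n2" "WW n1 n2 \<in> Rcx n1 n2"
  using Pm_Rspan[of n1 n2 1 0 0 0 0] Pm_Rspan[of n1 n2 0 1 0 0 0] Pm_Rspan[of n1 n2 0 0 1 0 0]
    Pm_Rspan[of n1 n2 0 0 0 1 0] Pm_Rspan[of n1 n2 0 0 0 0 1] Rspan_of_real[of 0 n1 n2]
  by (simp_all add: Rcx_def inv_monom_def X1_def rho_s_def iota_s_def)

text \<open>For nonzero n2 this is the conjugate of \<open>WW\<close> with one factor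
  \<open>cx_cnj Z1\<close> removed; similarly \<open>U2\<close> is \<open>WW\<close> without one
  factor \<open>cx_cnj Z2\<close> for nonzero n1.\<close>

definition "U1 n1 n2 = cx_cnj Z1 ^ (n2 - 1) * Z2 ^ n1"
definition "U2 n1 n2 = Z1 ^ n2 * cx_cnj Z2 ^ (n1 - 1)"

lemma zmon_add: "zmon (p + p') (q + q') (r + r') (s + s') = zmon p q r s * zmon p' q' r' s'"
  by (simp add: zmon_def power_add algebra_simps)

lemma zmon_diag: "zmon q q 0 0 = creal N1 ^ q" "zmon 0 0 r r = creal N2 ^ r"
  by (simp_all add: zmon_def flip: power_mult_distrib Z_cnj_Z)

lemma zmon_WW: "zmon (n2 * j) 0 0 (n1 * j) = WW n1 n2 ^ j" "zmon 0 (n2 * j) (n1 * j) 0 = cx_cnj (WW n1 n2) ^ j"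
  by (simp_all add: zmon_def WW_def power_mult_distrib cx_cnj_mult cx_cnj_power flip: power_mult)

text \<open>Pairing each variable with its conjugate gives powers of N1 and N2; what is left over is
  a power of \<open>WW\<close>.\<close>

lemma zmon_Rcx_pos: "zmon (q + n2 * j) q r (r + n1 * j) \<in> Rcx n1 n2"
proof -
  have "zmon (q + n2 * j) q r (r + n1 * j) = zmon q q 0 0 * zmon 0 0 r r * zmon (n2 * j) 0 0 (n1 * j)"
    by (simp flip: zmon_add)
  then show ?thesis
    by (auto simp: zmon_diag zmon_WW intro: Rcx_mult Rcx_power Rcx_gens)
qed

lemma zmon_Rcx_neg: "zmon p (p + n2 * j) (s + n1 * j) s \<in> Rcx n1 n2"
proof -
  have "zmon p (p + n2 * j) (s + n1 * j) s = zmon p p 0 0 * zmon 0 0 s s * zmon 0 (n2 * j) (n1 * j) 0"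
    by (simp flip: zmon_add)
  then show ?thesis
    by (auto simp: zmon_diag zmon_WW intro: Rcx_mult Rcx_power Rcx_gens Rcx_cnj)
qed

text \<open>Coprimality enters here: the solutions form the lattice generated by (n2, -n1), the
  exponent differences of \<open>WW\<close>.\<close>

lemma coprime_lin_eq_0:
  fixes x y :: int
  assumes "coprime n1 n2" "n1 \<noteq> 0" "n2 \<noteq> 0" "int n1 * x + int n2 * y = 0"
  obtains j where "x = int n2 * j" "y = - int n1 * j"
proof -
  have "int n2 dvd int n1 * x"
    using assms(4) by (metis add_eq_0_iff dvd_minus_iff dvd_triv_left)
  moreover have "coprime (int n2) (int n1)"
    using assms(1) by (simp add: coprime_commute)
  ultimately obtain j where j: "x = int n2 * j"
    by (metis coprime_dvd_mult_right_iff dvdE)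
  have "int n2 * (y + int n1 * j) = 0"
    using assms(4) j by (simp add: algebra_simps)
  then have "y = - int n1 * j"
    using assms(3) by simp
  with j that show thesis by blast
qed

section \<open>Classification of resonant exponents\<close>

locale resonance =
  fixes n1 n2 :: nat and w1 w2 :: real
  assumes n1: "n1 \<noteq> 0" and n2: "n2 \<noteq> 0" and cop: "coprime n1 n2"
    and w1: "w1 \<noteq> 0" and w2: "w2 \<noteq> 0" and res: "real n1 * w2 - real n2 * w1 = 0"
begin

text \<open>Multiplication by n1 clears the ratio w2 / w1 = n2 / n1 and turns a condition on real
  frequencies into one on integers.\<close>

lemma freq_eq:
  "real n1 * (freq w1 w2 p q r s) = w1 * real_of_int (int n1 * (int p - int q) + int n2 * (int r - int s))"
proof -
  have "real n1 * w2 = real n2 * w1" using res by simp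
  then have "real n1 * (w2 * (real r - real s)) = w1 * (real n2 * (real r - real s))"
    by (metis mult.assoc mult.commute)
  then show ?thesis by (simp add: freq_def algebra_simps)
qed

lemma freq_shift:
  shows "freq w1 w2 p q r s = w1 \<Longrightarrow> int n1 * (int p - int q - 1) + int n2 * (int r - int s) = 0"
    and "freq w1 w2 p q r s = w2 \<Longrightarrow> int n1 * (int p - int q) + int n2 * (int r - int s - 1) = 0"
    and "freq w1 w2 p q r s = 0 \<Longrightarrow> int n1 * (int p - int q) + int n2 * (int r - int s) = 0"
proof -
  assume "freq w1 w2 p q r s = w1"
  then have "w1 * real_of_int (int n1) = w1 * real_of_int (int n1 * (int p - int q) + int n2 * (int r - int s))"
    using freq_eq[of p q r s] by (simp add: mult.commute)
  then have "int n1 = int n1 * (int p - int q) + int n2 * (int r - int s)"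
    using w1 by (simp only: mult_cancel_left of_int_eq_iff) simp
  then show "int n1 * (int p - int q - 1) + int n2 * (int r - int s) = 0"
    by (simp add: algebra_simps)
next
  assume "freq w1 w2 p q r s = w2"
  then have "w1 * real_of_int (int n2) = w1 * real_of_int (int n1 * (int p - int q) + int n2 * (int r - int s))"
    using freq_eq[of p q r s] res by (simp add: mult.commute[of w1]) linarith
  then have "int n2 = int n1 * (int p - int q) + int n2 * (int r - int s)"
    using w1 by (simp only: mult_cancel_left of_int_eq_iff) simp
  then show "int n1 * (int p - int q) + int n2 * (int r - int s - 1) = 0"
    by (simp add: algebra_simps)
next
  assume "freq w1 w2 p q r s = 0"
  then have "w1 * real_of_int 0 = w1 * real_of_int (int n1 * (int p - int q) + int n2 * (int r - int s))"
    using freq_eq[of p q r s] by simp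
  then show "int n1 * (int p - int q) + int n2 * (int r - int s) = 0"
    using w1 by (simp only: mult_cancel_left of_int_eq_iff) simp
qed

lemma zmon_resonant_0:
  assumes "freq w1 w2 p q r s = 0"
  shows "zmon p q r s \<in> Rcx n1 n2"
proof -
  obtain j where j: "int p - int q = int n2 * j" "int r - int s = - int n1 * j"
    using coprime_lin_eq_0[OF cop n1 n2 freq_shift(3)[OF assms]] .
  show ?thesis
  proof (cases "j \<ge> 0")
    case True
    then obtain k where "j = int k" using nonneg_int_cases by blast
    with j have "int p = int (q + n2 * k)" "int s = int (r + n1 * k)" by auto
    then show ?thesis using zmon_Rcx_pos by (simp only: of_nat_eq_iff)
  next
    case False
    then obtain k where "j = - int k" by (metis linear nonpos_int_cases)
    with j have "int q = int (p + n2 * k)" "int r = int (s + n1 * k)" by auto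
    then show ?thesis using zmon_Rcx_neg by (simp only: of_nat_eq_iff)
  qed
qed

text \<open>For j \<ge> 0 a factor \<open>Z1\<close> splits off and leaves an invariant. For
  negative j there may be no \<open>Z1\<close> to split off, and \<open>U1\<close> takes its
  place.\<close>

lemma zmon_resonant_1:
  assumes "freq w1 w2 p q r s = w1"
  shows "\<exists>g\<in>Rcx n1 n2. zmon p q r s = g * Z1 \<or> zmon p q r s = g * U1 n1 n2"
proof -
  obtain j where j: "int p - int q - 1 = int n2 * j" "int r - int s = - int n1 * j"
    using coprime_lin_eq_0[OF cop n1 n2 freq_shift(1)[OF assms]] .
  show ?thesis
  proof (cases "j \<ge> 0")
    case True
    then obtain k where "j = int k" using nonneg_int_cases by blast
    with j have "int p = int (q + n2 * k + 1)" "int s = int (r + n1 * k)" by auto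
    then have p: "p = q + n2 * k + 1" and s: "s = r + n1 * k" by (simp_all only: of_nat_eq_iff)
    have "zmon p q r s = zmon (q + n2 * k) q r s * zmon 1 0 0 0"
      unfolding p by (simp flip: zmon_add)
    moreover have "zmon 1 0 0 0 = Z1" by (simp add: zmon_def)
    ultimately show ?thesis using zmon_Rcx_pos[of q n2 k r n1] s by (intro bexI[of _ "zmon (q + n2 * k) q r s"]) auto
  next
    case False
    \<comment> \<open>\<open>U1\<close> uses up one of the -j powers of the conjugate of
      \<open>WW\<close>, short of one factor \<open>cx_cnj Z1\<close>; k powers remain.\<close>
    define k where "k = nat (- j - 1)"
    have jk: "j = - int (Suc k)"
      using False by (simp add: k_def)
    obtain m where m: "n2 = Suc m" using n2 not0_implies_Suc by blast
    have "int q = int (p + m + n2 * k)" "int r = int (s + n1 * k + n1)"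
      using j unfolding jk m by (auto simp: algebra_simps)
    then have q: "q = (p + n2 * k) + m" and r: "r = (s + n1 * k) + n1" by linarith+
    have "zmon p q r s = zmon p (p + n2 * k) (s + n1 * k) s * zmon 0 m n1 0"
      unfolding q r by (simp flip: zmon_add)
    moreover have "zmon 0 m n1 0 = U1 n1 n2" by (simp add: zmon_def U1_def m)
    ultimately show ?thesis using zmon_Rcx_neg[of p n2 k s n1]
      by (intro bexI[of _ "zmon p (p + n2 * k) (s + n1 * k) s"]) auto
  qed
qed

lemma zmon_resonant_2:
  assumes "freq w1 w2 p q r s = w2"
  shows "\<exists>g\<in>Rcx n1 n2. zmon p q r s = g * Z2 \<or> zmon p q r s = g * U2 n1 n2"
proof -
  obtain j where j: "int p - int q = int n2 * j" "int r - int s - 1 = - int n1 * j"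
    using coprime_lin_eq_0[OF cop n1 n2 freq_shift(2)[OF assms]] .
  show ?thesis
  proof (cases "j \<le> 0")
    case True
    then obtain k where "j = - int k" by (metis nonpos_int_cases)
    with j have "int q = int (p + n2 * k)" "int r = int (s + n1 * k + 1)" by auto
    then have q: "q = p + n2 * k" and r: "r = s + n1 * k + 1" by (simp_all only: of_nat_eq_iff)
    have "zmon p q r s = zmon p q (s + n1 * k) s * zmon 0 0 1 0"
      unfolding r by (simp flip: zmon_add)
    moreover have "zmon 0 0 1 0 = Z2" by (simp add: zmon_def)
    ultimately show ?thesis using zmon_Rcx_neg[of p n2 k s n1] q by (intro bexI[of _ "zmon p q (s + n1 * k) s"]) auto
  next
    case False
    define k where "k = nat (j - 1)"
    have jk: "j = int (Suc k)"
      using False by (simp add: k_def)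
    obtain m where m: "n1 = Suc m" using n1 not0_implies_Suc by blast
    have "int p = int (q + n2 * k + n2)" "int s = int (r + n1 * k + m)"
      using j unfolding jk m by (auto simp: algebra_simps)
    then have p: "p = (q + n2 * k) + n2" and s: "s = (r + n1 * k) + m" by linarith+
    have "zmon p q r s = zmon (q + n2 * k) q r (r + n1 * k) * zmon n2 0 0 m"
      unfolding p s by (simp flip: zmon_add)
    moreover have "zmon n2 0 0 m = U2 n1 n2" by (simp add: zmon_def U2_def m)
    ultimately show ?thesis using zmon_Rcx_pos[of q n2 k r n1]
      by (intro bexI[of _ "zmon (q + n2 * k) q r (r + n1 * k)"]) auto
  qed
qed

end

text \<open>Generators of the kept fields over the invariants, before parity is imposed: the radial
  field and the constant field in the first block, then \<open>Z\<close> and \<open>U\<close> in the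
  other two. Their multiples by i are listed separately because the coefficients are real.\<close>

definition base_field :: "nat \<Rightarrow> nat \<Rightarrow> nat \<Rightarrow> 6 mfps^6" where
  "base_field n1 n2 i = [emb0 X1 X2, emb0 0 1,
     emb1 (cconst \<i> * Z1), emb1 (cconst \<i> * U1 n1 n2), emb1 Z1, emb1 (U1 n1 n2),
     emb2 (cconst \<i> * Z2), emb2 (cconst \<i> * U2 n1 n2), emb2 Z2, emb2 (U2 n1 n2)] ! i"

lemma Vf_simps:
  "base_field n1 n2 0 = emb0 X1 X2" "base_field n1 n2 1 = emb0 0 1" "base_field n1 n2 (Suc 0) = emb0 0 1"
  "base_field n1 n2 2 = emb1 (cconst \<i> * Z1)" "base_field n1 n2 3 = emb1 (cconst \<i> * U1 n1 n2)"
  "base_field n1 n2 4 = emb1 Z1" "base_field n1 n2 5 = emb1 (U1 n1 n2)"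
  "base_field n1 n2 6 = emb2 (cconst \<i> * Z2)" "base_field n1 n2 7 = emb2 (cconst \<i> * U2 n1 n2)"
  "base_field n1 n2 8 = emb2 Z2" "base_field n1 n2 9 = emb2 (U2 n1 n2)"
  by (simp_all add: base_field_def numeral_eq_Suc)

definition Nspan :: "nat \<Rightarrow> nat \<Rightarrow> (6 mfps^6) set" where
  "Nspan n1 n2 = span {inv_monom n1 n2 a b c d e *s base_field n1 n2 i | a b c d e i. e \<le> 1 \<and> i \<le> 9}"

lemma subspace_Nspan: "subspace (Nspan n1 n2)"
  by (simp add: Nspan_def)

lemma scaleR_smult_vec: "(c *\<^sub>R s) *s v = c *\<^sub>R (s *s (v :: 'n::finite mfps^'m))"
  by (simp add: vec_eq_iff)

lemma Rspan_smult_Nspan: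
  assumes "s \<in> Rspan n1 n2" "i \<le> 9"
  shows "s *s base_field n1 n2 i \<in> Nspan n1 n2"
  using assms(1) unfolding Rspan_def
proof (induction rule: span_induct)
  case base
  show ?case
    by (rule subspaceI) (use subspace_Nspan in
      \<open>auto simp: vector_sadd_rdistrib scaleR_smult_vec intro: subspace_add subspace_scale subspace_0\<close>)
next
  case (step s)
  then show ?case unfolding Nspan_def using assms(2) by (intro span_base) blast
qed

lemma emb_mult:
  "emb1 (g * u) = cre g *s emb1 u + cim g *s emb1 (cconst \<i> * u)"
  "emb2 (g * u) = cre g *s emb2 u + cim g *s emb2 (cconst \<i> * u)"
  by (simp_all add: vec_eq_iff forall_6 emb1_def emb2_def algebra_simps)

lemma emb_mult_Nspan:
  assumes "g \<in> Rcx n1 n2"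
  shows "emb1 (g * Z1) \<in> Nspan n1 n2" "emb1 (g * U1 n1 n2) \<in> Nspan n1 n2"
    "emb2 (g * Z2) \<in> Nspan n1 n2" "emb2 (g * U2 n1 n2) \<in> Nspan n1 n2"
    "emb0 (g * X1) (g * X2) \<in> Nspan n1 n2" "emb0 0 g \<in> Nspan n1 n2"
proof -
  note R = assms[unfolded Rcx_def mem_Collect_eq]
  note A = Rspan_smult_Nspan[OF conjunct1[OF R]] Rspan_smult_Nspan[OF conjunct2[OF R]]
  show "emb1 (g * Z1) \<in> Nspan n1 n2" "emb1 (g * U1 n1 n2) \<in> Nspan n1 n2"
    "emb2 (g * Z2) \<in> Nspan n1 n2" "emb2 (g * U2 n1 n2) \<in> Nspan n1 n2"
    unfolding emb_mult[of g Z1] emb_mult[of g "U1 n1 n2"] emb_mult[of g Z2] emb_mult[of g "U2 n1 n2"]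
    using A(1)[of 4] A(2)[of 2] A(1)[of 5] A(2)[of 3] A(1)[of 8] A(2)[of 6] A(1)[of 9] A(2)[of 7]
    by (auto simp: Vf_simps intro: subspace_add[OF subspace_Nspan])
  have "emb0 (g * X1) (g * X2) = cre g *s emb0 X1 X2" "emb0 0 g = cre g *s emb0 0 1"
    by (simp_all add: vec_eq_iff forall_6 emb0_def X1_def X2_def)
  then show "emb0 (g * X1) (g * X2) \<in> Nspan n1 n2" "emb0 0 g \<in> Nspan n1 n2"
    using A(1)[of 0] A(1)[of 1] by (simp_all add: Vf_simps)
qed

text \<open>The complex polynomials written in x1, x2, z and conjugates of z, where the homological
  operator is diagonal up to its nilpotent part. Building them one term at a time gives the
  induction by which solvability spreads.\<close>

inductive_set Cpoly :: "6 mfps cx set" where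
  zero: "0 \<in> Cpoly"
| step: "g \<in> Cpoly \<Longrightarrow> cconst c * cmon a b (zmon p q r s) + g \<in> Cpoly"

lemma Cpoly_add: "g \<in> Cpoly \<Longrightarrow> h \<in> Cpoly \<Longrightarrow> g + h \<in> Cpoly"
  by (induction rule: Cpoly.induct) (auto intro: Cpoly.intros simp: add.assoc)

lemma Cpoly_base: "cconst c * cmon a b (zmon p q r s) \<in> Cpoly"
  using Cpoly.step[OF Cpoly.zero, of c a b p q r s] by simp

lemma cmon_zmon_mult:
  "cmon a b (zmon p q r s) * cmon a' b' (zmon p' q' r' s')
     = cmon (a + a') (b + b') (zmon (p + p') (q + q') (r + r') (s + s'))"
  by (simp add: cmon_def zmon_add power_add algebra_simps)

lemma Cpoly_mult: "g \<in> Cpoly \<Longrightarrow> h \<in> Cpoly \<Longrightarrow> g * h \<in> Cpoly"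
proof (induction rule: Cpoly.induct)
  case (step g c a b p q r s)
  have "cconst c * cmon a b (zmon p q r s) * h \<in> Cpoly" using step.prems
  proof (induction rule: Cpoly.induct)
    case (step h c' a' b' p' q' r' s')
    have "cconst c * cmon a b (zmon p q r s) * (cconst c' * cmon a' b' (zmon p' q' r' s'))
        = cconst (c * c') * (cmon a b (zmon p q r s) * cmon a' b' (zmon p' q' r' s'))"
      by (simp add: kx_mult algebra_simps)
    then show ?case
      unfolding distrib_left using step.IH by (simp add: cmon_zmon_mult Cpoly.step)
  qed (simp add: Cpoly.zero)
  then show ?case
    using step by (simp add: distrib_right Cpoly_add)
qed (simp add: Cpoly.zero)

lemma kx_Cpoly: "cconst c \<in> Cpoly"
  using Cpoly_base[of c 0 0 0 0 0 0] by (simp add: cmon_def zmon_def)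

lemma rx_XX_Cpoly: "creal (mfps_X i) \<in> Cpoly"
proof -
  have 1: "creal (mfps_X 1) = cconst 1 * cmon 1 0 (zmon 0 0 0 0)" "creal (mfps_X 2) = cconst 1 * cmon 0 1 (zmon 0 0 0 0)"
    by (simp_all add: cmon_def zmon_def X1_def X2_def)
  have 2: "creal (mfps_X 3) = cconst (1/2) * cmon 0 0 (zmon 1 0 0 0) + cconst (1/2) * cmon 0 0 (zmon 0 1 0 0)"
      "creal (mfps_X 4) = cconst (- \<i>/2) * cmon 0 0 (zmon 1 0 0 0) + cconst (\<i>/2) * cmon 0 0 (zmon 0 1 0 0)"
      "creal (mfps_X 5) = cconst (1/2) * cmon 0 0 (zmon 0 0 1 0) + cconst (1/2) * cmon 0 0 (zmon 0 0 0 1)"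
      "creal (mfps_X 6) = cconst (- \<i>/2) * cmon 0 0 (zmon 0 0 1 0) + cconst (\<i>/2) * cmon 0 0 (zmon 0 0 0 1)"
    by (rule cx_eqI; simp add: cmon_def zmon_def Z1_def Z2_def mfps_eqI nth_scaleR_mfps scaleR_conv_of_real
        flip: distrib_right of_real_add scaleR_conv_of_real scaleR_add_left)+
  show ?thesis
    using exhaust_6[of i] by (elim disjE; simp only: 1 2) (intro Cpoly_add Cpoly_base)+
qed

text \<open>Real coordinates are complex combinations of z and its conjugate, so every real monomial
  decomposes into eigenvectors.\<close>

lemma rx_mono_Cpoly: "creal (mfps_monom \<alpha>) \<in> Cpoly"
proof (induction \<alpha> rule: mdeg_Suc_induct)
  case zero
  show ?case using kx_Cpoly[of 1] by (simp add: one_cx_def del: zero_fun_apply)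
next
  case (add i \<beta>)
  then show ?case
    using Cpoly_mult[OF rx_XX_Cpoly add] by (simp add: mono_mult flip: rx_mult del: plus_fun_apply)
qed

section \<open>Solving the homological equation\<close>

context resonance
begin

text \<open>Resonance means frequency w1 in the \<open>emb1\<close> block, w2 in the
  \<open>emb2\<close> block and 0 in the \<open>emb0\<close> block; the three classifications of
  resonant monomials supply the kept fields.\<close>

lemma Cpoly_solvable:
  assumes "g \<in> Cpoly"
  shows "emb1 g \<in> solvable w1 w2 (Nspan n1 n2)" "emb2 g \<in> solvable w1 w2 (Nspan n1 n2)"
    "emb0 g 0 \<in> solvable w1 w2 (Nspan n1 n2)" "emb0 0 g \<in> solvable w1 w2 (Nspan n1 n2)"
proof -
  note S = subspace_solvable[OF subspace_Nspan, of w1 w2 n1 n2]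
  have e0: "emb1 0 = 0" "emb2 0 = 0" "emb0 0 0 = 0"
    by (simp_all add: emb0_def emb1_def emb2_def vec_eq_iff forall_6)
  have kR: "cconst c * cmon a 0 w \<in> Rcx n1 n2" if "w \<in> Rcx n1 n2" for c a w
    unfolding cmon_def using that by (auto intro: Rcx_mult Rcx_kx Rcx_power Rcx_gens)
  have fr: "freq w1 w2 p q r s = l" if "- \<i> * complex_of_real (freq w1 w2 p q r s) + \<i> * complex_of_real l = 0" for p q r s l
    using that by (simp add: complex_eq_iff)
  have 1: "emb1 (cconst c * cmon a b (zmon p q r s)) \<in> solvable w1 w2 (Nspan n1 n2)" for c a b p q r s
  proof (rule emb_cmon_solvable[where l = w1 and e = emb1 and m = "- \<i> * complex_of_real (freq w1 w2 p q r s)" and w = "zmon p q r s",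
        OF subspace_Nspan LX_zmon emb_add(2) hom_op_emb(2)])
    fix a c assume "- \<i> * complex_of_real (freq w1 w2 p q r s) + \<i> * complex_of_real w1 = 0"
    then obtain g where g: "g \<in> Rcx n1 n2" "zmon p q r s = g * Z1 \<or> zmon p q r s = g * U1 n1 n2"
      using zmon_resonant_1 fr by blast
    have "cconst c * cmon a 0 (zmon p q r s) = cconst c * cmon a 0 g * Z1
        \<or> cconst c * cmon a 0 (zmon p q r s) = cconst c * cmon a 0 g * U1 n1 n2"
      using g(2) by (auto simp: cmon_def mult_ac)
    then show "emb1 (cconst c * cmon a 0 (zmon p q r s)) \<in> Nspan n1 n2"
      using emb_mult_Nspan(1,2)[OF kR[OF g(1)]] by auto
  qed
  have 2: "emb2 (cconst c * cmon a b (zmon p q r s)) \<in> solvable w1 w2 (Nspan n1 n2)" for c a b p q r s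
  proof (rule emb_cmon_solvable[where l = w2 and e = emb2 and m = "- \<i> * complex_of_real (freq w1 w2 p q r s)" and w = "zmon p q r s",
        OF subspace_Nspan LX_zmon emb_add(3) hom_op_emb(3)])
    fix a c assume "- \<i> * complex_of_real (freq w1 w2 p q r s) + \<i> * complex_of_real w2 = 0"
    then obtain g where g: "g \<in> Rcx n1 n2" "zmon p q r s = g * Z2 \<or> zmon p q r s = g * U2 n1 n2"
      using zmon_resonant_2 fr by blast
    have "cconst c * cmon a 0 (zmon p q r s) = cconst c * cmon a 0 g * Z2
        \<or> cconst c * cmon a 0 (zmon p q r s) = cconst c * cmon a 0 g * U2 n1 n2"
      using g(2) by (auto simp: cmon_def mult_ac)
    then show "emb2 (cconst c * cmon a 0 (zmon p q r s)) \<in> Nspan n1 n2"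
      using emb_mult_Nspan(3,4)[OF kR[OF g(1)]] by auto
  qed
  have 3: "emb0 (cconst c * cmon a b (zmon p q r s)) 0 \<in> solvable w1 w2 (Nspan n1 n2)
      \<and> emb0 0 (cconst c * cmon a b (zmon p q r s)) \<in> solvable w1 w2 (Nspan n1 n2)" for c a b p q r s
  proof (rule emb0_cmon_solvable[where m = "- \<i> * complex_of_real (freq w1 w2 p q r s)" and w = "zmon p q r s",
        OF subspace_Nspan LX_zmon])
    fix a c assume "- \<i> * complex_of_real (freq w1 w2 p q r s) = 0"
    then have R: "zmon p q r s \<in> Rcx n1 n2"
      using zmon_resonant_0 by simp
    show "emb0 0 (cconst c * cmon a 0 (zmon p q r s)) \<in> Nspan n1 n2"
      using emb_mult_Nspan(6)[OF kR[OF R]] .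
    have "cconst c * cmon (Suc a) 0 (zmon p q r s) = cconst c * cmon a 0 (zmon p q r s) * X1"
      "cconst c * cmon a 1 (zmon p q r s) = cconst c * cmon a 0 (zmon p q r s) * X2"
      by (simp_all add: cmon_def mult_ac)
    then show "emb0 (cconst c * cmon (Suc a) 0 (zmon p q r s)) (cconst c * cmon a 1 (zmon p q r s)) \<in> Nspan n1 n2"
      using emb_mult_Nspan(5)[OF kR[OF R]] by simp
  qed
  have emb0_add': "emb0 (g + h) 0 = emb0 g 0 + emb0 h 0" "emb0 0 (g + h) = emb0 0 g + emb0 0 h" for g h
    by (simp_all flip: emb_add)
  show "emb1 g \<in> solvable w1 w2 (Nspan n1 n2)" "emb2 g \<in> solvable w1 w2 (Nspan n1 n2)"
    "emb0 g 0 \<in> solvable w1 w2 (Nspan n1 n2)" "emb0 0 g \<in> solvable w1 w2 (Nspan n1 n2)"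
    using assms
    by (induction rule: Cpoly.induct)
       (auto simp: e0 emb_add(2,3) emb0_add' intro: subspace_add[OF S] subspace_0[OF S] 1 2 3[THEN conjunct1] 3[THEN conjunct2])
qed

text \<open>Homogeneity makes h a finite combination of monomial fields. An imaginary component is
  reached through multiplication by i. Degree and symmetry of the solution are left open until
  \<open>decompose\<close>.\<close>

lemma homogeneous_solvable:
  assumes "\<And>i. homogeneous k (h $ i)"
  shows "h \<in> solvable w1 w2 (Nspan n1 n2)"
proof -
  note S = subspace_solvable[OF subspace_Nspan, of w1 w2 n1 n2]
  have ax: "axis i (mfps_monom \<alpha>) \<in> solvable w1 w2 (Nspan n1 n2)" for i \<alpha>
  proof -
    note C = rx_mono_Cpoly[of \<alpha>]
    have "axis 1 (mfps_monom \<alpha>) = emb0 (creal (mfps_monom \<alpha>)) 0" "axis 2 (mfps_monom \<alpha>) = emb0 0 (creal (mfps_monom \<alpha>))"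
      "axis 3 (mfps_monom \<alpha>) = emb1 (creal (mfps_monom \<alpha>))" "axis 4 (mfps_monom \<alpha>) = emb1 (cconst \<i> * creal (mfps_monom \<alpha>))"
      "axis 5 (mfps_monom \<alpha>) = emb2 (creal (mfps_monom \<alpha>))" "axis 6 (mfps_monom \<alpha>) = emb2 (cconst \<i> * creal (mfps_monom \<alpha>))"
      by (simp_all add: vec_eq_iff forall_6 emb0_def emb1_def emb2_def axis_def)
    then show ?thesis
      using exhaust_6[of i] Cpoly_solvable[OF C] Cpoly_solvable[OF Cpoly_mult[OF kx_Cpoly[of \<i>] C]] by auto
  qed
  have "h = (\<Sum>i\<in>UNIV. \<Sum>\<beta> | mdeg \<beta> = k. mfps_nth (h $ i) \<beta> *\<^sub>R axis i (mfps_monom \<beta>))"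
  proof (subst vec_eq_iff, rule allI)
    fix j
    have "(\<Sum>i\<in>UNIV. \<Sum>\<beta> | mdeg \<beta> = k. mfps_nth (h $ i) \<beta> *\<^sub>R axis i (mfps_monom \<beta>)) $ j
        = (\<Sum>i\<in>UNIV. if i = j then (\<Sum>\<beta> | mdeg \<beta> = k. mfps_nth (h $ i) \<beta> *\<^sub>R mfps_monom \<beta>) else 0)"
      unfolding sum_component by (rule sum.cong) (auto simp: axis_def)
    also have "\<dots> = h $ j"
      using hom_eq_sum_mono[OF assms[of j]] by simp
    finally show "h $ j = (\<Sum>i\<in>UNIV. \<Sum>\<beta> | mdeg \<beta> = k. mfps_nth (h $ i) \<beta> *\<^sub>R axis i (mfps_monom \<beta>)) $ j"
      by simp
  qed
  also have "\<dots> \<in> solvable w1 w2 (Nspan n1 n2)"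
    by (intro subspace_sum[OF S] subspace_scale[OF S] ax)
  finally show ?thesis .
qed

end

section \<open>Reversing symmetries\<close>

text \<open>For c = 1 this is equivariance under the diagonal map with entries \<epsilon>, for c =
  -1 reversibility.\<close>

definition vpar :: "('n::finite \<Rightarrow> real) \<Rightarrow> real \<Rightarrow> 'n mfps^'n \<Rightarrow> bool" where
  "vpar \<epsilon> c v \<longleftrightarrow> (\<forall>i. par \<epsilon> (c * \<epsilon> i) (v $ i))"

definition sg_phi :: "6 \<Rightarrow> real" where
  "sg_phi i = (if i = 2 \<or> i = 4 \<or> i = 6 then -1 else 1)"

text \<open>The signs of \<open>\<psi> \<circ> \<phi>\<close>, an equivariance rather than a reversing symmetry.\<close>
definition sg_chi :: "real \<Rightarrow> real \<Rightarrow> real \<Rightarrow> 6 \<Rightarrow> real" where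
  "sg_chi a0 a1 a2 i = (if i = 1 \<or> i = 2 then a0 else if i = 3 \<or> i = 4 then a1 else a2)"

lemma sg_phi_simps [simp]:
  "sg_phi 1 = 1" "sg_phi 2 = -1" "sg_phi 3 = 1" "sg_phi 4 = -1" "sg_phi 5 = 1" "sg_phi 6 = -1"
  by (simp_all add: sg_phi_def)

lemma sg_chi_simps [simp]:
  "sg_chi a0 a1 a2 1 = a0" "sg_chi a0 a1 a2 2 = a0" "sg_chi a0 a1 a2 3 = a1"
  "sg_chi a0 a1 a2 4 = a1" "sg_chi a0 a1 a2 5 = a2" "sg_chi a0 a1 a2 6 = a2"
  by (simp_all add: sg_chi_def)

definition hom_cx :: "nat \<Rightarrow> 'n::finite mfps cx \<Rightarrow> bool" where
  "hom_cx k g \<longleftrightarrow> homogeneous k (cre g) \<and> homogeneous k (cim g)"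

text \<open>Composition with phi conjugates g, as it does for polynomials in z1, z2 and their
  conjugates with real coefficients.\<close>

definition phi_cx :: "6 mfps cx \<Rightarrow> bool" where
  "phi_cx g \<longleftrightarrow> par sg_phi 1 (cre g) \<and> par sg_phi (-1) (cim g)"

definition par_cx :: "('n::finite \<Rightarrow> real) \<Rightarrow> real \<Rightarrow> 'n mfps cx \<Rightarrow> bool" where
  "par_cx \<epsilon> c g \<longleftrightarrow> par \<epsilon> c (cre g) \<and> par \<epsilon> c (cim g)"

lemma hom_cx_mult: "hom_cx k g \<Longrightarrow> hom_cx l h \<Longrightarrow> hom_cx (k + l) (g * h)"
  by (auto simp: hom_cx_def intro: hom_add hom_diff hom_mult)

lemma hom_cx_one: "hom_cx 0 1"
  by (simp add: hom_cx_def hom_one)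

lemma hom_cx_power: "hom_cx k g \<Longrightarrow> hom_cx (n * k) (g ^ n)"
  by (induction n) (auto simp: hom_cx_one intro: hom_cx_mult)

lemma phi_cx_mult: "phi_cx g \<Longrightarrow> phi_cx h \<Longrightarrow> phi_cx (g * h)"
  using par_mult[of sg_phi 1 "cre g" 1 "cre h"] par_mult[of sg_phi "-1" "cim g" "-1" "cim h"]
    par_mult[of sg_phi 1 "cre g" "-1" "cim h"] par_mult[of sg_phi "-1" "cim g" 1 "cre h"]
  by (auto simp: phi_cx_def intro: par_add par_diff)

lemma phi_cx_one: "phi_cx 1"
  by (simp add: phi_cx_def par_one)

lemma phi_cx_power: "phi_cx g \<Longrightarrow> phi_cx (g ^ n)"
  by (induction n) (auto simp: phi_cx_one intro: phi_cx_mult)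

lemma par_cx_mult: "par_cx \<epsilon> c g \<Longrightarrow> par_cx \<epsilon> d h \<Longrightarrow> par_cx \<epsilon> (c * d) (g * h)"
  by (auto simp: par_cx_def intro: par_add par_diff par_mult)

lemma par_cx_one: "par_cx \<epsilon> 1 1"
  by (simp add: par_cx_def par_one)

lemma par_cx_power: "par_cx \<epsilon> c g \<Longrightarrow> par_cx \<epsilon> (c ^ n) (g ^ n)"
  by (induction n) (auto simp: par_cx_one intro: par_cx_mult)

lemma hom_XX: "homogeneous 1 (mfps_X i)"
  by (rule hom_mono) simp

lemma par_XX': "\<epsilon> i = c \<Longrightarrow> par \<epsilon> c (mfps_X i)"
  using par_XX[of \<epsilon> i] by simp

lemma Z_grading:
  "hom_cx 1 Z1" "hom_cx 1 (cx_cnj Z1)" "hom_cx 1 Z2" "hom_cx 1 (cx_cnj Z2)"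
  "phi_cx Z1" "phi_cx (cx_cnj Z1)" "phi_cx Z2" "phi_cx (cx_cnj Z2)"
  "par_cx (sg_chi a0 a1 a2) a1 Z1" "par_cx (sg_chi a0 a1 a2) a1 (cx_cnj Z1)"
  "par_cx (sg_chi a0 a1 a2) a2 Z2" "par_cx (sg_chi a0 a1 a2) a2 (cx_cnj Z2)"
  using hom_XX[where 'a = 6]
  by (auto simp: hom_cx_def phi_cx_def par_cx_def Z1_def Z2_def intro!: hom_uminus par_uminus par_XX')

section \<open>Degrees and signs of invariants and base fields\<close>

locale reversible_resonance = resonance n1 n2 w1 w2 for n1 n2 w1 w2 +
  fixes a0 a1 a2 :: real
  assumes a0: "a0 \<in> {1, -1}" and a1: "a1 \<in> {1, -1}" and a2: "a2 \<in> {1, -1}"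
begin

abbreviation "chi \<equiv> sg_chi a0 a1 a2"
text \<open>The sign by which psi composed with phi acts on \<open>WW\<close>; together with a0 it
  determines the type.\<close>

definition "sW = a1 ^ n2 * a2 ^ n1"

lemma signs_square [simp]: "a0 * a0 = 1" "a1 * a1 = 1" "a2 * a2 = 1" "sW * sW = 1"
proof -
  show 1: "a0 * a0 = 1" "a1 * a1 = 1" "a2 * a2 = 1"
    using a0 a1 a2 by auto
  have "sW * sW = (a1 * a1) ^ n2 * (a2 * a2) ^ n1"
    unfolding sW_def power_mult_distrib by (simp only: mult_ac)
  then show "sW * sW = 1" by (simp add: 1)
qed

lemma sW_cases: "sW = 1 \<or> sW = -1"
  using signs_square(4) by (metis square_eq_1_iff)

lemma chi_square: "chi i * chi i = 1"
  by (simp add: sg_chi_def)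

lemma sg_phi_square: "sg_phi i * sg_phi i = 1"
  by (simp add: sg_phi_def)

lemma WW_grading: "hom_cx (n1 + n2) (WW n1 n2)" "phi_cx (WW n1 n2)" "par_cx chi sW (WW n1 n2)"
proof -
  have "hom_cx (n2 * 1 + n1 * 1) (WW n1 n2)"
    unfolding WW_def by (intro hom_cx_mult hom_cx_power Z_grading)
  then show "hom_cx (n1 + n2) (WW n1 n2)" by (simp add: add.commute)
  show "phi_cx (WW n1 n2)" "par_cx chi sW (WW n1 n2)"
    unfolding WW_def sW_def by (intro phi_cx_mult phi_cx_power par_cx_mult par_cx_power Z_grading)+
qed

lemma U1_grading: "hom_cx (n1 + n2 - 1) (U1 n1 n2)" "phi_cx (U1 n1 n2)" "par_cx chi (sW * a1) (U1 n1 n2)"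
proof -
  have "hom_cx ((n2 - 1) * 1 + n1 * 1) (U1 n1 n2)"
    unfolding U1_def by (intro hom_cx_mult hom_cx_power Z_grading)
  then show "hom_cx (n1 + n2 - 1) (U1 n1 n2)" using n2 by (simp add: add.commute)
  show "phi_cx (U1 n1 n2)"
    unfolding U1_def by (intro phi_cx_mult phi_cx_power Z_grading)
  have "par_cx chi (a1 ^ (n2 - 1) * a2 ^ n1) (U1 n1 n2)"
    unfolding U1_def by (intro par_cx_mult par_cx_power Z_grading)
  \<comment> \<open>\<open>U1\<close> misses one conjugate of \<open>Z1\<close> compared with the
    conjugate of \<open>WW\<close>, and dividing by a1 is multiplying by it.\<close>
  moreover have "sW * a1 = a1 ^ (n2 - 1) * a2 ^ n1 * (a1 * a1)"
    unfolding sW_def power_eq_if[of a1 n2] using n2 by (simp only: if_False mult_ac)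
  ultimately show "par_cx chi (sW * a1) (U1 n1 n2)" by simp
qed

lemma U2_grading: "hom_cx (n1 + n2 - 1) (U2 n1 n2)" "phi_cx (U2 n1 n2)" "par_cx chi (sW * a2) (U2 n1 n2)"
proof -
  have "hom_cx (n2 * 1 + (n1 - 1) * 1) (U2 n1 n2)"
    unfolding U2_def by (intro hom_cx_mult hom_cx_power Z_grading)
  then show "hom_cx (n1 + n2 - 1) (U2 n1 n2)" using n1 by (simp add: add.commute)
  show "phi_cx (U2 n1 n2)"
    unfolding U2_def by (intro phi_cx_mult phi_cx_power Z_grading)
  have "par_cx chi (a1 ^ n2 * a2 ^ (n1 - 1)) (U2 n1 n2)"
    unfolding U2_def by (intro par_cx_mult par_cx_power Z_grading)
  moreover have "sW * a2 = a1 ^ n2 * a2 ^ (n1 - 1) * (a2 * a2)"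
    unfolding sW_def power_eq_if[of a2 n1] using n1 by (simp only: if_False mult_ac)
  ultimately show "par_cx chi (sW * a2) (U2 n1 n2)" by simp
qed

lemma Pm_grading:
  "homogeneous (a + 2 * b + 2 * c + (n1 + n2) * (d + e)) (inv_monom n1 n2 a b c d e)"
  "par sg_phi ((-1) ^ e) (inv_monom n1 n2 a b c d e)"
  "par chi (a0 ^ a * sW ^ (d + e)) (inv_monom n1 n2 a b c d e)"
proof -
  have sq: "homogeneous 2 (mfps_X i * mfps_X i)" "par sg_phi 1 (mfps_X i * mfps_X i)" "par chi 1 (mfps_X i * mfps_X i)" for i :: 6
    using hom_mult[OF hom_XX[of i] hom_XX[of i]] par_mult[OF par_XX[of sg_phi i] par_XX[of sg_phi i]]
      par_mult[OF par_XX[of chi i] par_XX[of chi i]]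
    unfolding sg_phi_square chi_square by (simp_all add: numeral_2_eq_2)
  have N: "homogeneous 2 N1" "homogeneous 2 N2" "par sg_phi 1 N1" "par sg_phi 1 N2" "par chi 1 N1" "par chi 1 N2"
    unfolding N1_def N2_def by (intro hom_add par_add sq)+
  have W: "homogeneous (n1 + n2) (rho_s n1 n2)" "homogeneous (n1 + n2) (iota_s n1 n2)" "par sg_phi 1 (rho_s n1 n2)"
    "par sg_phi (-1) (iota_s n1 n2)" "par chi sW (rho_s n1 n2)" "par chi sW (iota_s n1 n2)"
    using WW_grading by (simp_all add: hom_cx_def phi_cx_def par_cx_def rho_s_def iota_s_def)
  have "homogeneous (a * 1 + b * 2 + c * 2 + d * (n1 + n2) + e * (n1 + n2)) (inv_monom n1 n2 a b c d e)"
    unfolding inv_monom_def by (intro hom_mult hom_power hom_XX N W)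
  then show "homogeneous (a + 2 * b + 2 * c + (n1 + n2) * (d + e)) (inv_monom n1 n2 a b c d e)"
    by (simp add: algebra_simps)
  have "par sg_phi (1 ^ a * 1 ^ b * 1 ^ c * 1 ^ d * (-1) ^ e) (inv_monom n1 n2 a b c d e)"
    unfolding inv_monom_def by (intro par_mult par_power par_XX' N W) simp
  then show "par sg_phi ((-1) ^ e) (inv_monom n1 n2 a b c d e)" by simp
  have "par chi (a0 ^ a * 1 ^ b * 1 ^ c * sW ^ d * sW ^ e) (inv_monom n1 n2 a b c d e)"
    unfolding inv_monom_def by (intro par_mult par_power par_XX' N W) simp
  then show "par chi (a0 ^ a * sW ^ (d + e)) (inv_monom n1 n2 a b c d e)"
    by (simp add: power_add mult.assoc)
qed

definition degV :: "nat \<Rightarrow> nat" where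
  "degV i = [1, 0, 1, n1 + n2 - 1, 1, n1 + n2 - 1, 1, n1 + n2 - 1, 1, n1 + n2 - 1] ! i"
definition phiV :: "nat \<Rightarrow> real" where
  "phiV i = [1, -1, -1, -1, 1, 1, -1, -1, 1, 1] ! i"
definition chiV :: "nat \<Rightarrow> real" where
  "chiV i = [1, a0, 1, sW, 1, sW, 1, sW, 1, sW] ! i"

lemma le_9_cases:
  "(i :: nat) \<le> 9 \<Longrightarrow> i = 0 \<or> i = 1 \<or> i = 2 \<or> i = 3 \<or> i = 4 \<or> i = 5 \<or> i = 6 \<or> i = 7 \<or> i = 8 \<or> i = 9"
  by presburger

lemma emb_grading:
  "hom_cx k g \<Longrightarrow> homogeneous k (emb1 g $ i)" "hom_cx k g \<Longrightarrow> homogeneous k (emb2 g $ i)"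
  "hom_cx k g \<Longrightarrow> homogeneous k (emb1 (cconst \<i> * g) $ i)" "hom_cx k g \<Longrightarrow> homogeneous k (emb2 (cconst \<i> * g) $ i)"
  "phi_cx g \<Longrightarrow> vpar sg_phi 1 (emb1 g)" "phi_cx g \<Longrightarrow> vpar sg_phi 1 (emb2 g)"
  "phi_cx g \<Longrightarrow> vpar sg_phi (-1) (emb1 (cconst \<i> * g))" "phi_cx g \<Longrightarrow> vpar sg_phi (-1) (emb2 (cconst \<i> * g))"
  "par_cx chi (c * a1) g \<Longrightarrow> vpar chi c (emb1 g)" "par_cx chi (c * a2) g \<Longrightarrow> vpar chi c (emb2 g)"
  "par_cx chi (c * a1) g \<Longrightarrow> vpar chi c (emb1 (cconst \<i> * g))" "par_cx chi (c * a2) g \<Longrightarrow> vpar chi c (emb2 (cconst \<i> * g))"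
  using exhaust_6[of i]
  by (auto simp: hom_cx_def phi_cx_def par_cx_def emb1_def emb2_def vpar_def forall_6 intro: hom_uminus par_uminus)

lemma Vf_grading:
  assumes "i \<le> 9"
  shows "homogeneous (degV i) (base_field n1 n2 i $ j)" "vpar sg_phi (phiV i) (base_field n1 n2 i)" "vpar chi (chiV i) (base_field n1 n2 i)"
proof -
  have 0: "homogeneous 1 (emb0 X1 X2 $ j)" "vpar sg_phi 1 (emb0 X1 X2)" "vpar chi 1 (emb0 X1 X2)"
    using exhaust_6[of j] hom_XX[where 'a = 6]
    by (auto simp: emb0_def X1_def X2_def vpar_def forall_6 intro: par_XX')
  have 1: "homogeneous 0 (emb0 0 1 $ j)" "vpar sg_phi (-1) (emb0 0 1)" "vpar chi a0 (emb0 0 1)"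
    using exhaust_6[of j]
    by (auto simp: emb0_def vpar_def forall_6 hom_one par_one)
  have Z: "par_cx chi (1 * a1) Z1" "par_cx chi (1 * a2) Z2"
    using Z_grading(9,11) by simp_all
  show "homogeneous (degV i) (base_field n1 n2 i $ j)" "vpar sg_phi (phiV i) (base_field n1 n2 i)" "vpar chi (chiV i) (base_field n1 n2 i)"
    using le_9_cases[OF assms]
    by (elim disjE; simp only: degV_def phiV_def chiV_def base_field_def;
        simp add: 0 1 emb_grading U1_grading U2_grading Z_grading Z[simplified] numeral_eq_Suc del: One_nat_def)+
qed

text \<open>\<open>Qs\<close> collects the exponents of reversing fields, \<open>Qs'\<close> those
  of coordinate changes. They differ by the sign under phi, since L anticommutes with phi.\<close>

definition Qs :: "nat \<Rightarrow> 6 \<Rightarrow> (6 \<Rightarrow> nat) set" where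
  "Qs k i = {\<alpha>. mdeg \<alpha> = k \<and> sgn_pow sg_phi \<alpha> = - sg_phi i \<and> sgn_pow chi \<alpha> = chi i}"
definition Qs' :: "nat \<Rightarrow> 6 \<Rightarrow> (6 \<Rightarrow> nat) set" where
  "Qs' k i = {\<alpha>. mdeg \<alpha> = k \<and> sgn_pow sg_phi \<alpha> = sg_phi i \<and> sgn_pow chi \<alpha> = chi i}"

lemma supported_Qs_iff:
  "supported (Qs k i) s \<longleftrightarrow> homogeneous k s \<and> par sg_phi (- sg_phi i) s \<and> par chi (chi i) s"
  "supported (Qs' k i) s \<longleftrightarrow> homogeneous k s \<and> par sg_phi (sg_phi i) s \<and> par chi (chi i) s"
  by (auto simp: supported_def homogeneous_def par_def Qs_def Qs'_def)

lemma L_matrix_signs: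
  assumes "L_matrix w1 w2 $ j $ l \<noteq> 0"
  shows "sg_phi l = - sg_phi j" "chi l = chi j"
  using assms exhaust_6[of j] exhaust_6[of l] by (auto simp: L_matrix_def)

lemma vfilter_hom_op_L:
  "vfilter (Qs k) (hom_op (L_matrix w1 w2) \<xi>) = hom_op (L_matrix w1 w2) (vfilter (Qs' k) \<xi>)"
proof (rule vfilter_hom_op)
  fix i j l \<beta>
  assume "L_matrix w1 w2 $ j $ l \<noteq> 0"
  from L_matrix_signs[OF this] show "unit_idx j + \<beta> \<in> Qs' k i \<longleftrightarrow> unit_idx l + \<beta> \<in> Qs k i"
    by (auto simp: Qs_def Qs'_def sgn_pow_add simp del: plus_fun_apply)
next
  fix i j
  assume "L_matrix w1 w2 $ i $ j \<noteq> 0"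
  from L_matrix_signs[OF this] show "Qs' k j = Qs k i"
    by (auto simp: Qs_def Qs'_def)
qed

text \<open>Each product has one degree and one sign under either symmetry, so the projection keeps
  it whole or kills it; resonance itself needs no further inspection.\<close>

lemma vfilter_term:
  assumes "i \<le> 9"
  shows "vfilter (Qs k) (inv_monom n1 n2 a b c d e *s base_field n1 n2 i)
     = (if a + 2 * b + 2 * c + (n1 + n2) * (d + e) + degV i = k \<and> (-1) ^ e * phiV i = -1
          \<and> a0 ^ a * sW ^ (d + e) * chiV i = 1 then inv_monom n1 n2 a b c d e *s base_field n1 n2 i else 0)"
proof -
  let ?k = "a + 2 * b + 2 * c + (n1 + n2) * (d + e) + degV i"
  let ?p = "(-1) ^ e * phiV i" and ?q = "a0 ^ a * sW ^ (d + e) * chiV i"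
  let ?v = "inv_monom n1 n2 a b c d e *s base_field n1 n2 i"
  have h: "homogeneous ?k (?v $ j)" for j
    unfolding vector_smult_component by (rule hom_mult[OF Pm_grading(1) Vf_grading(1)[OF assms]])
  have p: "par sg_phi (?p * sg_phi j) (?v $ j)" for j
    using Vf_grading(2)[OF assms]
    unfolding vpar_def vector_smult_component by (metis par_mult Pm_grading(2) mult.assoc)
  have q: "par chi (?q * chi j) (?v $ j)" for j
    using Vf_grading(3)[OF assms]
    unfolding vpar_def vector_smult_component by (metis par_mult Pm_grading(3) mult.assoc)
  show ?thesis
  proof (cases "?k = k \<and> ?p = -1 \<and> ?q = 1")
    case True
    have "vfilter (Qs k) ?v = ?v"
      using h p q True by (intro vfilter_id) (auto simp: supported_Qs_iff)
    with True show ?thesis by simp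
  next
    case False
    have "vfilter (Qs k) ?v = 0"
    proof (rule vfilter_eq_0)
      fix j
      have nz: "sg_phi j \<noteq> 0" "chi j \<noteq> 0"
        using sg_phi_square[of j] chi_square[of j] by (metis mult_zero_left zero_neq_one)+
      show "supported (- Qs k j) (?v $ j)"
        unfolding supported_def
      proof (intro allI impI ComplI)
        fix \<alpha> assume "mfps_nth (?v $ j) \<alpha> \<noteq> 0" and Q: "\<alpha> \<in> Qs k j"
        then have "mdeg \<alpha> = ?k" "sgn_pow sg_phi \<alpha> = ?p * sg_phi j" "sgn_pow chi \<alpha> = ?q * chi j"
          using homD[OF h] parD[OF p] parD[OF q] by metis+
        with Q have "?k = k" "?p * sg_phi j = - 1 * sg_phi j" "?q * chi j = 1 * chi j"
          by (auto simp: Qs_def)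
        then show False using False nz by (simp only: mult_cancel_right) blast
      qed
    qed
    then show ?thesis unfolding if_not_P[OF False] .
  qed
qed

end

text \<open>The module generated by the first I fields \<open>G i\<close> over the formal series in
  the invariants X.\<close>

definition Mset :: "('m::finite \<Rightarrow> 6 mfps) \<Rightarrow> (nat \<Rightarrow> 6 mfps^6) \<Rightarrow> nat \<Rightarrow> (6 mfps^6) set" where
  "Mset X G I = {\<Sum>i<I. mfps_subst (f i) X *s G i | f. True}"

lemma subspace_Mset: "subspace (Mset X G I)"
proof (rule subspaceI)
  have "0 = (\<Sum>i<I. mfps_subst (0 :: 'a mfps) X *s G i)"
    by simp
  then show "0 \<in> Mset X G I"
    unfolding Mset_def by fast
next
  fix u v assume "u \<in> Mset X G I" "v \<in> Mset X G I"
  then obtain f g where "u = (\<Sum>i<I. mfps_subst (f i) X *s G i)" "v = (\<Sum>i<I. mfps_subst (g i) X *s G i)"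
    unfolding Mset_def by blast
  then have "u + v = (\<Sum>i<I. mfps_subst (f i + g i) X *s G i)"
    by (simp add: subst_add vector_sadd_rdistrib sum.distrib)
  then show "u + v \<in> Mset X G I"
    unfolding Mset_def by (auto intro!: exI[of _ "\<lambda>i. f i + g i"])
next
  fix c u assume "u \<in> Mset X G I"
  then obtain f where "u = (\<Sum>i<I. mfps_subst (f i) X *s G i)"
    unfolding Mset_def by blast
  then have "c *\<^sub>R u = (\<Sum>i<I. mfps_subst (c *\<^sub>R f i) X *s G i)"
    by (simp add: subst_scaleR scaleR_smult_vec scaleR_sum_right)
  then show "c *\<^sub>R u \<in> Mset X G I"
    unfolding Mset_def by (auto intro!: exI[of _ "\<lambda>i. c *\<^sub>R f i"])
qed

lemma pw_Mset:
  assumes "\<And>j. ord_ge 1 (X j)" "i < I"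
  shows "pw X \<gamma> *s G i \<in> Mset X G I"
proof -
  have "(\<Sum>l<I. mfps_subst (if l = i then mfps_monom \<gamma> else 0) X *s G l) = (\<Sum>l<I. if l = i then pw X \<gamma> *s G l else 0)"
    by (rule sum.cong) (simp_all add: subst_mono[OF assms(1)])
  then have "pw X \<gamma> *s G i = (\<Sum>l<I. mfps_subst (if l = i then mfps_monom \<gamma> else 0) X *s G l)"
    using assms(2) by simp
  then show ?thesis
    unfolding Mset_def by (auto intro!: exI[of _ "\<lambda>l. if l = i then mfps_monom \<gamma> else 0"])
qed

context reversible_resonance
begin

text \<open>The two sign conditions select the products that phi reverses and psi composed with phi
  preserves. What remains for each type is a finite check over i, e and the parities of a and
  d.\<close>

definition complete_gens :: "('m::finite \<Rightarrow> 6 mfps) \<Rightarrow> (nat \<Rightarrow> 6 mfps^6) \<Rightarrow> nat \<Rightarrow> bool" where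
  "complete_gens X G I \<longleftrightarrow> (\<forall>a b c d e i. e \<le> 1 \<longrightarrow> i \<le> 9 \<longrightarrow> (-1) ^ e * phiV i = -1 \<longrightarrow>
     a0 ^ a * sW ^ (d + e) * chiV i = 1 \<longrightarrow> inv_monom n1 n2 a b c d e *s base_field n1 n2 i \<in> Mset X G I)"

lemma vfilter_Nspan:
  assumes "complete_gens X G I" "Y \<in> Nspan n1 n2"
  shows "vfilter (Qs k) Y \<in> Mset X G I"
  using assms(2) unfolding Nspan_def
proof (induction rule: span_induct)
  case base
  show ?case
    by (rule subspaceI) (use subspace_Mset[of X G I] in
      \<open>auto simp: vfilter_add vfilter_scaleR vfilter_zero intro: subspace_add subspace_scale subspace_0\<close>)
next
  case (step v)
  then obtain a b c d e i where v: "v = inv_monom n1 n2 a b c d e *s base_field n1 n2 i" "e \<le> 1" "i \<le> 9"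
    by blast
  then show ?case
    using assms(1) subspace_0[OF subspace_Mset[of X G I]] by (simp add: vfilter_term complete_gens_def)
qed

text \<open>The projection fixes h and intertwines with the operator, so projecting any solution of
  the homological equation gives one of the right degree and parity.\<close>

lemma decompose:
  assumes "complete_gens X G I"
    and "\<And>i. homogeneous k (h $ i)" "vpar sg_phi (-1) h" "vpar chi 1 h"
  shows "\<exists>\<xi> Y. (\<forall>i. homogeneous k (\<xi> $ i)) \<and> (\<forall>i. homogeneous k (Y $ i)) \<and> vpar sg_phi 1 \<xi> \<and> vpar chi 1 \<xi> \<and>
        vpar sg_phi (-1) Y \<and> vpar chi 1 Y \<and> Y \<in> Mset X G I \<and> h = hom_op (L_matrix w1 w2) \<xi> + Y"
proof -
  obtain \<xi> Y where h: "h = hom_op (L_matrix w1 w2) \<xi> + Y" and Y: "Y \<in> Nspan n1 n2"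
    using homogeneous_solvable[OF assms(2)] unfolding solvable_def by blast
  have "h = vfilter (Qs k) h"
    using assms by (intro vfilter_id[symmetric]) (auto simp: supported_Qs_iff vpar_def)
  also have "\<dots> = hom_op (L_matrix w1 w2) (vfilter (Qs' k) \<xi>) + vfilter (Qs k) Y"
    unfolding h by (simp add: vfilter_add vfilter_hom_op_L)
  finally have "h = hom_op (L_matrix w1 w2) (vfilter (Qs' k) \<xi>) + vfilter (Qs k) Y" .
  moreover have "vfilter (Qs k) Y \<in> Mset X G I"
    using assms(1) Y by (rule vfilter_Nspan)
  moreover have "supported (Qs' k i) (vfilter (Qs' k) \<xi> $ i)" "supported (Qs k i) (vfilter (Qs k) Y $ i)" for i
    by (rule supported_vfilter)+
  ultimately show ?thesis
    by (intro exI[of _ "vfilter (Qs' k) \<xi>"] exI[of _ "vfilter (Qs k) Y"])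
       (auto simp: supported_Qs_iff vpar_def)
qed

end

section \<open>Formal conjugation and factorization of coordinate changes\<close>

definition vpart :: "nat \<Rightarrow> 'n::finite mfps^'n \<Rightarrow> 'n mfps^'n" where
  "vpart k = vfilter (\<lambda>_. {\<alpha>. mdeg \<alpha> = k})"

lemma nth_vpart: "mfps_nth (vpart k v $ i) \<alpha> = (if mdeg \<alpha> = k then mfps_nth (v $ i) \<alpha> else 0)"
  by (simp add: vpart_def nth_vfilter)

lemma hom_vpart: "homogeneous k (vpart k v $ i)"
  by (simp add: homogeneous_def supported_def nth_vpart)

lemma vpar_vpart: "vpar \<epsilon> c v \<Longrightarrow> vpar \<epsilon> c (vpart k v)"
  by (auto simp: vpar_def par_def supported_def nth_vpart)

lemma ord_ge_iff: "ord_ge m s \<longleftrightarrow> (\<forall>\<alpha>. mdeg \<alpha> < m \<longrightarrow> mfps_nth s \<alpha> = 0)"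
  unfolding ord_ge_def supported_def by (metis mem_Collect_eq not_le)

lemma ord_ge_zero [simp]: "ord_ge m 0"
  by (simp add: ord_ge_iff)

lemma ord_ge_diff_vpart:
  assumes "ord_ge k (v $ i)"
  shows "ord_ge (Suc k) (v $ i - vpart k v $ i)"
  using assms by (auto simp: ord_ge_iff nth_vpart less_Suc_eq)

lemma vpart_add: "vpart k (u + v) = vpart k u + vpart k v"
  by (simp add: vpart_def vfilter_add)

lemma vpart_hom: "(\<And>i. homogeneous k (v $ i)) \<Longrightarrow> vpart k v = v"
  unfolding vpart_def homogeneous_def by (rule vfilter_id)

lemma vpart_hom_neq: "(\<And>i. homogeneous l (v $ i)) \<Longrightarrow> k \<noteq> l \<Longrightarrow> vpart k v = 0"
  unfolding vpart_def by (rule vfilter_eq_0) (auto simp: homogeneous_def supported_def)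

lemma vpart_eq_0: "(\<And>i. ord_ge m (v $ i)) \<Longrightarrow> k < m \<Longrightarrow> vpart k v = 0"
  by (simp add: vec_eq_iff, intro allI mfps_eqI) (auto simp: nth_vpart ord_ge_iff)

section \<open>Defect of the conjugacy equation\<close>

definition conj_error ::
    "'n::finite mfps^'n \<Rightarrow> 'n mfps^'n \<Rightarrow> 'n mfps^'n \<Rightarrow> 'n mfps^'n" where
  "conj_error T \<Phi> Y = (\<chi> i. mfps_subst (T $ i) (($) \<Phi>) - (\<Sum>j\<in>UNIV. mfps_deriv j (\<Phi> $ i) * Y $ j))"

definition mfps_X_vec :: "'n::finite mfps^'n" where "mfps_X_vec = (\<chi> i. mfps_X i)"

lemma XXv_nth [simp]: "mfps_X_vec $ i = mfps_X i"
  by (simp add: mfps_X_vec_def)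

lemma ord_ge_near_id:
  assumes "ord_ge 2 ((\<Phi> - mfps_X_vec) $ i)"
  shows "ord_ge 1 (\<Phi> $ i)"
  using ord_ge_add[OF ord_ge_mono[OF assms] ord_ge_XX[of i], of ] by simp

text \<open>In degree k, adding \<xi> changes the defect by A \<xi> minus the derivative of \<xi>
  along A, and adding \<eta> by -\<eta>; together this is the negative of
  \<open>hom_op A \<xi> + \<eta>\<close>. All interactions have higher order.\<close>

lemma conj_error_step:
  fixes \<Phi> Y \<xi> \<eta> :: "'n::finite mfps^'n"
  assumes k: "k \<ge> 2"
    and T: "\<And>i j. mfps_nth (T $ i) (unit_idx j) = A $ i $ j"
    and \<Phi>: "\<And>i. ord_ge 2 ((\<Phi> - mfps_X_vec) $ i)" and Y: "\<And>i. ord_ge 2 ((Y - lin_part A) $ i)"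
    and \<xi>: "\<And>i. homogeneous k (\<xi> $ i)" and \<eta>: "\<And>i. homogeneous k (\<eta> $ i)"
  shows "ord_ge (Suc k) (conj_error T (\<Phi> + \<xi>) (Y + \<eta>) $ i - (conj_error T \<Phi> Y - (hom_op A \<xi> + \<eta>)) $ i)"
proof -
  have o\<xi>: "ord_ge k (\<xi> $ i)" and o\<eta>: "ord_ge k (\<eta> $ i)" for i
    using \<xi> \<eta> hom_imp_ord_ge by blast+
  obtain k' where k': "k = Suc k'"
    using k by (cases k) auto
  have D\<xi>: "ord_ge k' (mfps_deriv j (\<xi> $ i))" for i j
    using o\<xi>[of i] unfolding k' by (rule ord_ge_deriv)
  have D\<Phi>: "ord_ge 1 (mfps_deriv j ((\<Phi> - mfps_X_vec) $ i))" for i j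
    using ord_ge_deriv[of 1 "(\<Phi> - mfps_X_vec) $ i" j] \<Phi>[of i] by (simp add: numeral_2_eq_2)
  define S where "S = mfps_subst (T $ i) (\<lambda>i. \<Phi> $ i + \<xi> $ i) - mfps_subst (T $ i) (($) \<Phi>)
      - (\<Sum>j\<in>UNIV. mfps_nth (T $ i) (unit_idx j) *\<^sub>R \<xi> $ j)"
  have S: "ord_ge (Suc k) S"
    unfolding S_def by (rule subst_perturb) (use ord_ge_near_id[OF \<Phi>] o\<xi> k in auto)
  \<comment> \<open>These remainders have orders (k - 1) + 2, 1 + k and (k - 1) + k; the last
    exceeds k because k \<ge> 2.\<close>
  define E1 where "E1 = (\<Sum>j\<in>UNIV. mfps_deriv j (\<xi> $ i) * ((Y - lin_part A) $ j))"
  define E2 where "E2 = (\<Sum>j\<in>UNIV. mfps_deriv j ((\<Phi> - mfps_X_vec) $ i) * \<eta> $ j)"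
  define E3 where "E3 = (\<Sum>j\<in>UNIV. mfps_deriv j (\<xi> $ i) * \<eta> $ j)"
  have E1: "ord_ge (Suc k) E1"
    unfolding E1_def using ord_ge_mult[OF D\<xi> Y] k' by (intro ord_ge_sum) (metis add_2_eq_Suc')
  have E2: "ord_ge (Suc k) E2"
    unfolding E2_def using ord_ge_mult[OF D\<Phi> o\<eta>] by (intro ord_ge_sum) (metis plus_1_eq_Suc)
  have E3: "ord_ge (Suc k) E3"
    unfolding E3_def using ord_ge_mono[OF ord_ge_mult[OF D\<xi> o\<eta>], of "Suc k"] k k' by (intro ord_ge_sum) auto
  have plus: "($) (\<Phi> + \<xi>) = (\<lambda>i. \<Phi> $ i + \<xi> $ i)"
    by auto
  have delta: "(\<Sum>j\<in>UNIV. mfps_deriv j (mfps_X i) * \<eta> $ j) = \<eta> $ i"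
  proof -
    have "(\<Sum>j\<in>UNIV. mfps_deriv j (mfps_X i) * \<eta> $ j) = (\<Sum>j\<in>UNIV. if j = i then \<eta> $ j else 0)"
      by (rule sum.cong) (auto simp: deriv_XX)
    then show ?thesis by simp
  qed
  have D: "mfps_deriv j ((\<Phi> + \<xi>) $ i) * (Y + \<eta>) $ j = mfps_deriv j (\<Phi> $ i) * Y $ j
      + (mfps_deriv j (\<xi> $ i) * lin_part A $ j + mfps_deriv j (\<xi> $ i) * ((Y - lin_part A) $ j))
      + (mfps_deriv j (mfps_X i) * \<eta> $ j + mfps_deriv j ((\<Phi> - mfps_X_vec) $ i) * \<eta> $ j)
      + mfps_deriv j (\<xi> $ i) * \<eta> $ j" for j
    by (simp add: deriv_add deriv_diff algebra_simps)
  have "(\<Sum>j\<in>UNIV. mfps_deriv j ((\<Phi> + \<xi>) $ i) * (Y + \<eta>) $ j)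
      = (\<Sum>j\<in>UNIV. mfps_deriv j (\<Phi> $ i) * Y $ j) + (lie_deriv A (\<xi> $ i) + E1) + (\<eta> $ i + E2) + E3"
    unfolding D sum.distrib delta lie_deriv_def E1_def E2_def E3_def ..
  then have "conj_error T (\<Phi> + \<xi>) (Y + \<eta>) $ i - (conj_error T \<Phi> Y - (hom_op A \<xi> + \<eta>)) $ i = S - E1 - E2 - E3"
    unfolding conj_error_def hom_op_def S_def T plus by (simp add: algebra_simps)
  then show ?thesis
    using S E1 E2 E3 by (simp add: ord_ge_diff)
qed

lemma vpar_conj_error:
  assumes "\<And>i. \<epsilon> i * \<epsilon> i = 1" "vpar \<epsilon> c T" "vpar \<epsilon> 1 \<Phi>" "vpar \<epsilon> c Y"
  shows "vpar \<epsilon> c (conj_error T \<Phi> Y)"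
  unfolding vpar_def
proof
  fix i
  have "par \<epsilon> (c * \<epsilon> i) (mfps_subst (T $ i) (($) \<Phi>))"
    by (rule par_subst[where \<epsilon>' = \<epsilon>]) (use assms in \<open>auto simp: vpar_def\<close>)
  moreover have "par \<epsilon> (c * \<epsilon> i) (mfps_deriv j (\<Phi> $ i) * Y $ j)" for j
  proof -
    have "par \<epsilon> ((\<epsilon> i * \<epsilon> j) * (c * \<epsilon> j)) (mfps_deriv j (\<Phi> $ i) * Y $ j)"
      by (intro par_mult par_deriv) (use assms in \<open>auto simp: vpar_def\<close>)
    moreover have "(\<epsilon> i * \<epsilon> j) * (c * \<epsilon> j) = c * \<epsilon> i * (\<epsilon> j * \<epsilon> j)"
      by (simp add: mult_ac)
    ultimately show ?thesis
      using assms(1) by simp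
  qed
  ultimately show "par \<epsilon> (c * \<epsilon> i) (conj_error T \<Phi> Y $ i)"
    by (auto simp: conj_error_def intro: par_diff par_sum)
qed

lemma vpar_add: "vpar \<epsilon> c u \<Longrightarrow> vpar \<epsilon> c v \<Longrightarrow> vpar \<epsilon> c (u + v)"
  by (auto simp: vpar_def intro: par_add)

lemma vpar_XXv: "vpar \<epsilon> 1 mfps_X_vec"
  by (simp add: vpar_def par_XX)

text \<open>
  A coefficientwise limit only if step \<open>n\<close> of the sequence leaves all coefficients of degree
  \<open>< n + 2\<close> unchanged.
\<close>
definition vlimit :: "(nat \<Rightarrow> 'n::finite mfps^'n) \<Rightarrow> 'n mfps^'n" where
  "vlimit v = (\<chi> i. Abs_mfps (\<lambda>\<alpha>. mfps_nth (v (mdeg \<alpha>) $ i) \<alpha>))"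

lemma ord_ge_vlimit:
  assumes "\<And>n i. ord_ge (n + 2) ((v (Suc n) - v n) $ i)"
  shows "ord_ge (n + 2) ((vlimit v - v n) $ i)"
proof -
  have stable: "mfps_nth (v m $ i) \<alpha> = mfps_nth (v n $ i) \<alpha>" if "n \<le> m" "mdeg \<alpha> < n + 2" for m n \<alpha>
    using that(1)
  proof (induction m rule: dec_induct)
    case (step m)
    then have "mfps_nth ((v (Suc m) - v m) $ i) \<alpha> = 0"
      using assms[of m i] that(2) by (auto simp: ord_ge_iff)
    with step show ?case by simp
  qed simp
  have "mfps_nth (v (mdeg \<alpha>) $ i) \<alpha> = mfps_nth (v n $ i) \<alpha>" if "mdeg \<alpha> < n + 2" for \<alpha>
    using stable[of "mdeg \<alpha>" n \<alpha>] stable[of n "mdeg \<alpha>" \<alpha>] that by (cases "mdeg \<alpha> \<le> n") auto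
  then show ?thesis
    by (simp add: ord_ge_iff vlimit_def)
qed

lemma vpar_vlimit: "(\<And>n. vpar \<epsilon> c (v n)) \<Longrightarrow> vpar \<epsilon> c (vlimit v)"
  by (auto simp: vpar_def par_def supported_def vlimit_def)

text \<open>Differentiating the change of \<Phi> costs one degree, whence n + 1 in the conclusion.
  It still lets every fixed coefficient of the limiting defect be read off at a finite
  stage.\<close>

lemma conj_error_limit:
  fixes \<Phi> Y \<Phi>' Y' :: "'n::finite mfps^'n"
  assumes "\<And>i. ord_ge 1 (\<Phi> $ i)" "\<And>i. ord_ge (n + 2) ((\<Phi>' - \<Phi>) $ i)" "\<And>i. ord_ge (n + 2) ((Y' - Y) $ i)"
  shows "ord_ge (n + 1) ((conj_error T \<Phi>' Y' - conj_error T \<Phi> Y) $ i)"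
proof -
  let ?L = "\<Sum>j\<in>UNIV. mfps_nth (T $ i) (unit_idx j) *\<^sub>R (\<Phi>' - \<Phi>) $ j"
  have "ord_ge (Suc (n + 2)) (mfps_subst (T $ i) (\<lambda>i. \<Phi> $ i + (\<Phi>' - \<Phi>) $ i) - mfps_subst (T $ i) (($) \<Phi>) - ?L)"
    by (rule subst_perturb) (use assms in auto)
  moreover have "(\<lambda>i. \<Phi> $ i + (\<Phi>' - \<Phi>) $ i) = ($) \<Phi>'"
    by auto
  ultimately have 1: "ord_ge (n + 1) (mfps_subst (T $ i) (($) \<Phi>') - mfps_subst (T $ i) (($) \<Phi>) - ?L)"
    by (auto elim: ord_ge_mono)
  have 2: "ord_ge (n + 1) ?L"
    using ord_ge_mono[OF assms(2)] by (intro ord_ge_sum ord_ge_scaleR) auto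
  have 3: "ord_ge (n + 1) (mfps_deriv j ((\<Phi>' - \<Phi>) $ i) * Y' $ j)" for j
    using ord_ge_mult[OF ord_ge_deriv[of "n + 1"] ord_ge_0, of "(\<Phi>' - \<Phi>) $ i" j "Y' $ j"] assms(2)[of i] by simp
  have 4: "ord_ge (n + 1) (mfps_deriv j (\<Phi> $ i) * (Y' - Y) $ j)" for j
    using ord_ge_mono[OF ord_ge_mult[OF ord_ge_0 assms(3)], of "n + 1"] by simp
  have eq: "(conj_error T \<Phi>' Y' - conj_error T \<Phi> Y) $ i
      = (mfps_subst (T $ i) (($) \<Phi>') - mfps_subst (T $ i) (($) \<Phi>) - ?L) + ?L
        - ((\<Sum>j\<in>UNIV. mfps_deriv j ((\<Phi>' - \<Phi>) $ i) * Y' $ j) + (\<Sum>j\<in>UNIV. mfps_deriv j (\<Phi> $ i) * (Y' - Y) $ j))"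
    by (simp add: conj_error_def deriv_diff algebra_simps sum_subtractf)
  show ?thesis
    unfolding eq
    by (rule ord_ge_diff[OF ord_ge_add[OF 1 2] ord_ge_add[OF ord_ge_sum[OF 3] ord_ge_sum[OF 4]]])
qed

text \<open>
  Degree by degree, the error of degree \<open>k\<close> is split by the homological operator into a part removed
  by the coordinate change and a part kept in the normal form.
\<close>
theorem formal_normal_form:
  fixes A :: "real^'n::finite^'n" and T :: "'n mfps^'n" and \<epsilon>1 \<epsilon>2 :: "'n \<Rightarrow> real"
  assumes \<epsilon>: "\<And>i. \<epsilon>1 i * \<epsilon>1 i = 1" "\<And>i. \<epsilon>2 i * \<epsilon>2 i = 1"
    and T0: "\<And>i. mfps_nth (T $ i) 0 = 0"
    and T1: "\<And>i j. mfps_nth (T $ i) (unit_idx j) = A $ i $ j"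
    and Tpar: "vpar \<epsilon>1 (-1) T" "vpar \<epsilon>2 1 T"
    and decompose: "\<And>k h. k \<ge> 2 \<Longrightarrow> (\<And>i. homogeneous k (h $ i)) \<Longrightarrow> vpar \<epsilon>1 (-1) h \<Longrightarrow> vpar \<epsilon>2 1 h \<Longrightarrow>
      \<exists>\<xi> Y. (\<forall>i. homogeneous k (\<xi> $ i)) \<and> (\<forall>i. homogeneous k (Y $ i)) \<and> vpar \<epsilon>1 1 \<xi> \<and> vpar \<epsilon>2 1 \<xi> \<and>
        vpar \<epsilon>1 (-1) Y \<and> vpar \<epsilon>2 1 Y \<and> Y \<in> M \<and> h = hom_op A \<xi> + Y"
  shows "\<exists>\<Phi> Y. (\<forall>i. ord_ge 2 ((\<Phi> - mfps_X_vec) $ i)) \<and> vpar \<epsilon>1 1 \<Phi> \<and> vpar \<epsilon>2 1 \<Phi> \<and>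
    (\<forall>i. ord_ge 2 ((Y - lin_part A) $ i)) \<and> (\<forall>k\<ge>2. vpart k Y \<in> M) \<and> conj_error T \<Phi> Y = 0"
proof -
  define good where "good = (\<lambda>k h \<xi> Y. (\<forall>i. homogeneous k (\<xi> $ i)) \<and> (\<forall>i. homogeneous k (Y $ i)) \<and> vpar \<epsilon>1 1 \<xi> \<and> vpar \<epsilon>2 1 \<xi> \<and>
        vpar \<epsilon>1 (-1) Y \<and> vpar \<epsilon>2 1 Y \<and> Y \<in> M \<and> h = hom_op A \<xi> + (Y :: 'n mfps^'n))"
  have "\<exists>\<xi> Y. k \<ge> 2 \<longrightarrow> (\<forall>i. homogeneous k (h $ i)) \<longrightarrow> vpar \<epsilon>1 (-1) h \<longrightarrow> vpar \<epsilon>2 1 h \<longrightarrow> good k h \<xi> Y" for k h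
    using decompose[of k h] unfolding good_def by blast
  then obtain Xi Yi where XY: "\<And>k h. k \<ge> 2 \<Longrightarrow> (\<And>i. homogeneous k (h $ i)) \<Longrightarrow> vpar \<epsilon>1 (-1) h \<Longrightarrow> vpar \<epsilon>2 1 h
      \<Longrightarrow> good k h (Xi k h) (Yi k h)"
    by metis
  \<comment> \<open>Stage n treats degree n + 2, since the linear parts agree from the
    start.\<close>
  define R where "R = (\<lambda>n (\<Phi>, Y). vpart (n + 2) (conj_error T \<Phi> Y))"
  define st where "st = rec_nat (mfps_X_vec :: 'n mfps^'n, lin_part A)
      (\<lambda>n p. (fst p + Xi (n + 2) (R n p), snd p + Yi (n + 2) (R n p)))"
  define \<Phi> where "\<Phi> = (\<lambda>n. fst (st n))"
  define Y where "Y = (\<lambda>n. snd (st n))"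
  define \<xi> where "\<xi> = (\<lambda>n. Xi (n + 2) (R n (st n)))"
  define \<eta> where "\<eta> = (\<lambda>n. Yi (n + 2) (R n (st n)))"
  have \<Phi>_0: "\<Phi> 0 = mfps_X_vec" and \<Phi>_Suc: "\<Phi> (Suc n) = \<Phi> n + \<xi> n"
    and Y_0: "Y 0 = lin_part A" and Y_Suc: "Y (Suc n) = Y n + \<eta> n" for n
    by (simp_all add: \<Phi>_def Y_def st_def \<xi>_def \<eta>_def)
  have R_eq: "R n (st n) = vpart (n + 2) (conj_error T (\<Phi> n) (Y n))" for n
    by (simp add: R_def \<Phi>_def Y_def case_prod_unfold)
  have lin_par: "vpar \<epsilon>1 (-1) (lin_part A)" "vpar \<epsilon>2 1 (lin_part A)"
  proof -
    \<comment> \<open>The entries of A are the linear coefficients of T, so a nonzero one forces the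
      two signs to match.\<close>
    have "vpar \<epsilon> c (lin_part A)" if "vpar \<epsilon> c T" for \<epsilon> c
      unfolding vpar_def lin_part_def vec_lambda_beta
    proof (intro allI par_sum)
      fix i j
      show "par \<epsilon> (c * \<epsilon> i) (A $ i $ j *\<^sub>R mfps_X j)"
      proof (cases "A $ i $ j = 0")
        case False
        then have "\<epsilon> j = c * \<epsilon> i"
          using that parD[of \<epsilon> "c * \<epsilon> i" "T $ i" "unit_idx j"] by (auto simp: vpar_def T1)
        then show ?thesis using par_XX[of \<epsilon> j] by (auto intro: par_scaleR)
      qed simp
    qed
    then show "vpar \<epsilon>1 (-1) (lin_part A)" "vpar \<epsilon>2 1 (lin_part A)" using Tpar by blast+
  qed
  have inv: "(\<forall>i. ord_ge 2 ((\<Phi> n - mfps_X_vec) $ i)) \<and> vpar \<epsilon>1 1 (\<Phi> n) \<and> vpar \<epsilon>2 1 (\<Phi> n) \<and>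
      (\<forall>i. ord_ge 2 ((Y n - lin_part A) $ i)) \<and> vpar \<epsilon>1 (-1) (Y n) \<and> vpar \<epsilon>2 1 (Y n) \<and>
      (\<forall>i. ord_ge (n + 2) (conj_error T (\<Phi> n) (Y n) $ i)) \<and> good (n + 2) (R n (st n)) (\<xi> n) (\<eta> n)" for n
  proof (induction n)
    case 0
    have "conj_error T mfps_X_vec (lin_part A) $ i = T $ i - lin_part A $ i" for i
    proof -
      have "(\<Sum>j\<in>UNIV. mfps_deriv j (mfps_X i) * lin_part A $ j) = lin_part A $ i"
        using lie_deriv_XX[of A i] by (simp add: lie_deriv_def)
      moreover have "($) mfps_X_vec = (mfps_X :: 'n \<Rightarrow> 'n mfps)"
        by auto
      ultimately show ?thesis by (simp add: conj_error_def)
    qed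
    moreover have "ord_ge 2 (T $ i - lin_part A $ i)" for i
      unfolding ord_ge_iff
    proof (intro allI impI)
      fix \<alpha> :: "'n \<Rightarrow> nat" assume "mdeg \<alpha> < 2"
      then consider "\<alpha> = 0" | "mdeg \<alpha> = 1" by (metis One_nat_def less_2_cases mdeg_eq_0)
      then show "mfps_nth (T $ i - lin_part A $ i) \<alpha> = 0"
      proof cases
        case 2
        then obtain j where "\<alpha> = unit_idx j" by (rule mdeg_eq_1E)
        then show ?thesis
          by (simp add: T1 lin_part_def nth_sum if_distrib[of "\<lambda>c. _ * c"] cong: if_cong)
      qed (simp add: T0 lin_part_def nth_sum)
    qed
    ultimately have err: "ord_ge (0 + 2) (conj_error T (\<Phi> 0) (Y 0) $ i)" for i
      by (simp add: \<Phi>_0 Y_0 numeral_2_eq_2)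
    have "good (0 + 2) (R 0 (st 0)) (\<xi> 0) (\<eta> 0)"
      unfolding \<xi>_def \<eta>_def R_eq \<Phi>_0 Y_0
      by (intro XY hom_vpart vpar_vpart vpar_conj_error \<epsilon> Tpar vpar_XXv lin_par) simp
    then show ?case
      using err by (simp add: \<Phi>_0 Y_0 vpar_XXv lin_par)
  next
    case (Suc n)
    have g: "good (n + 2) (R n (st n)) (\<xi> n) (\<eta> n)" using Suc by blast
    have \<xi>2: "ord_ge 2 (\<xi> n $ i)" and \<eta>2: "ord_ge 2 (\<eta> n $ i)" for i
      by (rule hom_imp_ord_ge[of "n + 2"]; use g in \<open>simp add: good_def\<close>)+
    have 1: "ord_ge 2 ((\<Phi> (Suc n) - mfps_X_vec) $ i)" for i
    proof -
      have "ord_ge 2 ((\<Phi> n - mfps_X_vec) $ i)" "ord_ge 2 (\<xi> n $ i)"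
        using Suc \<xi>2 \<eta>2 by blast+
      from ord_ge_add[OF this] show ?thesis
        by (simp add: \<Phi>_Suc algebra_simps)
    qed
    have 2: "ord_ge 2 ((Y (Suc n) - lin_part A) $ i)" for i
    proof -
      have "ord_ge 2 ((Y n - lin_part A) $ i)" "ord_ge 2 (\<eta> n $ i)"
        using Suc \<xi>2 \<eta>2 by blast+
      from ord_ge_add[OF this] show ?thesis
        by (simp add: Y_Suc algebra_simps)
    qed
    have 3: "vpar \<epsilon>1 1 (\<Phi> (Suc n))" "vpar \<epsilon>2 1 (\<Phi> (Suc n))" "vpar \<epsilon>1 (-1) (Y (Suc n))" "vpar \<epsilon>2 1 (Y (Suc n))"
      using Suc g by (auto simp: good_def \<Phi>_Suc Y_Suc intro: vpar_add)
    have 4: "ord_ge (Suc n + 2) (conj_error T (\<Phi> (Suc n)) (Y (Suc n)) $ i)" for i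
    proof -
      have "ord_ge (Suc (n + 2)) (conj_error T (\<Phi> n + \<xi> n) (Y n + \<eta> n) $ i
          - (conj_error T (\<Phi> n) (Y n) - (hom_op A (\<xi> n) + \<eta> n)) $ i)"
        by (rule conj_error_step) (use Suc g T1 in \<open>auto simp: good_def\<close>)
      moreover have "hom_op A (\<xi> n) + \<eta> n = vpart (n + 2) (conj_error T (\<Phi> n) (Y n))"
        using g unfolding good_def R_eq by simp
      moreover have "ord_ge (Suc (n + 2)) (conj_error T (\<Phi> n) (Y n) $ i
          - vpart (n + 2) (conj_error T (\<Phi> n) (Y n)) $ i)"
        using Suc by (intro ord_ge_diff_vpart) blast
      ultimately show ?thesis
        using ord_ge_add by (fastforce simp: \<Phi>_Suc Y_Suc)
    qed
    have 5: "good (Suc n + 2) (R (Suc n) (st (Suc n))) (\<xi> (Suc n)) (\<eta> (Suc n))"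
      unfolding \<xi>_def \<eta>_def R_eq
      by (intro XY hom_vpart vpar_vpart vpar_conj_error \<epsilon> Tpar 3) simp
    from 1 2 3 4 5 show ?case by blast
  qed
  have step_ord: "ord_ge (n + 2) (\<xi> n $ i)" "ord_ge (n + 2) (\<eta> n $ i)" for n i
    by (rule hom_imp_ord_ge[of "n + 2"]; use inv[of n] in \<open>simp add: good_def\<close>)+
  have near: "ord_ge 2 ((\<Phi> n - mfps_X_vec) $ i)" for n i
    using inv[of n] by blast
  define \<Phi>l where "\<Phi>l = vlimit \<Phi>"
  define Yl where "Yl = vlimit Y"
  have \<Phi>lim: "ord_ge (n + 2) ((\<Phi>l - \<Phi> n) $ i)" for n i
    unfolding \<Phi>l_def
    by (rule ord_ge_vlimit) (simp add: \<Phi>_Suc step_ord del: add_2_eq_Suc')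
  have Ylim: "ord_ge (n + 2) ((Yl - Y n) $ i)" for n i
    unfolding Yl_def
    by (rule ord_ge_vlimit) (simp add: Y_Suc step_ord del: add_2_eq_Suc')
  have "conj_error T \<Phi>l Yl $ i = 0" for i
  proof (rule mfps_eqI)
    fix \<alpha> :: "'n \<Rightarrow> nat"
    define n where "n = mdeg \<alpha>"
    have "ord_ge (n + 1) ((conj_error T \<Phi>l Yl - conj_error T (\<Phi> n) (Y n)) $ i)"
      by (rule conj_error_limit[OF ord_ge_near_id[OF near] \<Phi>lim Ylim])
    moreover have "ord_ge (n + 2) (conj_error T (\<Phi> n) (Y n) $ i)"
      using inv[of n] by blast
    ultimately show "mfps_nth (conj_error T \<Phi>l Yl $ i) \<alpha> = mfps_nth 0 \<alpha>"
      by (auto simp: ord_ge_iff n_def)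
  qed
  then have "conj_error T \<Phi>l Yl = 0"
    by (simp add: vec_eq_iff)
  moreover have "vpart k Yl \<in> M" if "k \<ge> 2" for k
  proof -
    \<comment> \<open>The degree k part of the limit is exactly the correction of stage k - 2:
      earlier stages add lower degrees, later ones higher degrees.\<close>
    define n where "n = k - 2"
    have k: "k = n + 2" using that by (simp add: n_def)
    have "vpart j (Y n) = 0" if "j \<ge> n + 2" for j
      using that
    proof (induction n arbitrary: j)
      case 0
      have "homogeneous 1 (lin_part A $ i)" for i
        unfolding lin_part_def by (auto intro!: hom_sum hom_scaleR hom_mono)
      then show ?case
        unfolding Y_0 using 0 by (intro vpart_hom_neq[where l = 1]) auto
    next
      case (Suc n)
      have "homogeneous (n + 2) (\<eta> n $ i)" for i
        using inv[of n] by (simp add: good_def)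
      then have "vpart j (\<eta> n) = 0"
        using Suc.prems by (intro vpart_hom_neq[where l = "n + 2"]) auto
      then show ?case
        using Suc by (simp add: Y_Suc vpart_add)
    qed
    then have "vpart k (Y n) = 0"
      using k by simp
    moreover have "vpart k (\<eta> n) = \<eta> n"
      using inv[of n] k by (intro vpart_hom) (auto simp: good_def)
    ultimately have "vpart k (Y (Suc n)) = \<eta> n"
      by (simp add: Y_Suc vpart_add)
    moreover have "vpart k (Yl - Y (Suc n)) = 0"
      using Ylim[of "Suc n"] k by (intro vpart_eq_0) auto
    ultimately have "vpart k Yl = \<eta> n"
      using vpart_add[of k "Yl - Y (Suc n)" "Y (Suc n)"] by simp
    then show ?thesis using inv[of n] by (simp add: good_def)
  qed
  moreover have "ord_ge 2 ((\<Phi>l - mfps_X_vec) $ i)" "ord_ge 2 ((Yl - lin_part A) $ i)" for i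
    using \<Phi>lim[of 0 i] Ylim[of 0 i] by (simp_all add: \<Phi>_0 Y_0 numeral_2_eq_2)
  moreover have "vpar \<epsilon>1 1 \<Phi>l" "vpar \<epsilon>2 1 \<Phi>l"
    unfolding \<Phi>l_def using inv by (auto intro: vpar_vlimit)
  ultimately show ?thesis by blast
qed

section \<open>Factoring a formal map into homogeneous changes\<close>

definition poly_map :: "nat \<Rightarrow> 'n::finite mfps^'n \<Rightarrow> real^'n \<Rightarrow> real^'n" where
  "poly_map k p x = (\<chi> i. \<Sum>\<alpha> | mdeg \<alpha> = k. mfps_nth (p $ i) \<alpha> * (\<Prod>j\<in>UNIV. (x $ j) ^ \<alpha> j))"

lemma homogeneous_poly_map: "homogeneous_poly_map k (poly_map k p)"
  unfolding homogeneous_poly_map_def poly_map_def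
  by (rule exI[of _ "\<lambda>i. mfps_nth (p $ i)"]) (simp add: mdeg_def)

lemma taylor_map_poly_map:
  assumes "\<And>i. homogeneous k (p $ i)"
  shows "taylor_map (\<lambda>x. x + poly_map k p x) i = mfps_X i + p $ i"
proof -
  have "has_jet (\<lambda>x. x $ i + (\<Sum>\<alpha> | mdeg \<alpha> = k. mfps_nth (p $ i) \<alpha> * (\<Prod>j\<in>UNIV. (x $ j) ^ \<alpha> j)))
      (mfps_X i + (\<Sum>\<alpha> | mdeg \<alpha> = k. mfps_nth (p $ i) \<alpha> *\<^sub>R pw mfps_X \<alpha>))"
    unfolding has_jet_def pw_def by (intro allI jet_add jet_sum jet_scale jet_prod jet_power jet_coord)
  then show ?thesis
    unfolding taylor_map_def using hom_eq_sum_mono[OF assms[of i]]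
    by (simp add: poly_map_def taylor_has_jet)
qed

lemma poly_map_diag:
  assumes "vpar \<delta> 1 p"
  shows "poly_map k p (\<chi> i. \<delta> i * x $ i) = (\<chi> i. \<delta> i * poly_map k p x $ i)"
proof -
  have key: "mfps_nth (p $ i) \<alpha> * (\<Prod>j\<in>UNIV. (\<delta> j * x $ j) ^ \<alpha> j)
      = \<delta> i * (mfps_nth (p $ i) \<alpha> * (\<Prod>j\<in>UNIV. (x $ j) ^ \<alpha> j))" for i \<alpha>
  proof (cases "mfps_nth (p $ i) \<alpha> = 0")
    case False
    then have "sgn_pow \<delta> \<alpha> = \<delta> i"
      using assms parD[of \<delta> "\<delta> i" "p $ i" \<alpha>] by (auto simp: vpar_def)
    then show ?thesis
      by (simp add: power_mult_distrib prod.distrib flip: sgn_pow_def)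
  qed simp
  then show ?thesis
    by (simp only: poly_map_def vec_lambda_beta sum_distrib_left key)
qed

text \<open>\<open>C m\<close> is the composition of the first m factors. As it is tangent to the
  identity, composing it with I + P, where P is the degree m + 2 part of what is missing, adds P in
  that degree and otherwise disturbs only higher ones. The factors commute with \<Gamma> because its
  elements are diagonal and parity passes through substitution.\<close>

lemma formal_change_of_coordinatesI:
  fixes \<Phi> :: "'n::finite mfps^'n"
  assumes \<Phi>: "\<And>i. ord_ge 2 ((\<Phi> - mfps_X_vec) $ i)"
    and \<Gamma>: "\<And>\<gamma>. \<gamma> \<in> \<Gamma> \<Longrightarrow> \<exists>\<delta>. vpar \<delta> 1 \<Phi> \<and> (\<forall>x. \<gamma> x = (\<chi> i. \<delta> i * x $ i))"
  shows "formal_change_of_coordinates \<Gamma> (($) \<Phi>)"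
proof -
  define C where "C = rec_nat (mfps_X_vec :: 'n mfps^'n)
      (\<lambda>m C. \<chi> i. mfps_subst (C $ i) (\<lambda>j. mfps_X j + vpart (m + 2) (\<Phi> - C) $ j))"
  define P where "P = (\<lambda>m. vpart (m + 2) (\<Phi> - C m))"
  have C_0: "C 0 = mfps_X_vec" and C_Suc: "C (Suc m) $ i = mfps_subst (C m $ i) (\<lambda>j. mfps_X j + P m $ j)" for m i
    by (simp_all add: C_def P_def)
  have P_ord: "ord_ge (m + 2) (P m $ i)" for m i
    unfolding P_def by (rule hom_imp_ord_ge[OF hom_vpart]) simp
  have inv: "(\<forall>i. ord_ge (m + 2) ((\<Phi> - C m) $ i)) \<and> (\<forall>i. ord_ge 2 ((C m - mfps_X_vec) $ i))" for m
  proof (induction m)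
    case 0
    show ?case using \<Phi> by (simp add: C_0 numeral_2_eq_2)
  next
    case (Suc m)
    have unit: "mfps_nth (C m $ i) (unit_idx j) = (if i = j then 1 else 0)" for i j
      using Suc ord_geD[of 2 "(C m - mfps_X_vec) $ i" "unit_idx j"] by (auto split: if_splits)
    have step: "ord_ge (Suc (m + 2)) (C (Suc m) $ i - C m $ i - P m $ i)" for i
    proof -
      have "(\<Sum>j\<in>UNIV. mfps_nth (C m $ i) (unit_idx j) *\<^sub>R P m $ j) = P m $ i"
        unfolding unit by (simp add: if_distrib[of "\<lambda>c. c *\<^sub>R _"] cong: if_cong)
      then show ?thesis
        using subst_perturb[where \<Phi> = mfps_X and \<eta> = "($) (P m)" and g = "C m $ i", OF ord_ge_XX P_ord]
        by (simp add: C_Suc)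
    qed
    have "ord_ge (Suc m + 2) ((\<Phi> - C (Suc m)) $ i)" for i
    proof -
      have "ord_ge (Suc (m + 2)) ((\<Phi> - C m) $ i - P m $ i)"
        unfolding P_def using Suc by (intro ord_ge_diff_vpart) blast
      from ord_ge_diff[OF this step[of i]] show ?thesis by (simp add: algebra_simps)
    qed
    moreover have "ord_ge 2 ((C (Suc m) - mfps_X_vec) $ i)" for i
    proof -
      have "ord_ge 2 ((C m - mfps_X_vec) $ i)" "ord_ge 2 (P m $ i)" "ord_ge 2 (C (Suc m) $ i - C m $ i - P m $ i)"
        using Suc ord_ge_mono[OF P_ord[of m i]] ord_ge_mono[OF step[of i]] by auto
      from ord_ge_add[OF ord_ge_add[OF this(1,2)] this(3)] show ?thesis by (simp add: algebra_simps)
    qed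
    ultimately show ?case by blast
  qed
  have C_par: "vpar \<delta> 1 (C m)" if "vpar \<delta> 1 \<Phi>" for \<delta> m
  proof (induction m)
    case 0
    show ?case by (simp add: C_0 vpar_XXv)
  next
    case (Suc m)
    have P: "vpar \<delta> 1 (P m)"
      unfolding P_def using that Suc by (intro vpar_vpart) (auto simp: vpar_def intro: par_diff)
    show ?case
      unfolding vpar_def C_Suc
      using Suc P by (auto simp: vpar_def intro!: par_subst[where \<epsilon>' = \<delta>] par_add par_XX)
  qed
  \<comment> \<open>The factor of degree k belongs to stage k - 2; degrees below 2 never enter
    \<open>successive_changes\<close>.\<close>
  define \<xi> where "\<xi> = (\<lambda>k. poly_map k (P (k - 2)))"
  have sc: "successive_changes \<xi> m = ($) (C m)" for m
  proof (induction m)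
    case 0
    have "taylor (\<lambda>x :: real^'n. x $ i) = mfps_X i" for i
      by (rule taylor_has_jet) (simp add: has_jet_def jet_coord)
    then show ?case by (auto simp: C_0 taylor_map_def)
  next
    case (Suc m)
    have "homogeneous (m + 2) (P m $ i)" for i
      unfolding P_def by (rule hom_vpart)
    then have "taylor_map (\<lambda>x. x + \<xi> (m + 2) x) = (\<lambda>j. mfps_X j + P m $ j)"
      using taylor_map_poly_map[of "m + 2" "P m"] by (auto simp: \<xi>_def)
    then show ?case by (intro ext) (simp only: successive_changes.simps Suc C_Suc)
  qed
  show ?thesis
    unfolding formal_change_of_coordinates_def
  proof (intro exI[of _ \<xi>] conjI allI impI ballI)
    fix k :: nat and \<gamma> x
    show "homogeneous_poly_map k (\<xi> k)"
      unfolding \<xi>_def by (rule homogeneous_poly_map)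
    assume "\<gamma> \<in> \<Gamma>"
    then obtain \<delta> where \<delta>: "vpar \<delta> 1 \<Phi>" "\<And>x. \<gamma> x = (\<chi> i. \<delta> i * x $ i)"
      using \<Gamma> by blast
    have "vpar \<delta> 1 (P m)" for m
      unfolding P_def using \<delta>(1) C_par[OF \<delta>(1)] by (intro vpar_vpart) (auto simp: vpar_def intro: par_diff)
    then show "\<xi> k (\<gamma> x) = \<gamma> (\<xi> k x)"
      unfolding \<xi>_def \<delta>(2) by (rule poly_map_diag)
  next
    fix i \<alpha>
    have "mfps_nth (C m $ i) \<alpha> = mfps_nth (\<Phi> $ i) \<alpha>" if "m \<ge> mdeg \<alpha>" for m
    proof -
      have "mfps_nth ((\<Phi> - C m) $ i) \<alpha> = 0"
        using inv[of m] that by (auto simp: ord_ge_iff)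
      then show ?thesis by simp
    qed
    then show "\<forall>\<^sub>F m in sequentially. mfps_nth (successive_changes \<xi> m i) \<alpha> = mfps_nth (\<Phi> $ i) \<alpha>"
      unfolding sc eventually_sequentially by blast
  qed
qed

text \<open>Each degree supplies its own choice \<open>F k\<close> of coefficient series. Since X
  and G are homogeneous, the power product of exponent \<gamma> times \<open>G i\<close> lives in
  the single degree \<open>wt i \<gamma>\<close>, so the merged series takes its coefficient at
  \<gamma> from the choice for that degree.\<close>

lemma glue_homogeneous_parts:
  fixes X :: "'m::finite \<Rightarrow> 6 mfps" and G :: "nat \<Rightarrow> 6 mfps^6" and Y :: "6 mfps^6"
  assumes X: "\<And>j. homogeneous (w j) (X j)" and w: "\<And>j. w j \<ge> 1"
    and G: "\<And>i j. i < I \<Longrightarrow> homogeneous (o' i) (G i $ j)"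
    and Y: "\<And>j. ord_ge 2 ((Y - lin_part A) $ j)"
    and M: "\<And>k. k \<ge> 2 \<Longrightarrow> vpart k Y \<in> Mset X G I"
  shows "\<exists>f. Y = lin_part A + (\<Sum>i<I. mfps_subst (f i) X *s G i)"
proof -
  have Xo: "ord_ge 1 (X j)" for j
    using X w by (rule hom_imp_ord_ge)
  have ex: "\<exists>f. vpart k Y = (\<Sum>i<I. mfps_subst (f i) X *s G i)" if "k \<ge> 2" for k
    using M[OF that] unfolding Mset_def by simp
  define F where "F = (\<lambda>k. SOME f. vpart k Y = (\<Sum>i<I. mfps_subst (f i) X *s G i))"
  have F: "vpart k Y = (\<Sum>i<I. mfps_subst (F k i) X *s G i)" if "k \<ge> 2" for k
    unfolding F_def by (rule someI_ex[OF ex[OF that]])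
  define wt where "wt = (\<lambda>i \<gamma>. (\<Sum>j\<in>UNIV. \<gamma> j * w j) + o' i)"
  \<comment> \<open>Weights below 2 receive coefficient 0, because in those degrees \<open>Y\<close>
    is the linear part alone.\<close>
  define f where "f = (\<lambda>i. Abs_mfps (\<lambda>\<gamma>. if wt i \<gamma> \<ge> 2 then mfps_nth (F (wt i \<gamma>) i) \<gamma> else 0))"
  have f_nth: "mfps_nth (f i) \<gamma> = (if wt i \<gamma> \<ge> 2 then mfps_nth (F (wt i \<gamma>) i) \<gamma> else 0)" for i \<gamma>
    by (simp add: f_def)
  have expand: "mfps_nth ((\<Sum>i<I. mfps_subst (g i) X *s G i) $ j) \<alpha>
      = (\<Sum>i<I. \<Sum>\<gamma> | mdeg \<gamma> \<le> mdeg \<alpha>. mfps_nth (g i) \<gamma> * mfps_nth (pw X \<gamma> * G i $ j) \<alpha>)" for g j \<alpha>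
    by (simp add: nth_sum nth_subst_mult[OF Xo order_refl])
  have vanish: "mfps_nth (pw X \<gamma> * G i $ j) \<alpha> = 0" if "wt i \<gamma> \<noteq> mdeg \<alpha>" "i < I" for i \<gamma> j \<alpha>
    using homD[OF hom_mult[OF hom_pw[where w = w and \<Phi> = X, OF X] G[OF that(2)]]] that(1) by (simp add: wt_def)
  have "Y $ j = (lin_part A + (\<Sum>i<I. mfps_subst (f i) X *s G i)) $ j" for j
  proof (rule mfps_eqI)
    fix \<alpha> :: "6 \<Rightarrow> nat"
    define k where "k = mdeg \<alpha>"
    show "mfps_nth (Y $ j) \<alpha> = mfps_nth ((lin_part A + (\<Sum>i<I. mfps_subst (f i) X *s G i)) $ j) \<alpha>"
    proof (cases "k \<ge> 2")
      case True
      have "mfps_nth ((\<Sum>i<I. mfps_subst (f i) X *s G i) $ j) \<alpha>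
          = mfps_nth ((\<Sum>i<I. mfps_subst (F k i) X *s G i) $ j) \<alpha>"
        unfolding expand
      proof (intro sum.cong refl)
        fix i \<gamma> assume "i \<in> {..<I}"
        then show "mfps_nth (f i) \<gamma> * mfps_nth (pw X \<gamma> * G i $ j) \<alpha>
            = mfps_nth (F k i) \<gamma> * mfps_nth (pw X \<gamma> * G i $ j) \<alpha>"
          using vanish[of i \<gamma> \<alpha> j] True by (cases "wt i \<gamma> = k") (auto simp: f_nth k_def)
      qed
      also have "\<dots> = mfps_nth (Y $ j) \<alpha>"
        unfolding F[OF True, symmetric] by (simp add: nth_vpart k_def)
      moreover have "mfps_nth (lin_part A $ j) \<alpha> = 0"
      proof -
        have "homogeneous 1 (lin_part A $ j)"
          unfolding lin_part_def by (auto intro!: hom_sum hom_scaleR hom_mono)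
        then show ?thesis using homD[of 1 _ \<alpha>] True by (simp add: k_def)
      qed
      ultimately show ?thesis by simp
    next
      case False
      have "mfps_nth ((\<Sum>i<I. mfps_subst (f i) X *s G i) $ j) \<alpha> = 0"
        unfolding expand
      proof (intro sum.neutral ballI)
        fix i \<gamma> assume "i \<in> {..<I}"
        then show "mfps_nth (f i) \<gamma> * mfps_nth (pw X \<gamma> * G i $ j) \<alpha> = 0"
          using vanish[of i \<gamma> \<alpha> j] False by (cases "wt i \<gamma> = k") (auto simp: f_nth k_def)
      qed
      moreover have "mfps_nth ((Y - lin_part A) $ j) \<alpha> = 0"
        using Y[of j] False by (auto simp: ord_ge_iff k_def)
      ultimately show ?thesis by simp
    qed
  qed
  then show ?thesis
    by (intro exI[of _ f]) (simp add: vec_eq_iff)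
qed

section \<open>Application to the reversible field\<close>

lemma vpar_prod_signs:
  assumes "vpar \<epsilon>1 1 v" "vpar \<epsilon>2 1 v"
  shows "vpar (\<lambda>i. \<epsilon>1 i * \<epsilon>2 i) 1 v"
proof -
  have "sgn_pow (\<lambda>i. \<epsilon>1 i * \<epsilon>2 i) \<alpha> = sgn_pow \<epsilon>1 \<alpha> * sgn_pow \<epsilon>2 \<alpha>" for \<alpha>
    by (simp add: sgn_pow_def power_mult_distrib prod.distrib)
  with assms show ?thesis
    by (auto simp: vpar_def par_def supported_def)
qed

lemma phi_eq: "phi x = (\<chi> j. sg_phi j * x $ j)"
  by (simp add: vec_eq_iff forall_6 phi_def pack_def z1_def z2_def)

lemma psi_eq: "psi a0 a1 a2 x = (\<chi> j. (sg_phi j * sg_chi a0 a1 a2 j) * x $ j)"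
  by (simp add: vec_eq_iff forall_6 psi_def pack_def z1_def z2_def)

context reversible_resonance
begin

text \<open>The coefficient series are fixed before the target field: F is conjugate to every field
  with the resulting Taylor series, which separates the formal argument from the choice of smooth
  coefficients.\<close>

lemma formal_conjugacy:
  fixes F :: "real^6 \<Rightarrow> real^6" and X :: "'m::finite \<Rightarrow> 6 mfps"
  assumes F: "smooth_on UNIV F" "F 0 = 0" "(F has_derivative (\<lambda>v. L_matrix w1 w2 *v v)) (at 0)"
      "reversing phi F" "reversing (psi a0 a1 a2) F"
    and gens: "complete_gens X G I"
    and X: "\<And>j. homogeneous (w j) (X j)" and w: "\<And>j. w j \<ge> 1"
    and G: "\<And>i j. i < I \<Longrightarrow> homogeneous (o' i) (G i $ j)"
  shows "\<exists>f. \<forall>Y. (\<forall>j. taylor_map Y j = (lin_part (L_matrix w1 w2) + (\<Sum>i<I. mfps_subst (f i) X *s G i)) $ j)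
    \<longrightarrow> formally_conjugate {phi, psi a0 a1 a2} F Y"
proof -
  define T where "T = (\<chi> i. taylor_map F i)"
  have T_nth: "T $ i = taylor (\<lambda>x. F x $ i)" for i
    by (simp add: T_def taylor_map_def)
  have T0: "mfps_nth (T $ i) 0 = 0" for i
    by (simp add: T_nth nth_taylor_0 F(2))
  have T1: "mfps_nth (T $ i) (unit_idx j) = L_matrix w1 w2 $ i $ j" for i j
  proof -
    have "((\<lambda>x. F x $ i) has_derivative (\<lambda>v. (L_matrix w1 w2 *v v) $ i)) (at 0)"
      by (rule bounded_linear.has_derivative[OF bounded_linear_vec_nth F(3)])
    from frechet_derivative_at[OF this]
    have "partial j (\<lambda>x. F x $ i) 0 = (L_matrix w1 w2 *v axis j 1) $ i"
      by (metis partial_def)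
    also have "\<dots> = (\<Sum>l\<in>UNIV. if l = j then L_matrix w1 w2 $ i $ l else 0)"
      unfolding matrix_vector_mult_def vec_lambda_beta by (rule sum.cong) (auto simp: axis_def)
    finally show ?thesis by (simp add: T_nth nth_taylor_unit)
  qed
  have Tphi: "vpar sg_phi (-1) T"
    unfolding vpar_def T_nth
  proof
    fix i
    have "F (\<chi> j. sg_phi j * x $ j) = - (\<chi> j. sg_phi j * F x $ j)" for x
      using F(4) unfolding reversing_def phi_eq by blast
    then show "par sg_phi (-1 * sg_phi i) (taylor (\<lambda>x. F x $ i))"
      by (intro par_taylor smooth_on_vec_nth F(1)) (simp_all add: sg_phi_square)
  qed
  have Tchi: "vpar chi 1 T"
    unfolding vpar_def T_nth
  proof
    fix i
    \<comment> \<open>The signs of two reversals cancel, so F commutes with the composite.\<close>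
    have "F (psi a0 a1 a2 (phi x)) = psi a0 a1 a2 (phi (F x))" for x
    proof -
      have "psi a0 a1 a2 (- y) = - psi a0 a1 a2 y" for y
        by (simp add: psi_eq vec_eq_iff)
      then show ?thesis
        using F(4,5) unfolding reversing_def by simp
    qed
    moreover have "psi a0 a1 a2 (phi x) = (\<chi> j. chi j * x $ j)" for x
    proof -
      have "sg_phi j * chi j * (sg_phi j * x $ j) = (sg_phi j * sg_phi j) * (chi j * x $ j)" for j
        by (simp only: mult_ac)
      then have "sg_phi j * chi j * (sg_phi j * x $ j) = chi j * x $ j" for j
        by (simp only: sg_phi_square mult_1)
      then show ?thesis
        unfolding phi_eq psi_eq vec_lambda_beta by (simp only:)
    qed
    ultimately have "F (\<chi> j. chi j * x $ j) = (\<chi> j. chi j * F x $ j)" for x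
      by metis
    then show "par chi (1 * chi i) (taylor (\<lambda>x. F x $ i))"
      by (intro par_taylor smooth_on_vec_nth F(1)) (simp_all add: chi_square)
  qed
  obtain \<Phi> Y where \<Phi>: "\<And>i. ord_ge 2 ((\<Phi> - mfps_X_vec) $ i)" "vpar sg_phi 1 \<Phi>" "vpar chi 1 \<Phi>"
    and Y: "\<And>i. ord_ge 2 ((Y - lin_part (L_matrix w1 w2)) $ i)" "\<And>k. k \<ge> 2 \<Longrightarrow> vpart k Y \<in> Mset X G I"
    and err: "conj_error T \<Phi> Y = 0"
    using formal_normal_form[OF sg_phi_square chi_square T0 T1 Tphi Tchi, of "Mset X G I"] decompose[OF gens]
    by blast
  obtain f where f: "Y = lin_part (L_matrix w1 w2) + (\<Sum>i<I. mfps_subst (f i) X *s G i)"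
    using glue_homogeneous_parts[OF X w G Y] by blast
  have change: "formal_change_of_coordinates {phi, psi a0 a1 a2} (($) \<Phi>)"
  proof (rule formal_change_of_coordinatesI[OF \<Phi>(1)])
    \<comment> \<open>The entries of psi are the products of the signs of phi and of psi composed
      with phi, both of which \<Phi> respects.\<close>
    fix \<gamma> assume "\<gamma> \<in> {phi, psi a0 a1 a2}"
    then show "\<exists>\<delta>. vpar \<delta> 1 \<Phi> \<and> (\<forall>x. \<gamma> x = (\<chi> i. \<delta> i * x $ i))"
      using \<Phi>(2,3) vpar_prod_signs[OF \<Phi>(2,3)] phi_eq psi_eq by blast
  qed
  have "formally_conjugate {phi, psi a0 a1 a2} F Y'"
    if "\<And>j. taylor_map Y' j = (lin_part (L_matrix w1 w2) + (\<Sum>i<I. mfps_subst (f i) X *s G i)) $ j" for Y'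
    unfolding formally_conjugate_def
  proof (intro exI[of _ "($) \<Phi>"] conjI allI change)
    fix i
    have "conj_error T \<Phi> Y $ i = 0" using err by simp
    then show "(\<Sum>j\<in>UNIV. mfps_deriv j (\<Phi> $ i) * taylor_map Y' j) = mfps_subst (taylor_map F i) (($) \<Phi>)"
      unfolding that f[symmetric] by (simp add: conj_error_def T_def)
  qed
  then show ?thesis by blast
qed

definition gen_of :: "(nat \<times> nat \<times> nat \<times> nat) list \<Rightarrow> nat \<Rightarrow> 6 mfps^6" where
  "gen_of t l = (case t ! l of (a, d, e, i) \<Rightarrow> inv_monom n1 n2 a 0 0 d e *s base_field n1 n2 i)"

lemma gen_of_hom:
  assumes "\<forall>(a, d, e, i) \<in> set t. i \<le> 9" "l < length t"
  shows "\<exists>o'. \<forall>j. homogeneous o' (gen_of t l $ j)"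
proof -
  obtain a d e i where t: "t ! l = (a, d, e, i)" by (metis prod_cases4)
  then have "i \<le> 9" using assms nth_mem[of l t] by fastforce
  then show ?thesis
    using hom_mult[OF Pm_grading(1) Vf_grading(1)] unfolding gen_of_def t by fastforce
qed

text \<open>Membership reduces to splitting the invariant monomial into a power product of X and a
  remainder that the list contains together with the same base field.\<close>

lemma gen_of_Mset:
  assumes "\<And>j. ord_ge 1 (X j)" "(a', d', e, i) \<in> set t"
    and "inv_monom n1 n2 a b c d e = pw X \<gamma> * inv_monom n1 n2 a' 0 0 d' e"
  shows "inv_monom n1 n2 a b c d e *s base_field n1 n2 i \<in> Mset X (gen_of t) (length t)"
proof -
  obtain l where l: "l < length t" "t ! l = (a', d', e, i)"
    using assms(2) by (metis in_set_conv_nth)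
  have "inv_monom n1 n2 a b c d e *s base_field n1 n2 i = pw X \<gamma> *s gen_of t l"
    by (simp add: assms(3) gen_of_def l(2) vector_smult_assoc)
  then show ?thesis
    using pw_Mset[OF assms(1) l(1)] by simp
qed

end

section \<open>The four types\<close>

lemma vector_4 [simp]:
  fixes a b c d :: "'a::zero"
  shows "(vector [a, b, c, d] :: 'a^4) $ 1 = a"
    and "(vector [a, b, c, d] :: 'a^4) $ 2 = b"
    and "(vector [a, b, c, d] :: 'a^4) $ 3 = c"
    and "(vector [a, b, c, d] :: 'a^4) $ 4 = d"
  by (simp_all add: vector_def)

lemma vector_5 [simp]:
  fixes a b c d e :: "'a::zero"
  shows "(vector [a, b, c, d, e] :: 'a^5) $ 1 = a"
    and "(vector [a, b, c, d, e] :: 'a^5) $ 2 = b"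
    and "(vector [a, b, c, d, e] :: 'a^5) $ 3 = c"
    and "(vector [a, b, c, d, e] :: 'a^5) $ 4 = d"
    and "(vector [a, b, c, d, e] :: 'a^5) $ 5 = e"
  by (simp_all add: vector_def)

lemma exhaust_5: "(x = 1 \<or> x = 2 \<or> x = 3 \<or> x = 4 \<or> x = 5)" for x :: 5
proof (induct x)
  case (of_int z)
  hence "z = 0 \<or> z = 1 \<or> z = 2 \<or> z = 3 \<or> z = 4" by simp presburger
  thus ?case by auto
qed

lemma forall_5: "(\<forall>i::5. P i) \<longleftrightarrow> P 1 \<and> P 2 \<and> P 3 \<and> P 4 \<and> P 5"
  by (metis exhaust_5)

lemma UNIV_5: "(UNIV :: 5 set) = {1, 2, 3, 4, 5}"
  using exhaust_5 by auto

lemma pw_vector_4: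
  "pw (($) (vector [p, q, r, s] :: ('n::finite mfps)^4)) (($) (vector [a, b, c, d] :: nat^4)) = p ^ a * q ^ b * r ^ c * s ^ d"
  unfolding pw_def UNIV_4 by (subst prod.insert, simp, simp)+ (simp add: mult.assoc)

lemma pw_vector_5:
  "pw (($) (vector [p, q, r, s, t] :: ('n::finite mfps)^5)) (($) (vector [a, b, c, d, e] :: nat^5))
     = p ^ a * q ^ b * r ^ c * s ^ d * t ^ e"
  unfolding pw_def UNIV_5 by (subst prod.insert, simp, simp)+ (simp add: mult.assoc)

context reversible_resonance
begin

definition "XA = ($) (vector [mfps_X 1, N1, N2, rho_s n1 n2] :: (6 mfps)^4)"
definition "XB = ($) (vector [mfps_X 1, N1, N2, rho_s n1 n2 ^ 2] :: (6 mfps)^4)"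
definition "XC = ($) (vector [mfps_X 1 ^ 2, N1, N2, rho_s n1 n2] :: (6 mfps)^4)"
definition "XD = ($) (vector [mfps_X 1 ^ 2, N1, N2, rho_s n1 n2 ^ 2, mfps_X 1 * rho_s n1 n2] :: (6 mfps)^5)"

lemma invariants_hom:
  "homogeneous 1 (mfps_X (1 :: 6))" "homogeneous 2 (mfps_X (1 :: 6) ^ 2)" "homogeneous 2 N1" "homogeneous 2 N2"
  "homogeneous (n1 + n2) (rho_s n1 n2)" "homogeneous (2 * (n1 + n2)) (rho_s n1 n2 ^ 2)"
  "homogeneous (1 + (n1 + n2)) (mfps_X 1 * rho_s n1 n2)"
proof -
  show "homogeneous 1 (mfps_X (1 :: 6))" "homogeneous 2 N1" "homogeneous 2 N2" "homogeneous (n1 + n2) (rho_s n1 n2)"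
    using Pm_grading(1)[of 1 0 0 0 0] Pm_grading(1)[of 0 1 0 0 0] Pm_grading(1)[of 0 0 1 0 0] Pm_grading(1)[of 0 0 0 1 0]
    by (simp_all add: inv_monom_def numeral_2_eq_2)
  then show "homogeneous 2 (mfps_X (1 :: 6) ^ 2)" "homogeneous (2 * (n1 + n2)) (rho_s n1 n2 ^ 2)" "homogeneous (1 + (n1 + n2)) (mfps_X 1 * rho_s n1 n2)"
    using hom_power[of 1 "mfps_X (1 :: 6)" 2] hom_power[of "n1 + n2" "rho_s n1 n2" 2]
      hom_mult[of 1 "mfps_X (1 :: 6)" "n1 + n2" "rho_s n1 n2"] by simp_all
qed

lemma XA_hom: "\<exists>w. (\<forall>j. homogeneous (w j) (XA j)) \<and> (\<forall>j. w j \<ge> 1)"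
  using n1 invariants_hom by (intro exI[of _ "($) (vector [1, 2, 2, n1 + n2] :: nat^4)"])
    (simp add: XA_def forall_4)

lemma XB_hom: "\<exists>w. (\<forall>j. homogeneous (w j) (XB j)) \<and> (\<forall>j. w j \<ge> 1)"
  using n1 invariants_hom by (intro exI[of _ "($) (vector [1, 2, 2, 2 * (n1 + n2)] :: nat^4)"])
    (simp add: XB_def forall_4)

lemma XC_hom: "\<exists>w. (\<forall>j. homogeneous (w j) (XC j)) \<and> (\<forall>j. w j \<ge> 1)"
  using n1 invariants_hom by (intro exI[of _ "($) (vector [2, 2, 2, n1 + n2] :: nat^4)"])
    (simp add: XC_def forall_4)

lemma XD_hom: "\<exists>w. (\<forall>j. homogeneous (w j) (XD j)) \<and> (\<forall>j. w j \<ge> 1)"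
  using n1 invariants_hom by (intro exI[of _ "($) (vector [2, 2, 2, 2 * (n1 + n2), 1 + (n1 + n2)] :: nat^5)"])
    (simp add: XD_def forall_5)

lemma ord_ge_invariants: "ord_ge 1 (XA j)" "ord_ge 1 (XB j)" "ord_ge 1 (XC j)" "ord_ge 1 (XD k)"
  using XA_hom XB_hom XC_hom XD_hom hom_imp_ord_ge by blast+

text \<open>Division by 2 with remainder, in the exponents of those invariants that occur squared.
  In type D two remainders 1 combine into \<open>mfps_X 1 * rho_s n1 n2\<close>, hence the last
  equation.\<close>

lemma Pm_eq_pw:
  "inv_monom n1 n2 a b c d e = pw XA (($) (vector [a, b, c, d] :: nat^4)) * inv_monom n1 n2 0 0 0 0 e"
  "inv_monom n1 n2 a b c (2 * p + d') e = pw XB (($) (vector [a, b, c, p] :: nat^4)) * inv_monom n1 n2 0 0 0 d' e"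
  "inv_monom n1 n2 (2 * m + a') b c d e = pw XC (($) (vector [m, b, c, d] :: nat^4)) * inv_monom n1 n2 a' 0 0 0 e"
  "inv_monom n1 n2 (2 * m + a') b c (2 * p + d') e = pw XD (($) (vector [m, b, c, p, 0] :: nat^5)) * inv_monom n1 n2 a' 0 0 d' e"
  "inv_monom n1 n2 (2 * m + 1) b c (2 * p + 1) e = pw XD (($) (vector [m, b, c, p, 1] :: nat^5)) * inv_monom n1 n2 0 0 0 0 e"
  unfolding XA_def XB_def XC_def XD_def pw_vector_4 pw_vector_5 inv_monom_def
  by (simp_all add: power_add power_mult_distrib mult_ac flip: power_mult)

text \<open>
  An entry \<open>(a, d, e, i)\<close> stands for \<open>x\<^sub>1\<^sup>a \<rho>\<^sup>d \<iota>\<^sup>e\<close> times \<open>base_field n1 n2 i\<close>; the \<open>l\<close>-th entry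
  multiplies \<open>f l\<close> in the normal form.
\<close>
definition gensA :: "(nat \<times> nat \<times> nat \<times> nat) list" where
  "gensA = [(0,0,1,0), (0,0,0,1), (0,0,0,2), (0,0,0,3), (0,0,1,4), (0,0,1,5),
            (0,0,0,6), (0,0,0,7), (0,0,1,8), (0,0,1,9)]"
definition gensB :: "(nat \<times> nat \<times> nat \<times> nat) list" where
  "gensB = [(0,1,1,0), (0,0,0,1), (0,0,0,2), (0,0,1,5), (0,1,0,3), (0,1,1,4),
            (0,0,0,6), (0,0,1,9), (0,1,0,7), (0,1,1,8)]"
definition gensC :: "(nat \<times> nat \<times> nat \<times> nat) list" where
  "gensC = [(0,0,1,0), (1,0,0,1), (0,0,0,2), (0,0,0,3), (0,0,1,4), (0,0,1,5),
            (0,0,0,6), (0,0,0,7), (0,0,1,8), (0,0,1,9)]"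
definition gensD :: "(nat \<times> nat \<times> nat \<times> nat) list" where
  "gensD = [(1,0,1,0), (0,1,1,0), (1,0,0,1), (0,1,0,1),
            (0,0,0,2), (0,0,1,5), (1,0,0,3), (1,0,1,4), (0,1,0,3), (0,1,1,4),
            (0,0,0,6), (0,0,1,9), (1,0,0,7), (1,0,1,8), (0,1,0,7), (0,1,1,8)]"

lemma length_gens: "length gensA = 10" "length gensB = 10" "length gensC = 10" "length gensD = 16"
  by (simp_all add: gensA_def gensB_def gensC_def gensD_def)

lemma phiV_chiV:
  "phiV 0 = 1" "phiV 1 = -1" "phiV (Suc 0) = -1" "phiV 2 = -1" "phiV 3 = -1" "phiV 4 = 1" "phiV 5 = 1"
  "phiV 6 = -1" "phiV 7 = -1" "phiV 8 = 1" "phiV 9 = 1"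
  "chiV 0 = 1" "chiV 1 = a0" "chiV (Suc 0) = a0" "chiV 2 = 1" "chiV 3 = sW" "chiV 4 = 1" "chiV 5 = sW"
  "chiV 6 = 1" "chiV 7 = sW" "chiV 8 = 1" "chiV 9 = sW"
  by (simp_all add: phiV_def chiV_def numeral_eq_Suc)

text \<open>With both signs 1 the second condition holds for every term. Phi alone decides, by
  demanding a factor \<open>iota_s\<close> exactly on the fields with
  \<open>phiV i = 1\<close>.\<close>

lemma complete_gensA:
  assumes "a0 = 1" "sW = 1"
  shows "complete_gens XA (gen_of gensA) 10"
  unfolding complete_gens_def
proof (intro allI impI)
  fix a b c d e i :: nat
  assume e: "e \<le> 1" and i: "i \<le> 9" and p: "(-1) ^ e * phiV i = -1" and q: "a0 ^ a * sW ^ (d + e) * chiV i = 1"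
  have e01: "e = 0 \<or> e = 1" using e by auto
  have "(0, 0, e, i) \<in> set gensA"
    using le_9_cases[OF i] e01 p by (elim disjE; simp add: phiV_chiV gensA_def; simp add: assms)
  from gen_of_Mset[OF ord_ge_invariants(1) this Pm_eq_pw(1)]
  show "inv_monom n1 n2 a b c d e *s base_field n1 n2 i \<in> Mset XA (gen_of gensA) 10"
    by (simp add: length_gens)
qed

text \<open>Now \<open>rho_s\<close>, \<open>iota_s\<close> and the \<open>U\<close> fields change
  sign, so the parity of d is determined by e and i and becomes part of the generator.\<close>

lemma complete_gensB:
  assumes "a0 = 1" "sW = -1"
  shows "complete_gens XB (gen_of gensB) 10"
  unfolding complete_gens_def
proof (intro allI impI)
  fix a b c d e i :: nat
  assume e: "e \<le> 1" and i: "i \<le> 9" and p: "(-1) ^ e * phiV i = -1" and q: "a0 ^ a * sW ^ (d + e) * chiV i = 1"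
  have e01: "e = 0 \<or> e = 1" using e by auto
  define d' where "d' = d mod 2"
  have d: "d = 2 * (d div 2) + d'" "d' = 0 \<or> d' = 1"
    by (auto simp: d'_def)
  have "(-1 :: real) ^ (2 * (d div 2) + d') = (-1) ^ d'"
    by (simp add: power_add)
  then have "(-1 :: real) ^ d = (-1) ^ d'"
    by (simp only: d(1)[symmetric])
  then have "(-1) ^ d' * (-1) ^ e * chiV i = (1 :: real)"
    using q assms by (simp add: power_add)
  then have "(0, d', e, i) \<in> set gensB"
    using le_9_cases[OF i] e01 d(2) p by (elim disjE; simp add: phiV_chiV gensB_def; simp add: assms)
  from gen_of_Mset[OF ord_ge_invariants(2) this Pm_eq_pw(2), of a b c "d div 2"]
  show "inv_monom n1 n2 a b c d e *s base_field n1 n2 i \<in> Mset XB (gen_of gensB) 10"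
    unfolding d(1)[symmetric] by (simp add: length_gens)
qed

text \<open>Only x1 and x2 change sign here, so the exponent a is even except on the constant field
  \<open>base_field n1 n2 1\<close>, which needs a factor x1.\<close>

lemma complete_gensC:
  assumes "a0 = -1" "sW = 1"
  shows "complete_gens XC (gen_of gensC) 10"
  unfolding complete_gens_def
proof (intro allI impI)
  fix a b c d e i :: nat
  assume e: "e \<le> 1" and i: "i \<le> 9" and p: "(-1) ^ e * phiV i = -1" and q: "a0 ^ a * sW ^ (d + e) * chiV i = 1"
  have e01: "e = 0 \<or> e = 1" using e by auto
  define a' where "a' = a mod 2"
  have a: "a = 2 * (a div 2) + a'" "a' = 0 \<or> a' = 1"
    by (auto simp: a'_def)
  have "(-1 :: real) ^ (2 * (a div 2) + a') = (-1) ^ a'"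
    by (simp add: power_add)
  then have "(-1 :: real) ^ a = (-1) ^ a'"
    by (simp only: a(1)[symmetric])
  then have "(-1) ^ a' * chiV i = (1 :: real)"
    using q assms by simp
  then have "(a', 0, e, i) \<in> set gensC"
    using le_9_cases[OF i] e01 a(2) p by (elim disjE; simp add: phiV_chiV gensC_def; simp add: assms)
  from gen_of_Mset[OF ord_ge_invariants(3) this Pm_eq_pw(3), of "a div 2" b c d]
  show "inv_monom n1 n2 a b c d e *s base_field n1 n2 i \<in> Mset XC (gen_of gensC) 10"
    unfolding a(1)[symmetric] by (simp add: length_gens)
qed

lemma complete_gensD:
  assumes "a0 = -1" "sW = -1"
  shows "complete_gens XD (gen_of gensD) 16"
  unfolding complete_gens_def
proof (intro allI impI)
  fix a b c d e i :: nat
  assume e: "e \<le> 1" and i: "i \<le> 9" and p: "(-1) ^ e * phiV i = -1" and q: "a0 ^ a * sW ^ (d + e) * chiV i = 1"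
  have e01: "e = 0 \<or> e = 1" using e by auto
  define a' d' where "a' = a mod 2" and "d' = d mod 2"
  have a: "a = 2 * (a div 2) + a'" "a' = 0 \<or> a' = 1" and d: "d = 2 * (d div 2) + d'" "d' = 0 \<or> d' = 1"
    by (auto simp: a'_def d'_def)
  have "(-1 :: real) ^ (2 * (a div 2) + a') = (-1) ^ a'" "(-1 :: real) ^ (2 * (d div 2) + d') = (-1) ^ d'"
    by (simp_all add: power_add)
  then have 1: "(-1 :: real) ^ a = (-1) ^ a'" "(-1 :: real) ^ d = (-1) ^ d'"
    by (simp_all only: a(1)[symmetric] d(1)[symmetric])
  have s: "(-1) ^ a' * (-1) ^ d' * (-1) ^ e * chiV i = (1 :: real)"
    using q assms 1 by (simp add: power_add mult.assoc)
  show "inv_monom n1 n2 a b c d e *s base_field n1 n2 i \<in> Mset XD (gen_of gensD) 16"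
  \<comment> \<open>If both remainders are 1, their product is the fifth invariant and the generator
    is free of x1 and rho; otherwise the remainder belongs to the generator.\<close>
  proof (cases "a' = 1 \<and> d' = 1")
    case True
    then have "(0, 0, e, i) \<in> set gensD"
      using le_9_cases[OF i] e01 p s by (elim disjE; simp add: phiV_chiV gensD_def; simp add: assms)
    from gen_of_Mset[OF ord_ge_invariants(4) this Pm_eq_pw(5), of "a div 2" b c "d div 2"]
    show ?thesis
      using a(1) d(1) True by (simp add: length_gens)
  next
    case False
    then have "(a', d', e, i) \<in> set gensD"
      using le_9_cases[OF i] e01 a(2) d(2) p s by (elim disjE; simp add: phiV_chiV gensD_def; simp add: assms)
    from gen_of_Mset[OF ord_ge_invariants(4) this Pm_eq_pw(4), of "a div 2" b c "d div 2"]
    show ?thesis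
      unfolding a(1)[symmetric] d(1)[symmetric] by (simp add: length_gens)
  qed
qed

end

section \<open>Jets of real and complex expressions\<close>

lemma has_jet_intros:
  "has_jet (\<lambda>x. c) (of_real c)" "has_jet (\<lambda>x. x $ i) (mfps_X i)"
  "has_jet f s \<Longrightarrow> has_jet g t \<Longrightarrow> has_jet (\<lambda>x. f x + g x) (s + t)"
  "has_jet f s \<Longrightarrow> has_jet g t \<Longrightarrow> has_jet (\<lambda>x. f x - g x) (s - t)"
  "has_jet f s \<Longrightarrow> has_jet g t \<Longrightarrow> has_jet (\<lambda>x. f x * g x) (s * t)"
  "has_jet f s \<Longrightarrow> has_jet (\<lambda>x. - f x) (- s)"
  "has_jet f s \<Longrightarrow> has_jet (\<lambda>x. f x ^ n) (s ^ n)"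
  unfolding has_jet_def
  by (auto intro: jet_const jet_coord jet_add jet_diff jet_mult jet_uminus jet_power)

definition cjet :: "(real^'n::finite \<Rightarrow> complex) \<Rightarrow> 'n mfps cx \<Rightarrow> bool" where
  "cjet g S \<longleftrightarrow> has_jet (\<lambda>x. Re (g x)) (cre S) \<and> has_jet (\<lambda>x. Im (g x)) (cim S)"

lemma cjet_intros:
  "cjet (\<lambda>x. c) (cconst c)"
  "has_jet f s \<Longrightarrow> cjet (\<lambda>x. complex_of_real (f x)) (creal s)"
  "cjet g S \<Longrightarrow> cjet h T \<Longrightarrow> cjet (\<lambda>x. g x + h x) (S + T)"
  "cjet g S \<Longrightarrow> cjet h T \<Longrightarrow> cjet (\<lambda>x. g x * h x) (S * T)"
  "cjet g S \<Longrightarrow> cjet (\<lambda>x. cnj (g x)) (cx_cnj S)"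
  using has_jet_intros(1)[of 0]
  by (auto simp: cjet_def intro!: has_jet_intros)

lemma cjet_power: "cjet g S \<Longrightarrow> cjet (\<lambda>x. g x ^ n) (S ^ n)"
  using cjet_intros(1)[of 1] by (induction n) (auto intro: cjet_intros)

lemma cjet_z: "cjet z1 Z1" "cjet z2 Z2"
  by (auto simp: cjet_def z1_def z2_def Z1_def Z2_def intro: has_jet_intros)

lemma cjet_u:
  "cjet (\<lambda>x. cnj (z1 x) ^ (n2 - 1) * z2 x ^ n1) (U1 n1 n2)"
  "cjet (\<lambda>x. z1 x ^ n2 * cnj (z2 x) ^ (n1 - 1)) (U2 n1 n2)"
  unfolding U1_def U2_def by (intro cjet_intros cjet_power cjet_z)+

lemma has_jet_invariants:
  "has_jet (rho n1 n2) (rho_s n1 n2)" "has_jet (iota n1 n2) (iota_s n1 n2)"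
  "has_jet (\<lambda>x. (cmod (z1 x))\<^sup>2) N1" "has_jet (\<lambda>x. (cmod (z2 x))\<^sup>2) N2"
proof -
  have "cjet (\<lambda>x. z1 x ^ n2 * cnj (z2 x) ^ n1) (WW n1 n2)"
    unfolding WW_def by (intro cjet_intros cjet_power cjet_z)
  then show "has_jet (rho n1 n2) (rho_s n1 n2)" "has_jet (iota n1 n2) (iota_s n1 n2)"
    unfolding cjet_def rho_def[abs_def] iota_def[abs_def] rho_s_def iota_s_def by blast+
  show "has_jet (\<lambda>x. (cmod (z1 x))\<^sup>2) N1" "has_jet (\<lambda>x. (cmod (z2 x))\<^sup>2) N2"
    unfolding cmod_power2 z1_def z2_def N1_def N2_def complex.sel unfolding power2_eq_square
    by (intro has_jet_intros)+
qed

lemma has_jet_compose: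
  fixes p :: "real^'n::finite \<Rightarrow> real^'m::finite"
  assumes "has_jet g s" "\<And>j. has_jet (\<lambda>x. p x $ j) (\<Phi> j)" "\<And>j. ord_ge 1 (\<Phi> j)"
  shows "has_jet (\<lambda>x. g (p x)) (mfps_subst s \<Phi>)"
proof -
  have "jet n (\<lambda>x. g (\<chi> j. p x $ j)) (mfps_subst s \<Phi>)" for n
    using assms unfolding has_jet_def by (intro jet_compose) auto
  then show ?thesis by (simp add: has_jet_def)
qed

lemma taylor_map_pack:
  assumes "has_jet p s" "has_jet q t" "cjet g S" "cjet h T"
  shows "taylor_map (\<lambda>x. pack (p x) (q x) (g x) (h x)) j = (emb0 (creal s) (creal t) + emb1 S + emb2 T) $ j"
proof -
  have "taylor_map (\<lambda>x. pack (p x) (q x) (g x) (h x)) j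
      = (vector [taylor p, taylor q, taylor (\<lambda>x. Re (g x)), taylor (\<lambda>x. Im (g x)),
         taylor (\<lambda>x. Re (h x)), taylor (\<lambda>x. Im (h x))] :: 6 mfps^6) $ j"
    using exhaust_6[of j] by (auto simp: taylor_map_def pack_def)
  also have "\<dots> = (emb0 (creal s) (creal t) + emb1 S + emb2 T) $ j"
    using assms exhaust_6[of j] unfolding cjet_def
    by (auto simp: taylor_has_jet emb0_def emb1_def emb2_def)
  finally show ?thesis .
qed

section \<open>Taylor series of the four normal forms\<close>

context reversible_resonance
begin

lemma has_jet_XA:
  assumes "has_jet g s"
  shows "has_jet (\<lambda>x. g (vector [x $ 1, (cmod (z1 x))\<^sup>2, (cmod (z2 x))\<^sup>2, rho n1 n2 x])) (mfps_subst s XA)"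
proof (rule has_jet_compose[OF assms _ ord_ge_invariants(1)])
  fix j
  show "has_jet (\<lambda>x. (vector [x $ 1, (cmod (z1 x))\<^sup>2, (cmod (z2 x))\<^sup>2, rho n1 n2 x] :: real^4) $ j) (XA j)"
    using exhaust_4[of j] by (auto simp: XA_def intro!: has_jet_intros(2,5,7) has_jet_invariants)
qed

lemma has_jet_XB:
  assumes "has_jet g s"
  shows "has_jet (\<lambda>x. g (vector [x $ 1, (cmod (z1 x))\<^sup>2, (cmod (z2 x))\<^sup>2, (rho n1 n2 x)\<^sup>2])) (mfps_subst s XB)"
proof (rule has_jet_compose[OF assms _ ord_ge_invariants(2)])
  fix j
  show "has_jet (\<lambda>x. (vector [x $ 1, (cmod (z1 x))\<^sup>2, (cmod (z2 x))\<^sup>2, (rho n1 n2 x)\<^sup>2] :: real^4) $ j) (XB j)"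
    using exhaust_4[of j] by (auto simp: XB_def intro!: has_jet_intros(2,5,7) has_jet_invariants)
qed

lemma has_jet_XC:
  assumes "has_jet g s"
  shows "has_jet (\<lambda>x. g (vector [(x $ 1)\<^sup>2, (cmod (z1 x))\<^sup>2, (cmod (z2 x))\<^sup>2, rho n1 n2 x])) (mfps_subst s XC)"
proof (rule has_jet_compose[OF assms _ ord_ge_invariants(3)])
  fix j
  show "has_jet (\<lambda>x. (vector [(x $ 1)\<^sup>2, (cmod (z1 x))\<^sup>2, (cmod (z2 x))\<^sup>2, rho n1 n2 x] :: real^4) $ j) (XC j)"
    using exhaust_4[of j] by (auto simp: XC_def intro!: has_jet_intros(2,5,7) has_jet_invariants)
qed

lemma has_jet_XD:
  assumes "has_jet g s"
  shows "has_jet (\<lambda>x. g (vector [(x $ 1)\<^sup>2, (cmod (z1 x))\<^sup>2, (cmod (z2 x))\<^sup>2, (rho n1 n2 x)\<^sup>2, x $ 1 * rho n1 n2 x]))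
    (mfps_subst s XD)"
proof (rule has_jet_compose[OF assms _ ord_ge_invariants(4)])
  fix j
  show "has_jet (\<lambda>x. (vector [(x $ 1)\<^sup>2, (cmod (z1 x))\<^sup>2, (cmod (z2 x))\<^sup>2, (rho n1 n2 x)\<^sup>2, x $ 1 * rho n1 n2 x] :: real^5) $ j) (XD j)"
    using exhaust_5[of j] by (auto simp: XD_def intro!: has_jet_intros(2,5,7) has_jet_invariants)
qed

lemma lin_part_emb:
  "lin_part (L_matrix w1 w2) = emb0 X2 0 + emb1 (cconst (- \<i> * w1) * Z1) + emb2 (cconst (- \<i> * w2) * Z2)"
  by (simp add: vec_eq_iff forall_6 lin_part_L emb0_def emb1_def emb2_def X2_def Z1_def Z2_def scaleR_conv_of_real)

lemma smult_emb:
  "s *s emb1 g = emb1 (creal s * g)" "s *s emb2 g = emb2 (creal s * g)"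
  by (simp_all add: vec_eq_iff forall_6 emb0_def emb1_def emb2_def)

lemma Pm_small:
  "inv_monom n1 n2 0 0 0 0 0 = 1" "inv_monom n1 n2 0 0 0 0 (Suc 0) = iota_s n1 n2" "inv_monom n1 n2 0 0 0 (Suc 0) 0 = rho_s n1 n2"
  "inv_monom n1 n2 0 0 0 (Suc 0) (Suc 0) = rho_s n1 n2 * iota_s n1 n2" "inv_monom n1 n2 (Suc 0) 0 0 0 0 = mfps_X 1"
  "inv_monom n1 n2 (Suc 0) 0 0 0 (Suc 0) = mfps_X 1 * iota_s n1 n2"
  by (simp_all add: inv_monom_def)

lemma X1_jet: "cjet (\<lambda>x. complex_of_real (x $ 1)) X1"
  unfolding X1_def by (intro cjet_intros has_jet_intros)

lemma sum_lessThan_10: "(\<Sum>i<10. h i) = h 0 + h 1 + h 2 + h 3 + h 4 + h 5 + h 6 + h 7 + h 8 + h (9 :: nat)"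
  for h :: "nat \<Rightarrow> 'b::comm_monoid_add"
  by (simp add: eval_nat_numeral lessThan_Suc add_ac)

lemma sum_lessThan_16:
  "(\<Sum>i<16. h i) = h 0 + h 1 + h 2 + h 3 + h 4 + h 5 + h 6 + h 7 + h 8 + h 9
      + h 10 + h 11 + h 12 + h 13 + h 14 + h (15 :: nat)"
  for h :: "nat \<Rightarrow> 'b::comm_monoid_add"
  by (simp add: eval_nat_numeral lessThan_Suc add_ac)

lemma taylor_normal_form_A:
  assumes f: "\<And>i. i \<le> 9 \<Longrightarrow> has_jet (f i) (s i)"
  shows "taylor_map (normal_form_A n1 n2 w1 w2 f) j
    = (lin_part (L_matrix w1 w2) + (\<Sum>i<10. mfps_subst (s i) XA *s gen_of gensA i)) $ j"
proof -
  define m where "m = (\<lambda>i. mfps_subst (s i) XA)"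
  let ?M = "\<lambda>i. creal (m i)" and ?I = "iota_s n1 n2" and ?P = "rho_s n1 n2"
    and ?J = "creal (iota_s n1 n2)" and ?Q = "creal (rho_s n1 n2)" and ?U = "U1 n1 n2" and ?V = "U2 n1 n2"
  let ?p = "mfps_X 2 + mfps_X 1 * ?I * m 0"
  let ?q = "m 1 + mfps_X 2 * ?I * m 0"
  let ?S = "cconst (- \<i> * w1) * Z1 + cconst \<i> * Z1 * ?M 2 + cconst \<i> * ?U * ?M 3 + Z1 * ?J * ?M 4 + ?U * ?J * ?M 5"
  let ?T = "cconst (- \<i> * w2) * Z2 + cconst \<i> * Z2 * ?M 6 + cconst \<i> * ?V * ?M 7 + Z2 * ?J * ?M 8 + ?V * ?J * ?M 9"
  have m: "has_jet (\<lambda>x. f i (vector [x $ 1, (cmod (z1 x))\<^sup>2, (cmod (z2 x))\<^sup>2, rho n1 n2 x])) (m i)"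
    if "i \<le> 9" for i
    unfolding m_def by (rule has_jet_XA) (rule f[OF that])
  have "taylor_map (normal_form_A n1 n2 w1 w2 f) j = (emb0 (creal ?p) (creal ?q) + emb1 ?S + emb2 ?T) $ j"
    unfolding normal_form_A_def[abs_def] Let_def
    by (intro taylor_map_pack has_jet_invariants m X1_jet cjet_z cjet_u has_jet_intros cjet_intros) simp_all
  also have "emb0 (creal ?p) (creal ?q) + emb1 ?S + emb2 ?T
      = lin_part (L_matrix w1 w2) + (\<Sum>i<10. m i *s gen_of gensA i)"
    unfolding sum_lessThan_10
    by (simp add: gen_of_def gensA_def Vf_simps Pm_small smult_emb lin_part_emb vec_eq_iff forall_6
        emb0_def emb1_def emb2_def X1_def X2_def power2_eq_square algebra_simps)
  finally show ?thesis by (simp add: m_def)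
qed

lemma taylor_normal_form_B:
  assumes f: "\<And>i. i \<le> 9 \<Longrightarrow> has_jet (f i) (s i)"
  shows "taylor_map (normal_form_B n1 n2 w1 w2 f) j
    = (lin_part (L_matrix w1 w2) + (\<Sum>i<10. mfps_subst (s i) XB *s gen_of gensB i)) $ j"
proof -
  define m where "m = (\<lambda>i. mfps_subst (s i) XB)"
  let ?M = "\<lambda>i. creal (m i)" and ?I = "iota_s n1 n2" and ?P = "rho_s n1 n2"
    and ?J = "creal (iota_s n1 n2)" and ?Q = "creal (rho_s n1 n2)" and ?U = "U1 n1 n2" and ?V = "U2 n1 n2"
  let ?p = "mfps_X 2 + mfps_X 1 * ?P * ?I * m 0"
  let ?q = "m 1 + mfps_X 2 * ?P * ?I * m 0"
  let ?S = "cconst (- \<i> * w1) * Z1 + cconst \<i> * Z1 * ?M 2 + ?U * ?J * ?M 3 + cconst \<i> * ?U * ?Q * ?M 4 + Z1 * ?Q * ?J * ?M 5"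
  let ?T = "cconst (- \<i> * w2) * Z2 + cconst \<i> * Z2 * ?M 6 + ?V * ?J * ?M 7 + cconst \<i> * ?V * ?Q * ?M 8 + Z2 * ?Q * ?J * ?M 9"
  have m: "has_jet (\<lambda>x. f i (vector [x $ 1, (cmod (z1 x))\<^sup>2, (cmod (z2 x))\<^sup>2, (rho n1 n2 x)\<^sup>2])) (m i)"
    if "i \<le> 9" for i
    unfolding m_def by (rule has_jet_XB) (rule f[OF that])
  have "taylor_map (normal_form_B n1 n2 w1 w2 f) j = (emb0 (creal ?p) (creal ?q) + emb1 ?S + emb2 ?T) $ j"
    unfolding normal_form_B_def[abs_def] Let_def
    by (intro taylor_map_pack has_jet_invariants m X1_jet cjet_z cjet_u has_jet_intros cjet_intros) simp_all
  also have "emb0 (creal ?p) (creal ?q) + emb1 ?S + emb2 ?T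
      = lin_part (L_matrix w1 w2) + (\<Sum>i<10. m i *s gen_of gensB i)"
    unfolding sum_lessThan_10
    by (simp add: gen_of_def gensB_def Vf_simps Pm_small smult_emb lin_part_emb vec_eq_iff forall_6
        emb0_def emb1_def emb2_def X1_def X2_def power2_eq_square algebra_simps)
  finally show ?thesis by (simp add: m_def)
qed

lemma taylor_normal_form_C:
  assumes f: "\<And>i. i \<le> 9 \<Longrightarrow> has_jet (f i) (s i)"
  shows "taylor_map (normal_form_C n1 n2 w1 w2 f) j
    = (lin_part (L_matrix w1 w2) + (\<Sum>i<10. mfps_subst (s i) XC *s gen_of gensC i)) $ j"
proof -
  define m where "m = (\<lambda>i. mfps_subst (s i) XC)"
  let ?M = "\<lambda>i. creal (m i)" and ?I = "iota_s n1 n2" and ?P = "rho_s n1 n2"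
    and ?J = "creal (iota_s n1 n2)" and ?Q = "creal (rho_s n1 n2)" and ?U = "U1 n1 n2" and ?V = "U2 n1 n2"
  let ?p = "mfps_X 2 + mfps_X 1 * ?I * m 0"
  let ?q = "mfps_X 1 * m 1 + mfps_X 2 * ?I * m 0"
  let ?S = "cconst (- \<i> * w1) * Z1 + cconst \<i> * Z1 * ?M 2 + cconst \<i> * ?U * ?M 3 + Z1 * ?J * ?M 4 + ?U * ?J * ?M 5"
  let ?T = "cconst (- \<i> * w2) * Z2 + cconst \<i> * Z2 * ?M 6 + cconst \<i> * ?V * ?M 7 + Z2 * ?J * ?M 8 + ?V * ?J * ?M 9"
  have m: "has_jet (\<lambda>x. f i (vector [(x $ 1)\<^sup>2, (cmod (z1 x))\<^sup>2, (cmod (z2 x))\<^sup>2, rho n1 n2 x])) (m i)"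
    if "i \<le> 9" for i
    unfolding m_def by (rule has_jet_XC) (rule f[OF that])
  have "taylor_map (normal_form_C n1 n2 w1 w2 f) j = (emb0 (creal ?p) (creal ?q) + emb1 ?S + emb2 ?T) $ j"
    unfolding normal_form_C_def[abs_def] Let_def
    by (intro taylor_map_pack has_jet_invariants m X1_jet cjet_z cjet_u has_jet_intros cjet_intros) simp_all
  also have "emb0 (creal ?p) (creal ?q) + emb1 ?S + emb2 ?T
      = lin_part (L_matrix w1 w2) + (\<Sum>i<10. m i *s gen_of gensC i)"
    unfolding sum_lessThan_10
    by (simp add: gen_of_def gensC_def Vf_simps Pm_small smult_emb lin_part_emb vec_eq_iff forall_6
        emb0_def emb1_def emb2_def X1_def X2_def power2_eq_square algebra_simps)
  finally show ?thesis by (simp add: m_def)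
qed

lemma taylor_normal_form_D:
  assumes f: "\<And>i. i \<le> 15 \<Longrightarrow> has_jet (f i) (s i)"
  shows "taylor_map (normal_form_D n1 n2 w1 w2 f) j
    = (lin_part (L_matrix w1 w2) + (\<Sum>i<16. mfps_subst (s i) XD *s gen_of gensD i)) $ j"
proof -
  define m where "m = (\<lambda>i. mfps_subst (s i) XD)"
  let ?M = "\<lambda>i. creal (m i)" and ?I = "iota_s n1 n2" and ?P = "rho_s n1 n2"
    and ?J = "creal (iota_s n1 n2)" and ?Q = "creal (rho_s n1 n2)" and ?U = "U1 n1 n2" and ?V = "U2 n1 n2"
  let ?p = "mfps_X 2 + mfps_X 1 ^ 2 * ?I * m 0 + mfps_X 1 * ?P * ?I * m 1"
  let ?q = "mfps_X 1 * m 2 + mfps_X 1 * mfps_X 2 * ?I * m 0 + ?P * m 3 + mfps_X 2 * ?P * ?I * m 1"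
  let ?S = "cconst (- \<i> * w1) * Z1 + cconst \<i> * Z1 * ?M 4 + ?U * ?J * ?M 5 + cconst \<i> * X1 * ?U * ?M 6 + X1 * Z1 * ?J * ?M 7
        + cconst \<i> * ?U * ?Q * ?M 8 + Z1 * ?Q * ?J * ?M 9"
  let ?T = "cconst (- \<i> * w2) * Z2 + cconst \<i> * Z2 * ?M 10 + ?V * ?J * ?M 11 + cconst \<i> * X1 * ?V * ?M 12 + X1 * Z2 * ?J * ?M 13
        + cconst \<i> * ?V * ?Q * ?M 14 + Z2 * ?Q * ?J * ?M 15"
  have m: "has_jet (\<lambda>x. f i (vector [(x $ 1)\<^sup>2, (cmod (z1 x))\<^sup>2, (cmod (z2 x))\<^sup>2, (rho n1 n2 x)\<^sup>2, x $ 1 * rho n1 n2 x])) (m i)"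
    if "i \<le> 15" for i
    unfolding m_def by (rule has_jet_XD) (rule f[OF that])
  have "taylor_map (normal_form_D n1 n2 w1 w2 f) j = (emb0 (creal ?p) (creal ?q) + emb1 ?S + emb2 ?T) $ j"
    unfolding normal_form_D_def[abs_def] Let_def
    by (intro taylor_map_pack has_jet_invariants m X1_jet cjet_z cjet_u has_jet_intros cjet_intros) simp_all
  also have "emb0 (creal ?p) (creal ?q) + emb1 ?S + emb2 ?T
      = lin_part (L_matrix w1 w2) + (\<Sum>i<16. m i *s gen_of gensD i)"
    unfolding sum_lessThan_16
    by (simp add: gen_of_def gensD_def Vf_simps Pm_small smult_emb lin_part_emb vec_eq_iff forall_6
        emb0_def emb1_def emb2_def X1_def X2_def power2_eq_square algebra_simps)
  finally show ?thesis by (simp add: m_def)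
qed

text \<open>Borel's lemma turns the coefficient series into smooth germs; since jets determine
  Taylor series, the normal form built from these germs has the series that
  \<open>formal_conjugacy\<close> asks for.\<close>

lemma conjugate_to_normal_form:
  fixes F :: "real^6 \<Rightarrow> real^6" and X :: "'m::finite \<Rightarrow> 6 mfps" and nf :: "(nat \<Rightarrow> real^'m \<Rightarrow> real) \<Rightarrow> real^6 \<Rightarrow> real^6"
  assumes F: "smooth_on UNIV F" "F 0 = 0" "(F has_derivative (\<lambda>v. L_matrix w1 w2 *v v)) (at 0)"
      "reversing phi F" "reversing (psi a0 a1 a2) F"
    and gens: "complete_gens X (gen_of t) I" "I = length t" "\<forall>(a, d, e, i) \<in> set t. i \<le> 9"
    and X: "\<exists>w. (\<forall>j. homogeneous (w j) (X j)) \<and> (\<forall>j. w j \<ge> 1)"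
    and nf: "\<And>f s j. (\<And>i. i < I \<Longrightarrow> has_jet (f i) (s i)) \<Longrightarrow> taylor_map (nf f) j
        = (lin_part (L_matrix w1 w2) + (\<Sum>i<I. mfps_subst (s i) X *s gen_of t i)) $ j"
  shows "\<exists>f. (\<forall>i<I. smooth_germ (f i)) \<and> formally_conjugate {phi, psi a0 a1 a2} F (nf f)"
proof -
  obtain w where w: "\<And>j. homogeneous (w j) (X j)" "\<And>j. w j \<ge> 1"
    using X by blast
  have "\<forall>l. \<exists>o'. l < I \<longrightarrow> (\<forall>j. homogeneous o' (gen_of t l $ j))"
    using gen_of_hom[OF gens(3)] unfolding gens(2) by blast
  then obtain o' where o': "\<And>l j. l < I \<Longrightarrow> homogeneous (o' l) (gen_of t l $ j)"
    by metis
  obtain s where s: "\<And>Y. (\<And>j. taylor_map Y j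
        = (lin_part (L_matrix w1 w2) + (\<Sum>i<I. mfps_subst (s i) X *s gen_of t i)) $ j)
      \<Longrightarrow> formally_conjugate {phi, psi a0 a1 a2} F Y"
    using formal_conjugacy[OF F gens(1) w o'] by blast
  have "\<forall>i. \<exists>g. has_jet g (s i)"
    using borel_formal by blast
  then obtain f where f: "\<And>i. has_jet (f i) (s i)"
    by metis
  have "formally_conjugate {phi, psi a0 a1 a2} F (nf f)"
    by (rule s) (rule nf[OF f])
  then show ?thesis
    using f has_jet_smooth_germ by blast
qed

end

text \<open>The parity table of the types is a case distinction for the sign of \<open>WW\<close>
  under psi composed with phi.\<close>

lemma system_type_eq:
  assumes "a0 \<in> {1, -1}" "a1 \<in> {1, -1}" "a2 \<in> {1, -1}"
  shows "system_type a0 a1 a2 n1 n2 =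
    (if a0 = 1 then if a1 ^ n2 * a2 ^ n1 = 1 then TypeA else TypeB
     else if a1 ^ n2 * a2 ^ n1 = 1 then TypeC else TypeD)"
  using assms by (auto simp: system_type_def Let_def minus_one_power_iff)

theorem theorem5p2:
  fixes n1 n2 :: nat and \<omega>1 \<omega>2 a0 a1 a2 :: real and F :: "real^6 \<Rightarrow> real^6"
  assumes "n1 \<noteq> 0" and "n2 \<noteq> 0" and "coprime n1 n2"
    and "\<omega>1 \<noteq> 0" and "\<omega>2 \<noteq> 0" and "real n1 * \<omega>2 - real n2 * \<omega>1 = 0"
    and "a0 \<in> {1, -1}" and "a1 \<in> {1, -1}" and "a2 \<in> {1, -1}"
    and "smooth_on UNIV F" and "F 0 = 0"
    and "(F has_derivative (\<lambda>v. L_matrix \<omega>1 \<omega>2 *v v)) (at 0)"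
    and "reversing phi F" and "reversing (psi a0 a1 a2) F"
  shows "case system_type a0 a1 a2 n1 n2 of
      TypeA \<Rightarrow> (\<exists>f :: nat \<Rightarrow> real^4 \<Rightarrow> real. (\<forall>i\<le>9. smooth_germ (f i)) \<and>
        formally_conjugate {phi, psi a0 a1 a2} F (normal_form_A n1 n2 \<omega>1 \<omega>2 f))
    | TypeB \<Rightarrow> (\<exists>f :: nat \<Rightarrow> real^4 \<Rightarrow> real. (\<forall>i\<le>9. smooth_germ (f i)) \<and>
        formally_conjugate {phi, psi a0 a1 a2} F (normal_form_B n1 n2 \<omega>1 \<omega>2 f))
    | TypeC \<Rightarrow> (\<exists>f :: nat \<Rightarrow> real^4 \<Rightarrow> real. (\<forall>i\<le>9. smooth_germ (f i)) \<and>
        formally_conjugate {phi, psi a0 a1 a2} F (normal_form_C n1 n2 \<omega>1 \<omega>2 f))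
    | TypeD \<Rightarrow> (\<exists>f :: nat \<Rightarrow> real^5 \<Rightarrow> real. (\<forall>i\<le>15. smooth_germ (f i)) \<and>
        formally_conjugate {phi, psi a0 a1 a2} F (normal_form_D n1 n2 \<omega>1 \<omega>2 f))"
proof -
  interpret reversible_resonance n1 n2 \<omega>1 \<omega>2 a0 a1 a2
    by unfold_locales (use assms in auto)
  note F = assms(10-14)
  have le: "i \<le> 9 \<longleftrightarrow> i < 10" "i \<le> 15 \<longleftrightarrow> i < 16" for i :: nat
    by auto
  have type: "system_type a0 a1 a2 n1 n2 =
      (if a0 = 1 then if sW = 1 then TypeA else TypeB else if sW = 1 then TypeC else TypeD)"
    unfolding sW_def by (rule system_type_eq[OF assms(7-9)])
  consider "a0 = 1" "sW = 1" | "a0 = 1" "sW = -1" | "a0 = -1" "sW = 1" | "a0 = -1" "sW = -1"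
    using sW_cases assms(7) by auto
  then show ?thesis
  proof cases
    case 1
    have "\<exists>f. (\<forall>i<10. smooth_germ (f i)) \<and> formally_conjugate {phi, psi a0 a1 a2} F (normal_form_A n1 n2 \<omega>1 \<omega>2 f)"
      by (rule conjugate_to_normal_form[OF F complete_gensA[OF 1] _ _ XA_hom taylor_normal_form_A])
         (auto simp: length_gens, simp add: gensA_def, auto)
    moreover have "system_type a0 a1 a2 n1 n2 = TypeA"
      unfolding type using 1 by simp
    ultimately show ?thesis by (simp only: nf_type.case le)
  next
    case 2
    have "\<exists>f. (\<forall>i<10. smooth_germ (f i)) \<and> formally_conjugate {phi, psi a0 a1 a2} F (normal_form_B n1 n2 \<omega>1 \<omega>2 f)"
      by (rule conjugate_to_normal_form[OF F complete_gensB[OF 2] _ _ XB_hom taylor_normal_form_B])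
         (auto simp: length_gens, simp add: gensB_def, auto)
    moreover have "system_type a0 a1 a2 n1 n2 = TypeB"
      unfolding type using 2 by simp
    ultimately show ?thesis by (simp only: nf_type.case le)
  next
    case 3
    have "\<exists>f. (\<forall>i<10. smooth_germ (f i)) \<and> formally_conjugate {phi, psi a0 a1 a2} F (normal_form_C n1 n2 \<omega>1 \<omega>2 f)"
      by (rule conjugate_to_normal_form[OF F complete_gensC[OF 3] _ _ XC_hom taylor_normal_form_C])
         (auto simp: length_gens, simp add: gensC_def, auto)
    moreover have "system_type a0 a1 a2 n1 n2 = TypeC"
      unfolding type using 3 by simp
    ultimately show ?thesis by (simp only: nf_type.case le)
  next
    case 4
    have "\<exists>f. (\<forall>i<16. smooth_germ (f i)) \<and> formally_conjugate {phi, psi a0 a1 a2} F (normal_form_D n1 n2 \<omega>1 \<omega>2 f)"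
      by (rule conjugate_to_normal_form[OF F complete_gensD[OF 4] _ _ XD_hom taylor_normal_form_D])
         (auto simp: length_gens, simp add: gensD_def, auto)
    moreover have "system_type a0 a1 a2 n1 n2 = TypeD"
      unfolding type using 4 by simp
    ultimately show ?thesis by (simp only: nf_type.case le)
  qed
qed

end
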